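(* Consider the particle-free case $N=0$, and let $\Delta t>0$. Let $(\rho_h^n,\mathbf M_h^n,\mathbf E_h^n,\mathbf B_h^n)$, $n=0,1,2,\dots$, be generated by the explicit Euler method with step $\Delta t$ applied to either of the two semi-discrete systems (S$_0$) or (F$_0$) described in the context. Then the following are exactly conserved, i.e. independent of $n$: 1. the total mass $\int_{\Omega_h}\rho_h^n\,dx$; 2. the weak Gauss law residual $\int_{\Omega}\Big(\nabla_w\cdot\mathbf E_h^n-4\pi e\,\frac{\rho_h^n}{m}\Big)\phi_h\,dx$ for every $\phi_h\in\mathring Q_{k+1}$; 3. the divergence $\nabla\cdot\mathbf B_h^n$.
   Context: Let $d=3$, let $\Omega\subset\mathbb R^3$ be a bounded domain with a (finite, conforming, polyhedral) partition $\mathcal T_h$ into cells $K$, $\Omega_h=\bigcup_{K\in\mathcal T_h}K$ (identified with $\Omega$), $\mathcal E_h$ the set of interior faces, and $k\ge0$ an integer. The constants $c>0$, $m>0$ and $e\neq0$ (charge) are fixed. For $\mathbf u\in\mathbb R^3$, $\gamma(\mathbf u)=\sqrt{1+\frac{\mathbf u\cdot\mathbf u}{m^2c^2}}$; $\mathbf M^2:=\mathbf M\cdot\mathbf M$. Finite element spaces ($P_k(K)$: polynomials of degree at most $k$ on $K$): $Q_k=\{f\in H^1(\Omega): f|_K\in P_k(K)\ \forall K\}$; $N_k=\{f\in H(\mathrm{curl},\Omega): f|_K\in P_k(K)^d+\mathbf x\times P_k(K)^d\ \forall K\}$; $RT_k=\{f\in H(\mathrm{div},\Omega): f|_K\in P_k(K)^d+\mathbf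 x P_k(K)\ \forall K\}$; $DG_k=\{f\in L^2(\Omega): f|_K\in P_k(K)\ \forall K\}$. $\mathring Q_k$, $\mathring N_k$, $\mathring{RT}_k$ are the subspaces of functions with, respectively, $f=0$, $\mathbf n\times f=0$, $\mathbf n\cdot f=0$ on $\partial\Omega$. The weak divergence $\nabla_w\cdot:\mathring N_k\to\mathring Q_{k+1}$ is defined by $\int_\Omega(\nabla_w\cdot\mathbf E_h)\phi_h\,dx=-\int_\Omega\mathbf E_h\cdot\nabla\phi_h\,dx$ for all $\phi_h\in\mathring Q_{k+1}$. Vector-gradient notation: $(\mathbf a\cdot\nabla\mathbf b)\cdot\mathbf c=\sum_{i,j}a_i(\partial_i b_j)c_j$; gradients of discontinuous piecewise polynomials are taken cell by cell. Jumps and fluxes: for a face $e=K_1\cap K_2\in\mathcal E_h$ (in $\int_e$ and $\mathcal E_h$, $e$ denotes a face, elsewhere the charge), let $\mathbf n_1$ be the unit normal pointing from $K_1$ to $K_2$, $\mathbf n_2=-\mathbf n_1$, $\mathbf n=\mathbf n_1$. For scalars $[\![g]\!]=g_1\mathbf n_1+g_2\mathbf n_2$; for vector fields $[\![\mathbf a]\!]=\mathbf a_1-\mathbf a_2$, $\{\mathbf a\}=\frac{\mathbf a_1+\mathbf a_2}2$, and $(\mathbf a)^*=\{\mathbf a\}+\frac12\frac{\mathbf M_h\cdot\mathbf n}{|\mathbf M_h\cdot\mathbf n|}[\![\mathbf a]\!]$ (quotient taken as $0$ where $\mathbf M_h\cdot\mathbf n=0$). In both systems $\mathbf E_h\in\mathring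 N_k$, $\mathbf B_h\in\mathring{RT}_k$ and $$\int_\Omega\partial_t\mathbf E_h\cdot\boldsymbol\nu_h\,dx=c\int_\Omega\mathbf B_h\cdot(\nabla\times\boldsymbol\nu_h)\,dx-\frac{4\pi e}m\int_\Omega\rho_h\mathbf w_h\cdot\boldsymbol\nu_h\,dx\quad\forall\boldsymbol\nu_h\in\mathring N_k,$$ $$\int_\Omega\partial_t\mathbf B_h\cdot\boldsymbol\tau_h\,dx=-c\int_\Omega\boldsymbol\tau_h\cdot(\nabla\times\mathbf E_h)\,dx\quad\forall\boldsymbol\tau_h\in\mathring{RT}_k.$$ System (S$_0$): $\rho_h\in Q_{k+1}$, $\mathbf M_h\in Q_{k+1}^d$; $\mathbf w_h$ is the $L^2(\Omega)$-projection onto $Q_{k+1}^d$ of $\frac{\mathbf M_h}{\rho_h\gamma(m\mathbf M_h/\rho_h)}$ and $G_h$ the $L^2(\Omega)$-projection onto $Q_{k+1}$ of $\gamma(m\mathbf M_h/\rho_h)-1-\frac{\mathbf M_h^2}{\rho_h^2c^2\gamma(m\mathbf M_h/\rho_h)}$; and, in addition, $$\int_\Omega\partial_t\rho_h\,\phi_h\,dx=\int_\Omega\rho_h\mathbf w_h\cdot\nabla\phi_h\,dx\quad\forall\phi_h\in Q_{k+1},$$ $$\int_\Omega\partial_t\mathbf M_h\cdot\boldsymbol\mu_h\,dx=\int_\Omega(\mathbf w_h\cdot\nabla\boldsymbol\mu_h-\boldsymbol\mu_h\cdot\nabla\mathbf w_h)\cdot\mathbf M_h\,dx-\int_\Omega\rho_h\,\boldsymbol\mu_h\cdot\nabla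 G_h\,c^2\,dx+\frac em\int_\Omega\rho_h\Big(\mathbf E_h+\mathbf w_h\times\frac{\mathbf B_h}c\Big)\cdot\boldsymbol\mu_h\,dx\quad\forall\boldsymbol\mu_h\in Q_{k+1}^d.$$ System (F$_0$): $\rho_h\in DG_{k+1}$, $\mathbf M_h\in RT_k$; $\mathbf w_h$ is the $L^2(\Omega)$-projection onto $RT_k$, and $G_h$ the $L^2(\Omega)$-projection onto $DG_{k+1}$, of the same respective expressions; and, in addition, $$\int_\Omega\partial_t\rho_h\,\phi_h\,dx=\int_\Omega\rho_h\mathbf w_h\cdot\nabla\phi_h\,dx-\sum_{e\in\mathcal E_h}\int_e(\rho_h\mathbf w_h)^*\cdot[\![\phi_h]\!]\,ds\quad\forall\phi_h\in DG_{k+1},$$ $$\begin{aligned}\int_\Omega\partial_t\mathbf M_h\cdot\boldsymbol\mu_h\,dx&=\int_\Omega(\mathbf w_h\cdot\nabla\boldsymbol\mu_h-\boldsymbol\mu_h\cdot\nabla\mathbf w_h)\cdot\mathbf M_h\,dx-\int_\Omega\rho_h\,\boldsymbol\mu_h\cdot\nabla G_h\,c^2\,dx+\frac em\int_\Omega\rho_h\Big(\mathbf E_h+\mathbf w_h\times\frac{\mathbf B_h}c\Big)\cdot\boldsymbol\mu_h\,dx\\&\quad+\sum_{e\in\mathcal E_h}\int_e(\mathbf n\times\mathbf M_h)^*\cdot[\![\boldsymbol\mu_h\times\mathbf w_h]\!]\,ds+\sum_{e\in\mathcal E_h}\int_e(\rho_h\boldsymbol\mu_h)^*\cdot[\![G_h]\!]\,c^2\,ds\quad\forall\boldsymbol\mu_h\in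 RT_k.\end{aligned}$$ Explicit Euler means: each $\partial_t u$ is replaced by $\frac{u^{n+1}-u^n}{\Delta t}$ and all right-hand sides (including $\mathbf w_h,G_h$) are evaluated with the unknowns at step $n$. It is understood that $\rho_h^n$ vanishes nowhere, so that all expressions are defined. *)

theory Defs
  imports "HOL-Analysis.Analysis"
begin

type_synonym point = "real^3"
type_synonym sfield = "real^3 \<Rightarrow> real"
type_synonym vfield = "real^3 \<Rightarrow> real^3"


section \<open>Differential operators and Sobolev spaces\<close>

definition pd :: "3 \<Rightarrow> sfield \<Rightarrow> sfield"
  where "pd i f x = frechet_derivative f (at x) (axis i 1)"

text \<open>These are pointwise operators. Applied to a piecewise polynomial they give the cell-by-cell
  derivative, since they are local and the mesh skeleton is a null set.\<close>

definition grad :: "sfield \<Rightarrow> vfield"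
  where "grad f x = (\<chi> i. pd i f x)"

definition curl :: "vfield \<Rightarrow> vfield"
  where "curl F x = vector
    [pd 2 (\<lambda>y. F y $ 3) x - pd 3 (\<lambda>y. F y $ 2) x,
     pd 3 (\<lambda>y. F y $ 1) x - pd 1 (\<lambda>y. F y $ 3) x,
     pd 1 (\<lambda>y. F y $ 2) x - pd 2 (\<lambda>y. F y $ 1) x]"

text \<open>\<open>(a \<cdot> \<nabla>b) \<cdot> c\<close>\<close>

definition advect :: "vfield \<Rightarrow> vfield \<Rightarrow> vfield \<Rightarrow> sfield"
  where "advect a b c x = (\<Sum>i\<in>UNIV. \<Sum>j\<in>UNIV. a x $ i * pd i (\<lambda>y. b y $ j) x * c x $ j)"

fun Ck :: "nat \<Rightarrow> sfield \<Rightarrow> bool" where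
  "Ck 0 f \<longleftrightarrow> continuous_on UNIV f"
| "Ck (Suc n) f \<longleftrightarrow> (\<forall>x. f differentiable (at x)) \<and> (\<forall>i. Ck n (pd i f))"

definition test_function :: "point set \<Rightarrow> sfield \<Rightarrow> bool"
  where "test_function \<Omega> \<psi> \<longleftrightarrow>
    (\<forall>n. Ck n \<psi>) \<and> (\<exists>C. compact C \<and> C \<subseteq> \<Omega> \<and> (\<forall>x. x \<notin> C \<longrightarrow> \<psi> x = 0))"

definition test_field :: "point set \<Rightarrow> vfield \<Rightarrow> bool"
  where "test_field \<Omega> \<Psi> \<longleftrightarrow> (\<forall>i. test_function \<Omega> (\<lambda>x. \<Psi> x $ i))"

definition L2 :: "point set \<Rightarrow> (real^3 \<Rightarrow> 'b::real_normed_vector) set"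
  where "L2 \<Omega> = {f. f \<in> borel_measurable (lebesgue_on \<Omega>) \<and>
                    integrable (lebesgue_on \<Omega>) (\<lambda>x. (norm (f x))\<^sup>2)}"

definition is_weak_grad :: "point set \<Rightarrow> sfield \<Rightarrow> vfield \<Rightarrow> bool"
  where "is_weak_grad \<Omega> f g \<longleftrightarrow> (\<forall>\<psi> i. test_function \<Omega> \<psi> \<longrightarrow>
    (LINT x|lebesgue_on \<Omega>. f x * pd i \<psi> x) = - (LINT x|lebesgue_on \<Omega>. g x $ i * \<psi> x))"

definition is_weak_curl :: "point set \<Rightarrow> vfield \<Rightarrow> vfield \<Rightarrow> bool"
  where "is_weak_curl \<Omega> f g \<longleftrightarrow> (\<forall>\<Psi>. test_field \<Omega> \<Psi> \<longrightarrow>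
    (LINT x|lebesgue_on \<Omega>. f x \<bullet> curl \<Psi> x) = (LINT x|lebesgue_on \<Omega>. g x \<bullet> \<Psi> x))"

definition is_weak_div :: "point set \<Rightarrow> vfield \<Rightarrow> sfield \<Rightarrow> bool"
  where "is_weak_div \<Omega> f g \<longleftrightarrow> (\<forall>\<psi>. test_function \<Omega> \<psi> \<longrightarrow>
    (LINT x|lebesgue_on \<Omega>. f x \<bullet> grad \<psi> x) = - (LINT x|lebesgue_on \<Omega>. g x * \<psi> x))"

definition H1 :: "point set \<Rightarrow> sfield set"
  where "H1 \<Omega> = {f \<in> L2 \<Omega>. \<exists>g \<in> L2 \<Omega>. is_weak_grad \<Omega> f g}"

definition Hcurl :: "point set \<Rightarrow> vfield set"
  where "Hcurl \<Omega> = {f \<in> L2 \<Omega>. \<exists>g \<in> L2 \<Omega>. is_weak_curl \<Omega> f g}"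

definition Hdiv :: "point set \<Rightarrow> vfield set"
  where "Hdiv \<Omega> = {f \<in> L2 \<Omega>. \<exists>g \<in> L2 \<Omega>. is_weak_div \<Omega> f g}"

text \<open>The operators on \<^const>\<open>Hcurl\<close> and \<^const>\<open>Hdiv\<close>. Their values are determined
  up to a null set, so the choice of a representative is immaterial under integrals and
  almost everywhere.\<close>

definition weak_curl :: "point set \<Rightarrow> vfield \<Rightarrow> vfield"
  where "weak_curl \<Omega> f = (SOME g. g \<in> L2 \<Omega> \<and> is_weak_curl \<Omega> f g)"

definition weak_div :: "point set \<Rightarrow> vfield \<Rightarrow> sfield"
  where "weak_div \<Omega> f = (SOME g. g \<in> L2 \<Omega> \<and> is_weak_div \<Omega> f g)"


section \<open>Meshes\<close>

text \<open>Cells are closed convex polytopes; conformity means that two cells meet in a common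
  (possibly empty) face. Distinct cells then have disjoint interiors. Asking for
  \<open>\<Omega> = interior (\<Union>\<T>)\<close> makes the identification of the two exact: it
  excludes cracks along faces.\<close>

definition conforming_mesh :: "point set \<Rightarrow> point set set \<Rightarrow> bool"
  where "conforming_mesh \<Omega> \<T> \<longleftrightarrow>
    finite \<T> \<and>
    (\<forall>K\<in>\<T>. polytope K \<and> interior K \<noteq> {}) \<and>
    (\<forall>K\<in>\<T>. \<forall>K'\<in>\<T>. (K \<inter> K') face_of K \<and> (K \<inter> K') face_of K') \<and>
    \<Omega> = interior (\<Union>\<T>)"

definition interior_faces :: "point set set \<Rightarrow> point set set"
  where "interior_faces \<T> =
    {K1 \<inter> K2 | K1 K2. K1 \<in> \<T> \<and> K2 \<in> \<T> \<and> K1 \<noteq> K2 \<and> aff_dim (K1 \<inter> K2) = 2}"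

definition boundary_faces :: "point set \<Rightarrow> point set \<Rightarrow> point set set"
  where "boundary_faces \<Omega> K = {F. F facet_of K \<and> F \<subseteq> frontier \<Omega>}"

definition unit_normal :: "point set \<Rightarrow> point \<Rightarrow> bool"
  where "unit_normal F n \<longleftrightarrow> norm n = 1 \<and> (\<forall>x\<in>F. \<forall>y\<in>F. n \<bullet> (x - y) = 0)"

text \<open>One-sided trace from the cell \<open>K\<close>; for a function that is polynomial on the interior
  of \<open>K\<close> this is the value of that polynomial, at every point of \<open>K\<close>.\<close>

definition trace :: "point set \<Rightarrow> (real^3 \<Rightarrow> 'b::t2_space) \<Rightarrow> real^3 \<Rightarrow> 'b"
  where "trace K f x = Lim (at x within interior K) f"


section \<open>Finite element spaces\<close>

text \<open>Elements are functions on \<open>\<real>\<^sup>3\<close> that are polynomial on the interior of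
  every cell. Their values on the skeleton and outside the domain are unconstrained and never used:
  boundary and face values are traces.\<close>

definition Pol :: "nat \<Rightarrow> sfield set"
  where "Pol k = {p. \<exists>a :: (3 \<Rightarrow> nat) \<Rightarrow> real. \<forall>x.
    p x = (\<Sum>\<alpha> | (\<Sum>i\<in>UNIV. \<alpha> i) \<le> k. a \<alpha> * (\<Prod>i\<in>UNIV. (x $ i) ^ \<alpha> i))}"

definition PolV :: "nat \<Rightarrow> vfield set"
  where "PolV k = {p. \<forall>i. (\<lambda>x. p x $ i) \<in> Pol k}"

definition Q :: "point set \<Rightarrow> point set set \<Rightarrow> nat \<Rightarrow> sfield set"
  where "Q \<Omega> \<T> k = {f \<in> H1 \<Omega>. \<forall>K\<in>\<T>. \<exists>p\<in>Pol k. \<forall>x\<in>interior K. f x = p x}"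

definition QV :: "point set \<Rightarrow> point set set \<Rightarrow> nat \<Rightarrow> vfield set"
  where "QV \<Omega> \<T> k = {f. \<forall>i. (\<lambda>x. f x $ i) \<in> Q \<Omega> \<T> k}"

definition Ned :: "point set \<Rightarrow> point set set \<Rightarrow> nat \<Rightarrow> vfield set"
  where "Ned \<Omega> \<T> k = {f \<in> Hcurl \<Omega>. \<forall>K\<in>\<T>. \<exists>p\<in>PolV k. \<exists>q\<in>PolV k.
    \<forall>x\<in>interior K. f x = p x + cross3 x (q x)}"

definition RT :: "point set \<Rightarrow> point set set \<Rightarrow> nat \<Rightarrow> vfield set"
  where "RT \<Omega> \<T> k = {f \<in> Hdiv \<Omega>. \<forall>K\<in>\<T>. \<exists>p\<in>PolV k. \<exists>q\<in>Pol k.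
    \<forall>x\<in>interior K. f x = p x + q x *\<^sub>R x}"

definition DG :: "point set \<Rightarrow> point set set \<Rightarrow> nat \<Rightarrow> sfield set"
  where "DG \<Omega> \<T> k = {f \<in> L2 \<Omega>. \<forall>K\<in>\<T>. \<exists>p\<in>Pol k. \<forall>x\<in>interior K. f x = p x}"

definition Q0 :: "point set \<Rightarrow> point set set \<Rightarrow> nat \<Rightarrow> sfield set"
  where "Q0 \<Omega> \<T> k = {f \<in> Q \<Omega> \<T> k.
    \<forall>K\<in>\<T>. \<forall>F\<in>boundary_faces \<Omega> K. \<forall>x\<in>F. trace K f x = 0}"

definition Ned0 :: "point set \<Rightarrow> point set set \<Rightarrow> nat \<Rightarrow> vfield set"
  where "Ned0 \<Omega> \<T> k = {f \<in> Ned \<Omega> \<T> k.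
    \<forall>K\<in>\<T>. \<forall>F\<in>boundary_faces \<Omega> K. \<forall>n. unit_normal F n \<longrightarrow>
      (\<forall>x\<in>F. cross3 n (trace K f x) = 0)}"

definition RT0 :: "point set \<Rightarrow> point set set \<Rightarrow> nat \<Rightarrow> vfield set"
  where "RT0 \<Omega> \<T> k = {f \<in> RT \<Omega> \<T> k.
    \<forall>K\<in>\<T>. \<forall>F\<in>boundary_faces \<Omega> K. \<forall>n. unit_normal F n \<longrightarrow>
      (\<forall>x\<in>F. n \<bullet> trace K f x = 0)}"

text \<open>In the next two definitions the chosen function is unique up to a null set, because the
  finite element spaces are finite-dimensional modulo functions vanishing almost everywhere.\<close>

definition L2_projection ::
    "point set \<Rightarrow> (real^3 \<Rightarrow> 'b::real_inner) set \<Rightarrow> (real^3 \<Rightarrow> 'b) \<Rightarrow> real^3 \<Rightarrow> 'b"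
  where "L2_projection \<Omega> V f = (SOME w. w \<in> V \<and> (\<forall>v\<in>V.
    (LINT x|lebesgue_on \<Omega>. w x \<bullet> v x) = (LINT x|lebesgue_on \<Omega>. f x \<bullet> v x)))"

text \<open>\<open>\<nabla>\<^sub>w\<cdot>\<close>, the discrete divergence (not the distributional \<^const>\<open>weak_div\<close>).\<close>

definition nabla_w :: "point set \<Rightarrow> point set set \<Rightarrow> nat \<Rightarrow> vfield \<Rightarrow> sfield"
  where "nabla_w \<Omega> \<T> k E = (SOME d. d \<in> Q0 \<Omega> \<T> (k+1) \<and> (\<forall>\<phi>\<in>Q0 \<Omega> \<T> (k+1).
    (LINT x|lebesgue_on \<Omega>. d x * \<phi> x) = - (LINT x|lebesgue_on \<Omega>. E x \<bullet> grad \<phi> x)))"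


section \<open>Face integrals, jumps and fluxes\<close>

text \<open>Surface integral over a subset of a plane, by an isometric parametrisation of the plane.\<close>

definition face_integral :: "point set \<Rightarrow> sfield \<Rightarrow> real"
  where "face_integral F g =
    (let (a, L) = (SOME (a, L :: real^2 \<Rightarrow> real^3).
                     linear L \<and> (\<forall>y. norm (L y) = norm y) \<and> F \<subseteq> range (\<lambda>y. a + L y))
     in LINT y|lebesgue_on {y. a + L y \<in> F}. g (a + L y))"

text \<open>A labelling of the two cells at a face. All face integrands below are invariant under
  exchanging the labels.\<close>

definition face_cells :: "point set set \<Rightarrow> point set \<Rightarrow> point set \<times> point set"
  where "face_cells \<T> F = (SOME (K1, K2). K1 \<in> \<T> \<and> K2 \<in> \<T> \<and> K1 \<noteq> K2 \<and> F = K1 \<inter> K2)"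

definition cell1 :: "point set set \<Rightarrow> point set \<Rightarrow> point set"
  where "cell1 \<T> F = fst (face_cells \<T> F)"

definition cell2 :: "point set set \<Rightarrow> point set \<Rightarrow> point set"
  where "cell2 \<T> F = snd (face_cells \<T> F)"

text \<open>The unit normal pointing from \<^const>\<open>cell1\<close> to \<^const>\<open>cell2\<close>: the normal of the plane
  that separates the two convex cells.\<close>

definition nrm :: "point set set \<Rightarrow> point set \<Rightarrow> point"
  where "nrm \<T> F = (THE n. norm n = 1 \<and>
    (\<exists>b. (\<forall>x\<in>cell1 \<T> F. n \<bullet> x \<le> b) \<and> (\<forall>x\<in>cell2 \<T> F. b \<le> n \<bullet> x)))"

definition jump_s :: "point set set \<Rightarrow> point set \<Rightarrow> sfield \<Rightarrow> vfield"
  where "jump_s \<T> F g x =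
    trace (cell1 \<T> F) g x *\<^sub>R nrm \<T> F + trace (cell2 \<T> F) g x *\<^sub>R (- nrm \<T> F)"

definition jump_v :: "point set set \<Rightarrow> point set \<Rightarrow> vfield \<Rightarrow> vfield"
  where "jump_v \<T> F a x = trace (cell1 \<T> F) a x - trace (cell2 \<T> F) a x"

definition avg :: "point set set \<Rightarrow> point set \<Rightarrow> vfield \<Rightarrow> vfield"
  where "avg \<T> F a x = (1/2) *\<^sub>R (trace (cell1 \<T> F) a x + trace (cell2 \<T> F) a x)"

text \<open>The flux \<open>(a)\<^sup>*\<close>. The normal component of \<open>M \<in> RT\<^sub>k\<close> is single-valued on an
  interior face, so it may be taken from either side; \<open>sgn 0 = 0\<close> is the stated convention.\<close>

definition upwind :: "point set set \<Rightarrow> vfield \<Rightarrow> point set \<Rightarrow> vfield \<Rightarrow> vfield"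
  where "upwind \<T> M F a x =
    avg \<T> F a x + (1/2 * sgn (trace (cell1 \<T> F) M x \<bullet> nrm \<T> F)) *\<^sub>R jump_v \<T> F a x"


section \<open>The explicit Euler schemes\<close>

definition lorentz :: "real \<Rightarrow> real \<Rightarrow> point \<Rightarrow> real"
  where "lorentz c m u = sqrt (1 + (u \<bullet> u) / (m\<^sup>2 * c\<^sup>2))"

definition w_expr :: "real \<Rightarrow> real \<Rightarrow> sfield \<Rightarrow> vfield \<Rightarrow> vfield"
  where "w_expr c m \<rho> M x =
    (1 / (\<rho> x * lorentz c m ((m / \<rho> x) *\<^sub>R M x))) *\<^sub>R M x"

definition G_expr :: "real \<Rightarrow> real \<Rightarrow> sfield \<Rightarrow> vfield \<Rightarrow> sfield"
  where "G_expr c m \<rho> M x =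
    lorentz c m ((m / \<rho> x) *\<^sub>R M x) - 1
    - (M x \<bullet> M x) / ((\<rho> x)\<^sup>2 * c\<^sup>2 * lorentz c m ((m / \<rho> x) *\<^sub>R M x))"

text \<open>In all predicates below primed unknowns belong to step \<open>n + 1\<close>, unprimed ones to step
  \<open>n\<close>; \<open>e\<close> is the charge and \<open>F\<close> ranges over faces.\<close>

definition maxwell_step ::
    "point set \<Rightarrow> point set set \<Rightarrow> nat \<Rightarrow> real \<Rightarrow> real \<Rightarrow> real \<Rightarrow> real \<Rightarrow>
     sfield \<Rightarrow> vfield \<Rightarrow> vfield \<Rightarrow> vfield \<Rightarrow> vfield \<Rightarrow> vfield \<Rightarrow> bool"
  where "maxwell_step \<Omega> \<T> k c m e dt \<rho> w E B E' B' \<longleftrightarrow>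
    (\<forall>\<nu>\<in>Ned0 \<Omega> \<T> k.
      (LINT x|lebesgue_on \<Omega>. ((1/dt) *\<^sub>R (E' x - E x)) \<bullet> \<nu> x) =
        c * (LINT x|lebesgue_on \<Omega>. B x \<bullet> weak_curl \<Omega> \<nu> x)
        - 4 * pi * e / m * (LINT x|lebesgue_on \<Omega>. (\<rho> x *\<^sub>R w x) \<bullet> \<nu> x)) \<and>
    (\<forall>\<tau>\<in>RT0 \<Omega> \<T> k.
      (LINT x|lebesgue_on \<Omega>. ((1/dt) *\<^sub>R (B' x - B x)) \<bullet> \<tau> x) =
        - c * (LINT x|lebesgue_on \<Omega>. \<tau> x \<bullet> weak_curl \<Omega> E x))"

text \<open>The volume terms of the momentum equation, common to both systems.\<close>

definition momentum_volume ::
    "point set \<Rightarrow> real \<Rightarrow> real \<Rightarrow> real \<Rightarrow>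
     sfield \<Rightarrow> vfield \<Rightarrow> vfield \<Rightarrow> vfield \<Rightarrow> vfield \<Rightarrow> sfield \<Rightarrow> vfield \<Rightarrow> real"
  where "momentum_volume \<Omega> c m e \<rho> M E B w G \<mu> =
    (LINT x|lebesgue_on \<Omega>. advect w \<mu> M x - advect \<mu> w M x)
    - (LINT x|lebesgue_on \<Omega>. \<rho> x * (\<mu> x \<bullet> grad G x) * c\<^sup>2)
    + e / m * (LINT x|lebesgue_on \<Omega>. \<rho> x * ((E x + cross3 (w x) ((1/c) *\<^sub>R B x)) \<bullet> \<mu> x))"

definition step_S0 ::
    "point set \<Rightarrow> point set set \<Rightarrow> nat \<Rightarrow> real \<Rightarrow> real \<Rightarrow> real \<Rightarrow> real \<Rightarrow>
     sfield \<Rightarrow> vfield \<Rightarrow> vfield \<Rightarrow> vfield \<Rightarrow> sfield \<Rightarrow> vfield \<Rightarrow> vfield \<Rightarrow> vfield \<Rightarrow> bool"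
  where "step_S0 \<Omega> \<T> k c m e dt \<rho> M E B \<rho>' M' E' B' \<longleftrightarrow>
    (let w = L2_projection \<Omega> (QV \<Omega> \<T> (k+1)) (w_expr c m \<rho> M);
         G = L2_projection \<Omega> (Q \<Omega> \<T> (k+1)) (G_expr c m \<rho> M)
     in maxwell_step \<Omega> \<T> k c m e dt \<rho> w E B E' B' \<and>
        (\<forall>\<phi>\<in>Q \<Omega> \<T> (k+1).
          (LINT x|lebesgue_on \<Omega>. (\<rho>' x - \<rho> x) / dt * \<phi> x) =
            (LINT x|lebesgue_on \<Omega>. (\<rho> x *\<^sub>R w x) \<bullet> grad \<phi> x)) \<and>
        (\<forall>\<mu>\<in>QV \<Omega> \<T> (k+1).
          (LINT x|lebesgue_on \<Omega>. ((1/dt) *\<^sub>R (M' x - M x)) \<bullet> \<mu> x) =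
            momentum_volume \<Omega> c m e \<rho> M E B w G \<mu>))"

definition step_F0 ::
    "point set \<Rightarrow> point set set \<Rightarrow> nat \<Rightarrow> real \<Rightarrow> real \<Rightarrow> real \<Rightarrow> real \<Rightarrow>
     sfield \<Rightarrow> vfield \<Rightarrow> vfield \<Rightarrow> vfield \<Rightarrow> sfield \<Rightarrow> vfield \<Rightarrow> vfield \<Rightarrow> vfield \<Rightarrow> bool"
  where "step_F0 \<Omega> \<T> k c m e dt \<rho> M E B \<rho>' M' E' B' \<longleftrightarrow>
    (let w = L2_projection \<Omega> (RT \<Omega> \<T> k) (w_expr c m \<rho> M);
         G = L2_projection \<Omega> (DG \<Omega> \<T> (k+1)) (G_expr c m \<rho> M)
     in maxwell_step \<Omega> \<T> k c m e dt \<rho> w E B E' B' \<and>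
        (\<forall>\<phi>\<in>DG \<Omega> \<T> (k+1).
          (LINT x|lebesgue_on \<Omega>. (\<rho>' x - \<rho> x) / dt * \<phi> x) =
            (LINT x|lebesgue_on \<Omega>. (\<rho> x *\<^sub>R w x) \<bullet> grad \<phi> x)
            - (\<Sum>F\<in>interior_faces \<T>. face_integral F
                (\<lambda>x. upwind \<T> M F (\<lambda>y. \<rho> y *\<^sub>R w y) x \<bullet> jump_s \<T> F \<phi> x))) \<and>
        (\<forall>\<mu>\<in>RT \<Omega> \<T> k.
          (LINT x|lebesgue_on \<Omega>. ((1/dt) *\<^sub>R (M' x - M x)) \<bullet> \<mu> x) =
            momentum_volume \<Omega> c m e \<rho> M E B w G \<mu>
            + (\<Sum>F\<in>interior_faces \<T>. face_integral F
                (\<lambda>x. upwind \<T> M F (\<lambda>y. cross3 (nrm \<T> F) (M y)) x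
                      \<bullet> jump_v \<T> F (\<lambda>y. cross3 (\<mu> y) (w y)) x))
            + (\<Sum>F\<in>interior_faces \<T>. face_integral F
                (\<lambda>x. upwind \<T> M F (\<lambda>y. \<rho> y *\<^sub>R \<mu> y) x \<bullet> jump_s \<T> F G x * c\<^sup>2))))"

definition euler_S0 ::
    "point set \<Rightarrow> point set set \<Rightarrow> nat \<Rightarrow> real \<Rightarrow> real \<Rightarrow> real \<Rightarrow> real \<Rightarrow>
     (nat \<Rightarrow> sfield) \<Rightarrow> (nat \<Rightarrow> vfield) \<Rightarrow> (nat \<Rightarrow> vfield) \<Rightarrow> (nat \<Rightarrow> vfield) \<Rightarrow> bool"
  where "euler_S0 \<Omega> \<T> k c m e dt \<rho> M E B \<longleftrightarrow>
    (\<forall>n. \<rho> n \<in> Q \<Omega> \<T> (k+1) \<and> M n \<in> QV \<Omega> \<T> (k+1) \<and> E n \<in> Ned0 \<Omega> \<T> k \<and> B n \<in> RT0 \<Omega> \<T> k) \<and>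
    (\<forall>n. step_S0 \<Omega> \<T> k c m e dt (\<rho> n) (M n) (E n) (B n)
           (\<rho> (Suc n)) (M (Suc n)) (E (Suc n)) (B (Suc n)))"

definition euler_F0 ::
    "point set \<Rightarrow> point set set \<Rightarrow> nat \<Rightarrow> real \<Rightarrow> real \<Rightarrow> real \<Rightarrow> real \<Rightarrow>
     (nat \<Rightarrow> sfield) \<Rightarrow> (nat \<Rightarrow> vfield) \<Rightarrow> (nat \<Rightarrow> vfield) \<Rightarrow> (nat \<Rightarrow> vfield) \<Rightarrow> bool"
  where "euler_F0 \<Omega> \<T> k c m e dt \<rho> M E B \<longleftrightarrow>
    (\<forall>n. \<rho> n \<in> DG \<Omega> \<T> (k+1) \<and> M n \<in> RT \<Omega> \<T> k \<and> E n \<in> Ned0 \<Omega> \<T> k \<and> B n \<in> RT0 \<Omega> \<T> k) \<and>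
    (\<forall>n. step_F0 \<Omega> \<T> k c m e dt (\<rho> n) (M n) (E n) (B n)
           (\<rho> (Suc n)) (M (Suc n)) (E (Suc n)) (B (Suc n)))"

text \<open>Only interior points of cells are considered, where the expressions to be projected are
  evaluated; zeros of traces on the skeleton would be harmless.\<close>

definition nowhere_zero :: "point set set \<Rightarrow> sfield \<Rightarrow> bool"
  where "nowhere_zero \<T> \<rho> \<longleftrightarrow> (\<forall>K\<in>\<T>. \<forall>x\<in>interior K. \<rho> x \<noteq> 0)"

end

theory Submission
  imports Defs
begin

text \<open>Each conserved quantity comes from one choice of test function. With \<open>\<phi> = 1\<close> the right-hand
side of the discrete continuity equation vanishes, which is conservation of mass.

For \<open>\<phi> \<in> Q0\<close> of degree \<open>k + 1\<close> the gradient \<open>\<nabla>\<phi>\<close> lies in \<open>Ned0\<close> of degree \<open>k\<close> and has weak curl zero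
(\<open>grad_Q0_Ned0\<close>, \<open>grad_Hcurl\<close>). Testing Ampere's law with \<open>\<nabla>\<phi>\<close> leaves only the current, which also stands
on the right of the continuity equation tested with \<open>\<phi>\<close>; the two changes over one step cancel in the Gauss
residual. In the discontinuous scheme the continuity equation carries a flux over the interior faces,
multiplied by the jump of the test function. That jump is zero because a piecewise polynomial in
\<open>H1\<close> is continuous across faces (\<open>jump_s_Q_zero\<close>).

The curl maps \<open>Ned0\<close> into \<open>RT0\<close> (\<open>curl_Ned0_RT0\<close>). Hence \<open>r = B' - B + c dt curl E\<close> is itself admissible in Faraday's
law, which then says that \<open>r\<close> is orthogonal to itself. So \<open>B' - B = - c dt curl E\<close> almost everywhere,
and the weak divergence of a curl is zero.

The analytic work lies in two places. The spaces are defined by weak derivatives against smooth test functions,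
whereas the arguments above need the classical derivatives of the polynomials on the cells. The bridge is the
fundamental lemma of the calculus of variations, which requires enough explicit test functions;
they are built from \<open>exp (- 1 / t)\<close>. Second, \<open>nabla_w\<close> is given by a choice operator,
so its defining property needs an existence proof: a Riesz representation for function spaces that are
finite-dimensional only up to null sets (\<open>Riesz_representation_spanned\<close>).\<close>

section \<open>Partial derivatives, gradient and curl\<close>

lemma pd_eqI:
  assumes "(f has_derivative f') (at x)"
  shows "pd i f x = f' (axis i 1)"
  using frechet_derivative_at[OF assms] by (simp add: pd_def)

lemma has_derivative_pd:
  assumes "f differentiable (at x)"
  shows "(f has_derivative (\<lambda>v. \<Sum>i\<in>UNIV. v $ i * pd i f x)) (at x)"
proof -
  let ?D = "frechet_derivative f (at x)"
  have D: "(f has_derivative ?D) (at x)"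
    using assms frechet_derivative_works by blast
  have lin: "linear ?D"
    using D has_derivative_linear by blast
  have "?D v = (\<Sum>i\<in>UNIV. v $ i * pd i f x)" for v :: "real^3"
  proof -
    have "?D v = ?D (\<Sum>i\<in>UNIV. v $ i *\<^sub>R axis i 1)"
      by (simp add: basis_expansion flip: scalar_mult_eq_scaleR)
    then show ?thesis
      using lin by (simp add: linear_sum linear_cmul pd_def)
  qed
  then have "?D = (\<lambda>v. \<Sum>i\<in>UNIV. v $ i * pd i f x)" by blast
  with D show ?thesis by simp
qed

lemma pd_const [simp]: "pd i (\<lambda>x. a) = (\<lambda>x. 0)"
  using pd_eqI[OF has_derivative_const] by blast

lemma pd_coord: "pd i (\<lambda>x. x $ j) x = (if i = j then 1 else 0)"
proof -
  have "((\<lambda>x::real^3. x $ j) has_derivative (\<lambda>v. v $ j)) (at x)"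
    by (intro bounded_linear_imp_has_derivative bounded_linear_vec_nth)
  from pd_eqI[OF this, of i] show ?thesis by (auto simp: axis_def)
qed

lemma pd_add:
  assumes "f differentiable (at x)" "g differentiable (at x)"
  shows "pd i (\<lambda>x. f x + g x) x = pd i f x + pd i g x"
  using pd_eqI[OF has_derivative_add[OF assms[unfolded frechet_derivative_works]]]
  by (simp add: pd_def)

lemma pd_diff:
  assumes "f differentiable (at x)" "g differentiable (at x)"
  shows "pd i (\<lambda>x. f x - g x) x = pd i f x - pd i g x"
  using pd_eqI[OF has_derivative_diff[OF assms[unfolded frechet_derivative_works]]]
  by (simp add: pd_def)

lemma pd_mult:
  assumes "f differentiable (at x)" "g differentiable (at x)"
  shows "pd i (\<lambda>x. f x * g x) x = pd i f x * g x + f x * pd i g x"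
proof -
  have "((\<lambda>x. f x * g x) has_derivative
      (\<lambda>v. f x * frechet_derivative g (at x) v + frechet_derivative f (at x) v * g x)) (at x)"
    using assms by (intro has_derivative_mult) (simp_all add: frechet_derivative_works)
  from pd_eqI[OF this, of i] show ?thesis by (simp add: pd_def)
qed

lemma pd_cmult:
  assumes "f differentiable (at x)"
  shows "pd i (\<lambda>x. a * f x) x = a * pd i f x"
  using pd_mult[of "\<lambda>_. a" x f i] assms by simp

lemma pd_chain:
  assumes "f differentiable (at x)" "(h has_real_derivative h') (at (f x))"
  shows "(\<lambda>x. h (f x)) differentiable (at x)" "pd i (\<lambda>x. h (f x)) x = h' * pd i f x"
proof -
  have D: "((\<lambda>x. h (f x)) has_derivative (\<lambda>v. h' * frechet_derivative f (at x) v)) (at x)"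
    using assms has_derivative_compose[of f "frechet_derivative f (at x)" x UNIV h "(*) h'"]
    by (simp add: frechet_derivative_works has_field_derivative_def)
  show "(\<lambda>x. h (f x)) differentiable (at x)"
    using D differentiableI by blast
  show "pd i (\<lambda>x. h (f x)) x = h' * pd i f x"
    using pd_eqI[OF D, of i] by (simp add: pd_def)
qed

text \<open>Derivatives are local: this is what allows \<open>pd\<close> of a function known only on an open cell to be computed from
the polynomial that it agrees with there.\<close>

lemma pd_transform:
  assumes "open S" "x \<in> S" "\<And>y. y \<in> S \<Longrightarrow> f y = g y"
  shows "pd i f x = pd i g x"
proof -
  have "(f has_derivative D) (at x) \<longleftrightarrow> (g has_derivative D) (at x)" for D
    using has_derivative_transform_within_open[of f D x UNIV S g]
      has_derivative_transform_within_open[of g D x UNIV S f] assms by auto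
  then show ?thesis by (simp add: pd_def frechet_derivative_def)
qed

lemma grad_transform:
  assumes "open S" "x \<in> S" "\<And>y. y \<in> S \<Longrightarrow> f y = g y"
  shows "grad f x = grad g x"
  unfolding grad_def using pd_transform[OF assms] by simp

lemma curl_transform:
  assumes "open S" "x \<in> S" "\<And>y. y \<in> S \<Longrightarrow> E y = F y"
  shows "curl E x = curl F x"
proof -
  have "pd i (\<lambda>y. E y $ j) x = pd i (\<lambda>y. F y $ j) x" for i j
    by (rule pd_transform[OF assms(1,2)]) (simp add: assms(3))
  then show ?thesis by (simp add: curl_def)
qed

lemma continuous_on_vecI:
  fixes f :: vfield
  assumes "\<And>i. continuous_on S (\<lambda>x. f x $ i)"
  shows "continuous_on S f"
  using continuous_on_vec_lambda[of S "\<lambda>i x. f x $ i"] assms by simp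

lemma has_derivative_along_axis:
  assumes "\<And>x. f differentiable (at x)"
  shows "((\<lambda>t. f (x + t *\<^sub>R axis i 1)) has_real_derivative pd i f (x + t *\<^sub>R axis i 1)) (at t)"
proof -
  let ?y = "x + t *\<^sub>R axis i (1::real)"
  let ?D = "frechet_derivative f (at ?y)"
  have D: "(f has_derivative ?D) (at ?y)"
    using assms frechet_derivative_works by blast
  have lin: "linear ?D" using D has_derivative_linear by blast
  have "((\<lambda>t. x + t *\<^sub>R axis i (1::real)) has_derivative (\<lambda>s. s *\<^sub>R axis i 1)) (at t)"
    by (auto intro!: derivative_eq_intros)
  from has_derivative_compose[OF this D]
  have "((\<lambda>t. f (x + t *\<^sub>R axis i 1)) has_derivative (\<lambda>s. ?D (s *\<^sub>R axis i 1))) (at t)" .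
  moreover have "(\<lambda>s. ?D (s *\<^sub>R axis i 1)) = (*) (pd i f ?y)"
    using lin by (auto simp: linear_cmul pd_def)
  ultimately show ?thesis
    by (simp add: has_field_derivative_def)
qed

lemma mean_value_pd:
  assumes "\<And>x. f differentiable (at x)" "0 < h"
  obtains \<xi> where "0 < \<xi>" "\<xi> < h"
    "f (x + h *\<^sub>R axis i 1) - f x = h * pd i f (x + \<xi> *\<^sub>R axis i 1)"
  using MVT2[of 0 h "\<lambda>t. f (x + t *\<^sub>R axis i 1)" "\<lambda>t. pd i f (x + t *\<^sub>R axis i 1)"]
    has_derivative_along_axis[OF assms(1)] assms(2) by auto

lemma pd_translate:
  assumes "\<And>x. f differentiable (at x)"
  shows "(\<lambda>y. f (y + a)) differentiable (at x)" "pd i (\<lambda>y. f (y + a)) x = pd i f (x + a)"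
proof -
  let ?D = "frechet_derivative f (at (x + a))"
  have "(f has_derivative ?D) (at (x + a))"
    using assms frechet_derivative_works by blast
  moreover have "((\<lambda>y. y + a) has_derivative (\<lambda>v. v)) (at x)"
    by (auto intro!: derivative_eq_intros)
  ultimately have D: "((\<lambda>y. f (y + a)) has_derivative ?D) (at x)"
    using has_derivative_compose by fastforce
  show "(\<lambda>y. f (y + a)) differentiable (at x)" using D differentiableI by blast
  show "pd i (\<lambda>y. f (y + a)) x = pd i f (x + a)"
    using pd_eqI[OF D] by (simp add: pd_def)
qed

text \<open>The mean value theorem, applied to the first difference in one direction and then to the derivative in the other.\<close>

lemma second_difference_quotient:
  fixes x :: point
  assumes "\<And>x. f differentiable (at x)" "\<And>x. pd i f differentiable (at x)" and h: "0 < h"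
  shows "\<exists>y. norm (y - x) \<le> 2 * h \<and>
    f (x + h *\<^sub>R axis i 1 + h *\<^sub>R axis j 1) - f (x + h *\<^sub>R axis i 1) - f (x + h *\<^sub>R axis j 1) + f x
      = h * h * pd j (pd i f) y"
proof -
  let ?u = "axis i 1 :: point" and ?v = "axis j 1 :: point"
  let ?g = "\<lambda>y. f (y + h *\<^sub>R ?v) - f y"
  have dg: "\<And>x. ?g differentiable (at x)"
    by (intro differentiable_diff pd_translate assms)
  obtain \<xi> where \<xi>: "0 < \<xi>" "\<xi> < h" "?g (x + h *\<^sub>R ?u) - ?g x = h * pd i ?g (x + \<xi> *\<^sub>R ?u)"
    by (rule mean_value_pd[OF dg h])
  obtain \<eta> where \<eta>: "0 < \<eta>" "\<eta> < h"
    "pd i f (x + \<xi> *\<^sub>R ?u + h *\<^sub>R ?v) - pd i f (x + \<xi> *\<^sub>R ?u) = h * pd j (pd i f) (x + \<xi> *\<^sub>R ?u + \<eta> *\<^sub>R ?v)"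
    by (rule mean_value_pd[OF assms(2) h])
  have "pd i ?g (x + \<xi> *\<^sub>R ?u) = pd i f (x + \<xi> *\<^sub>R ?u + h *\<^sub>R ?v) - pd i f (x + \<xi> *\<^sub>R ?u)"
    by (subst pd_diff) (simp_all add: pd_translate assms)
  moreover have "norm (x + \<xi> *\<^sub>R ?u + \<eta> *\<^sub>R ?v - x) \<le> 2 * h"
    using norm_triangle_ineq[of "\<xi> *\<^sub>R ?u" "\<eta> *\<^sub>R ?v"] \<xi>(1,2) \<eta>(1,2) by (simp add: algebra_simps)
  ultimately show ?thesis
    using \<xi>(3) \<eta>(3) by (intro exI[of _ "x + \<xi> *\<^sub>R ?u + \<eta> *\<^sub>R ?v"]) (simp add: algebra_simps)
qed

text \<open>Schwarz's theorem: the second difference quotient is symmetric in the two directions and tends to either mixed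
derivative.\<close>

lemma pd_commute:
  assumes "\<And>x. f differentiable (at x)" "\<And>i x. pd i f differentiable (at x)"
    and "\<And>i j. continuous_on UNIV (pd i (pd j f))"
  shows "pd i (pd j f) x = pd j (pd i f) x"
proof -
  define h where "h n = 1 / real (Suc n)" for n
  have hpos: "h n > 0" for n by (simp add: h_def)
  have hlim: "h \<longlonglongrightarrow> 0" unfolding h_def
    using LIMSEQ_inverse_real_of_nat by (simp add: inverse_eq_divide)
  define \<Delta> where "\<Delta> i j n = (f (x + h n *\<^sub>R axis i 1 + h n *\<^sub>R axis j 1)
      - f (x + h n *\<^sub>R axis i 1) - f (x + h n *\<^sub>R axis j 1) + f x) / (h n * h n)" for i j n
  have "\<Delta> i j \<longlonglongrightarrow> pd j (pd i f) x" for i j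
  proof -
    have "\<forall>n. \<exists>y. norm (y - x) \<le> 2 * h n \<and> \<Delta> i j n = pd j (pd i f) y"
    proof
      fix n
      obtain y where "norm (y - x) \<le> 2 * h n" "\<Delta> i j n * (h n * h n) = h n * h n * pd j (pd i f) y"
        using second_difference_quotient[OF assms(1,2) hpos[of n], where i = i and j = j and x = x] hpos[of n] unfolding \<Delta>_def by auto
      then show "\<exists>y. norm (y - x) \<le> 2 * h n \<and> \<Delta> i j n = pd j (pd i f) y"
        using hpos[of n] by (intro exI[of _ y]) auto
    qed
    then obtain y where y: "\<And>n. norm (y n - x) \<le> 2 * h n" "\<And>n. \<Delta> i j n = pd j (pd i f) (y n)" by metis
    have "(\<lambda>n. y n - x) \<longlonglongrightarrow> 0"
      by (rule Lim_null_comparison[OF always_eventually tendsto_mult_right_zero[OF hlim, of 2]]) (simp add: y(1))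
    then have "y \<longlonglongrightarrow> x" by (simp add: LIM_zero_iff)
    moreover have "isCont (pd j (pd i f)) x"
      using assms(3) by (simp add: continuous_on_eq_continuous_at)
    ultimately have "(\<lambda>n. pd j (pd i f) (y n)) \<longlonglongrightarrow> pd j (pd i f) x"
      by (rule isCont_tendsto_compose[rotated])
    then show ?thesis using y(2) by presburger
  qed
  note lim = this
  have "\<Delta> i j = \<Delta> j i" unfolding \<Delta>_def by (simp add: fun_eq_iff algebra_simps)
  with lim[of i j] have "\<Delta> j i \<longlonglongrightarrow> pd j (pd i f) x" by simp
  from LIMSEQ_unique[OF lim[of j i] this] show ?thesis .
qed

text \<open>Indices of type \<open>3\<close> are added modulo 3, so that \<open>i\<close>, \<open>i + 1\<close>, \<open>i + 2\<close> is a cyclic permutation of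
the coordinates. Stated with these indices, one formula covers all components of a curl or a cross product.\<close>

lemma cyclic_index_3:
  assumes "P 1 2 3" "P 2 3 1" "P 3 1 2"
  shows "P i (i + 1) (i + (2::3))"
proof -
  have "(1::3) + 1 = 2" "(1::3) + 2 = 3" "(2::3) + 1 = 3" "(2::3) + 2 = 1" "(3::3) + 1 = 1" "(3::3) + 2 = 2"
    by auto
  then show ?thesis using exhaust_3[of i] assms by metis
qed

lemma curl_nth: "curl F x $ i = pd (i + 1) (\<lambda>y. F y $ (i + 2)) x - pd (i + 2) (\<lambda>y. F y $ (i + 1)) x"
  by (rule cyclic_index_3[where P = "\<lambda>i j k. curl F x $ i = pd j (\<lambda>y. F y $ k) x - pd k (\<lambda>y. F y $ j) x"]) (simp_all add: curl_def vector_3)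

lemma index_3_distinct: "(i::3) + 1 \<noteq> i" "(i::3) + 2 \<noteq> i" "(i::3) + 1 \<noteq> i + 2" 
  "(i::3) + 1 + 1 = i + 2" "(i::3) + 1 + 2 = i" "(i::3) + 2 + 1 = i" "(i::3) + 2 + 2 = i + 1"
proof -
  have "(4::3) = 1" "(5::3) = 2" by auto
  then show "i + 1 \<noteq> i" "i + 2 \<noteq> i" "i + 1 \<noteq> i + 2" 
  "i + 1 + 1 = i + 2" "i + 1 + 2 = i" "i + 2 + 1 = i" "i + 2 + 2 = i + 1"
    using exhaust_3[of i] by auto
qed

lemma sum_3_shift: "(\<Sum>j\<in>UNIV. f j) = f i + f (i + 1) + f (i + 2)" for f :: "3 \<Rightarrow> real" and i :: 3
  by (rule cyclic_index_3[where P = "\<lambda>i j k. (\<Sum>j\<in>UNIV. f j) = f i + f j + f k"]) (simp_all add: sum_3)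

lemma inner_curl_axis:
  "v \<bullet> curl (\<lambda>x. \<psi> x *\<^sub>R axis i 1) x = v $ (i + 1) * pd (i + 2) \<psi> x - v $ (i + 2) * pd (i + 1) \<psi> x"
proof -
  have c: "(\<lambda>y. (\<psi> y *\<^sub>R axis i 1 :: real^3) $ j) = (if j = i then \<psi> else (\<lambda>_. 0))" for j
    by (auto simp: axis_def)
  have "curl (\<lambda>x. \<psi> x *\<^sub>R axis i 1) x $ i = 0"
    "curl (\<lambda>x. \<psi> x *\<^sub>R axis i 1) x $ (i + 1) = pd (i + 2) \<psi> x"
    "curl (\<lambda>x. \<psi> x *\<^sub>R axis i 1) x $ (i + 2) = - pd (i + 1) \<psi> x"
    unfolding curl_nth c index_3_distinct(4-7)
    using index_3_distinct(1-3)[of i] index_3_distinct(1-3)[of i, symmetric] by simp_all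
  then show ?thesis unfolding inner_vec_def by (subst sum_3_shift[of _ i]) simp
qed

lemma cross3_nth: "cross3 x y $ i = x $ (i + 1) * y $ (i + 2) - x $ (i + 2) * y $ (i + 1)"
  by (rule cyclic_index_3[where P = "\<lambda>i j k. cross3 x y $ i = x $ j * y $ k - x $ k * y $ j"]) (simp_all add: cross3_def vector_3)

text \<open>The component of the curl normal to a plane spanned by \<open>a\<close> and \<open>b\<close> involves only derivatives along
\<open>a\<close> and \<open>b\<close>, of the components along \<open>b\<close> and \<open>a\<close>.\<close>

lemma cross3_inner_curl:
  "cross3 a b \<bullet> curl E x = (\<Sum>i\<in>UNIV. \<Sum>j\<in>UNIV. a $ i * b $ j * pd i (\<lambda>y. E y $ j) x)
     - (\<Sum>i\<in>UNIV. \<Sum>j\<in>UNIV. b $ i * a $ j * pd i (\<lambda>y. E y $ j) x)"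
  by (simp add: inner_vec_def curl_def cross3_def sum_3 vector_3 algebra_simps)

section \<open>Integrals of derivatives with compact support\<close>

lemma integral_affine:
  fixes f :: "real^3 \<Rightarrow> real"
  assumes "f \<in> borel_measurable borel" "c \<noteq> 0"
  shows "(LINT x|lborel. f x) = \<bar>c\<bar> ^ 3 * (LINT y|lborel. f (t + c *\<^sub>R y))"
proof -
  have "(LINT x|lborel. f x) = (LINT x|density (distr lborel borel (\<lambda>x. t + c *\<^sub>R x)) (\<lambda>_. \<bar>c\<bar> ^ 3). f x)"
    using lborel_affine[OF assms(2), of t] by simp
  also have "\<dots> = (LINT x|distr lborel borel (\<lambda>x. t + c *\<^sub>R x). \<bar>c\<bar> ^ 3 * f x)"
    using assms(1) by (subst integral_density) auto
  also have "\<dots> = (LINT y|lborel. \<bar>c\<bar> ^ 3 * f (t + c *\<^sub>R y))"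
    using assms(1) by (subst integral_distr) auto
  finally show ?thesis by simp
qed

lemma integral_translate:
  fixes f :: "'a::euclidean_space \<Rightarrow> real"
  assumes "f \<in> borel_measurable borel"
  shows "(LINT x|lborel. f (x + a)) = (LINT x|lborel. f x)"
proof -
  have "(LINT x|lborel. f x) = (LINT x|distr lborel borel ((+) a). f x)"
    by (simp add: lborel_distr_plus)
  also have "\<dots> = (LINT x|lborel. f (a + x))"
    by (rule integral_distr) (use assms in auto)
  finally show ?thesis by (simp add: add.commute)
qed

lemma pd_outside_support:
  assumes "closed C" "\<And>x. x \<notin> C \<Longrightarrow> f x = 0" "x \<notin> C"
  shows "pd i f x = 0"
proof -
  have "pd i f x = pd i (\<lambda>_. 0) x"
    by (rule pd_transform[of "- C"]) (use assms in auto)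
  then show ?thesis by simp
qed

lemma differentiable_imp_continuous_on:
  assumes "\<And>x. f differentiable (at x)"
  shows "continuous_on UNIV f"
  using assms by (simp add: continuous_on_eq_continuous_within differentiable_imp_continuous_within)

lemma integrable_compact_support:
  fixes f :: sfield
  assumes "continuous_on UNIV f" "compact C" "\<And>x. x \<notin> C \<Longrightarrow> f x = 0"
  shows "integrable lborel f"
proof -
  have "integrable lborel (\<lambda>x. indicator C x *\<^sub>R f x)"
    using borel_integrable_compact[OF assms(2), of f] assms(1) continuous_on_subset
    by (metis top_greatest)
  moreover have "(\<lambda>x. indicator C x *\<^sub>R f x) = f"
    using assms(3) by (intro ext) (auto simp: indicator_def)
  ultimately show ?thesis by simp
qed

text \<open>Translation invariance makes the integral of every difference quotient zero. By the mean value theorem the quotients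
are values of the derivative at nearby points, hence bounded by a multiple of the indicator of a fixed ball;
dominated convergence carries the zero over to the derivative.\<close>

lemma integral_pd_zero:
  assumes "\<And>x. f differentiable (at x)" "continuous_on UNIV (pd i f)"
    and "compact C" "\<And>x. x \<notin> C \<Longrightarrow> f x = 0"
  shows "(LINT x|lborel. pd i f x) = 0"
proof -
  let ?v = "axis i (1::real) :: real^3"
  have z: "pd i f x = 0" if "x \<notin> C" for x
    using pd_outside_support[of C] assms that compact_imp_closed by blast
  have "bounded (pd i f ` C)"
    using assms by (meson compact_continuous_image compact_imp_bounded continuous_on_subset top_greatest)
  then obtain b where b: "b > 0" "\<And>x. x \<in> C \<Longrightarrow> \<bar>pd i f x\<bar> \<le> b"
    by (auto simp: bounded_pos)
  have bd: "\<bar>pd i f x\<bar> \<le> b" for x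
    using b z by (cases "x \<in> C") auto
  obtain R where R: "\<And>x. x \<in> C \<Longrightarrow> norm x \<le> R"
    using compact_imp_bounded[OF assms(3)] by (auto simp: bounded_iff)
  define h where "h n = 1 / real (Suc n)" for n
  have hpos: "h n > 0" and h1: "h n \<le> 1" for n by (simp_all add: h_def)
  have hlim: "h \<longlonglongrightarrow> 0" unfolding h_def
    using LIMSEQ_inverse_real_of_nat by (simp add: inverse_eq_divide)
  have cf: "continuous_on UNIV f"
    using assms(1) by (rule differentiable_imp_continuous_on)
  have mf: "f \<in> borel_measurable borel"
    using cf borel_measurable_continuous_onI by blast
  have int: "integrable lborel f"
    by (rule integrable_compact_support[OF cf assms(3,4)])
  have int': "integrable lborel (\<lambda>x. f (x + a))" for a
  proof -
    have "integrable (distr lborel borel ((+) a)) f" using int by (simp add: lborel_distr_plus)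
    then have "integrable lborel (\<lambda>x. f (a + x))"
      by (subst (asm) integrable_distr_eq) (use mf in auto)
    then show ?thesis by (simp add: add.commute)
  qed
  define s where "s n x = (f (x + h n *\<^sub>R ?v) - f x) / h n" for n x
  have s0: "(LINT x|lborel. s n x) = 0" for n
    unfolding s_def using integral_translate[OF mf] int int' by simp
  have mv: "\<exists>\<xi>. 0 < \<xi> \<and> \<xi> < h n \<and> s n x = pd i f (x + \<xi> *\<^sub>R ?v)" for n x
  proof -
    obtain \<xi> where "0 < \<xi>" "\<xi> < h n" "f (x + h n *\<^sub>R ?v) - f x = h n * pd i f (x + \<xi> *\<^sub>R ?v)"
      using mean_value_pd[OF assms(1) hpos] by metis
    then show ?thesis using hpos[of n] by (auto simp: s_def)
  qed
  have "(\<lambda>n. LINT x|lborel. s n x) \<longlonglongrightarrow> (LINT x|lborel. pd i f x)"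
  proof (rule integral_dominated_convergence[where w = "\<lambda>x. b * indicator (cball 0 (R + 1)) x"])
    show "pd i f \<in> borel_measurable lborel"
      using assms(2) borel_measurable_continuous_onI by auto
    show "s n \<in> borel_measurable lborel" for n
      unfolding s_def using mf by measurable
    show "integrable lborel (\<lambda>x::real^3. b * indicator (cball 0 (R + 1)) x :: real)"
      by (intro integrable_mult_right integrable_real_indicator) (use emeasure_lborel_cball_finite in auto)
    show "AE x in lborel. (\<lambda>n. s n x) \<longlonglongrightarrow> pd i f x"
    proof (rule AE_I2)
      fix x
      have "\<forall>n. \<exists>\<xi>. 0 < \<xi> \<and> \<xi> < h n \<and> s n x = pd i f (x + \<xi> *\<^sub>R ?v)"
        using mv by blast
      then obtain \<xi> where \<xi>: "\<And>n. 0 < \<xi> n \<and> \<xi> n < h n \<and> s n x = pd i f (x + \<xi> n *\<^sub>R ?v)"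
        by metis
      have "\<xi> \<longlonglongrightarrow> 0"
        by (rule tendsto_sandwich[OF _ _ tendsto_const hlim])
          (use \<xi> in \<open>auto intro!: always_eventually less_imp_le\<close>)
      then have "(\<lambda>n. x + \<xi> n *\<^sub>R ?v) \<longlonglongrightarrow> x"
        using tendsto_add[OF tendsto_const[of x] tendsto_scaleR[OF _ tendsto_const[of ?v], of \<xi> 0]] by simp
      moreover have "isCont (pd i f) x"
        using assms(2) by (simp add: continuous_on_eq_continuous_at)
      ultimately have "(\<lambda>n. pd i f (x + \<xi> n *\<^sub>R ?v)) \<longlonglongrightarrow> pd i f x"
        using isCont_tendsto_compose by blast
      then show "(\<lambda>n. s n x) \<longlonglongrightarrow> pd i f x" using \<xi> by simp
    qed
    show "AE x in lborel. norm (s n x) \<le> b * indicator (cball 0 (R + 1)) x" for n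
    proof (rule AE_I2)
      fix x
      obtain \<xi> where \<xi>: "0 < \<xi>" "\<xi> < h n" "s n x = pd i f (x + \<xi> *\<^sub>R ?v)"
        using mv by blast
      show "norm (s n x) \<le> b * indicator (cball 0 (R + 1)) x"
      proof (cases "x + \<xi> *\<^sub>R ?v \<in> C")
        case True
        have "norm (\<xi> *\<^sub>R ?v) \<le> 1" using \<xi> h1[of n] by simp
        then have "norm x \<le> R + 1"
          using R[OF True] by (smt (verit) norm_diff_ineq)
        then show ?thesis using \<xi> bd by simp
      next
        case False
        then show ?thesis using \<xi> z b by (simp add: indicator_def)
      qed
    qed
  qed
  then show ?thesis using s0 by (simp add: LIMSEQ_const_iff)
qed

section \<open>Smooth test functions\<close>

text \<open>For \<open>P = 1\<close> this is the classical function \<open>exp (- 1 / t)\<close>, extended by zero to \<open>t \<le> 0\<close>. The polynomial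
factor makes the family closed under differentiation, so that smoothness is a closure property.\<close>

definition flat :: "real poly \<Rightarrow> real \<Rightarrow> real"
  where "flat P t = (if t \<le> 0 then 0 else poly P (1 / t) * exp (- (1 / t)))"

lemma poly_times_exp_minus_tendsto_0:
  "((\<lambda>s. poly P s * exp (- s)) \<longlongrightarrow> (0::real)) at_top"
proof -
  have "((\<lambda>s. \<Sum>i\<le>degree P. coeff P i * (s ^ i / exp s)) \<longlongrightarrow> (\<Sum>i\<le>degree P. coeff P i * 0)) at_top"
    by (intro tendsto_sum tendsto_mult tendsto_const tendsto_power_div_exp_0)
  moreover have "(\<lambda>s. \<Sum>i\<le>degree P. coeff P i * (s ^ i / exp s)) = (\<lambda>s. poly P s * exp (- s))"
    by (simp add: poly_altdef sum_distrib_right exp_minus divide_inverse mult.assoc)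
  ultimately show ?thesis by simp
qed

text \<open>At zero the difference quotient is again a polynomial in \<open>1 / t\<close> times \<open>exp (- 1 / t)\<close>, which tends to zero
from the right. For \<open>t > 0\<close> the chain rule produces the factor \<open>1 / t\<^sup>2\<close>, which is the polynomial
\<open>[:0, 0, 1:]\<close> in \<open>1 / t\<close>.\<close>

lemma flat_has_derivative:
  "(flat P has_real_derivative flat ([:0, 0, 1:] * (P - pderiv P)) t) (at t)"
proof -
  consider "t < 0" | "t = 0" | "t > 0" by linarith
  then show ?thesis
  proof cases
    case 1
    have "((\<lambda>_. 0) has_real_derivative 0) (at t)" by simp
    then have "(flat P has_real_derivative 0) (at t)"
      by (rule has_field_derivative_transform_within_open[of _ _ _ "{..<0}"]) (use 1 in \<open>auto simp: flat_def\<close>)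
    then show ?thesis using 1 by (simp add: flat_def)
  next
    case 2
    have "((\<lambda>y. flat P y / y) \<longlongrightarrow> 0) (at_left 0)"
    proof (rule tendsto_eventually)
      show "\<forall>\<^sub>F y in at_left 0. flat P y / y = 0"
        by (auto simp: flat_def eventually_at_left_field intro: exI[of _ "-1"])
    qed
    moreover have "((\<lambda>y. flat P y / y) \<longlongrightarrow> 0) (at_right 0)"
    proof -
      have "((\<lambda>y. poly (pCons 0 P) (inverse y) * exp (- inverse y)) \<longlongrightarrow> 0) (at_right 0)"
        using filterlim_compose[OF poly_times_exp_minus_tendsto_0 filterlim_inverse_at_top_right] .
      moreover have "\<forall>\<^sub>F y in at_right 0.
          poly (pCons 0 P) (inverse y) * exp (- inverse y) = flat P y / y"
        unfolding eventually_at_right_field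
        by (rule exI[of _ 1]) (auto simp: flat_def divide_inverse)
      ultimately show ?thesis by (rule Lim_transform_eventually)
    qed
    ultimately have "((\<lambda>y. flat P y / y) \<longlongrightarrow> 0) (at 0)"
      using filterlim_split_at by blast
    then show ?thesis using 2 by (simp add: has_field_derivative_iff flat_def)
  next
    case 3
    have "((\<lambda>t. poly P (1 / t) * exp (- (1 / t))) has_real_derivative
        flat ([:0, 0, 1:] * (P - pderiv P)) t) (at t)"
      using 3 by (auto intro!: derivative_eq_intros poly_DERIV[THEN DERIV_chain2]
          simp: flat_def field_simps power2_eq_square)
    then show ?thesis
      by (rule has_field_derivative_transform_within_open[of _ _ _ "{0<..}"]) (use 3 in \<open>auto simp: flat_def\<close>)
  qed
qed

lemma continuous_flat:
  "continuous_on UNIV (flat P)"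
  using flat_has_derivative[of P] DERIV_isCont continuous_at_imp_continuous_on by blast

text \<open>A set of functions closed under partial differentiation consists of smooth functions as soon as its members are
differentiable. This one is large enough to contain all cut-off functions used below.\<close>

inductive_set smooth_functions :: "sfield set" where
  const: "(\<lambda>x. a) \<in> smooth_functions"
| coord: "(\<lambda>x. x $ i) \<in> smooth_functions"
| add: "f \<in> smooth_functions \<Longrightarrow> g \<in> smooth_functions \<Longrightarrow> (\<lambda>x. f x + g x) \<in> smooth_functions"
| mult: "f \<in> smooth_functions \<Longrightarrow> g \<in> smooth_functions \<Longrightarrow> (\<lambda>x. f x * g x) \<in> smooth_functions"
| flat: "f \<in> smooth_functions \<Longrightarrow> (\<lambda>x. flat P (f x)) \<in> smooth_functions"

lemma smooth_functions_pd:
  assumes "f \<in> smooth_functions"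
  shows "(\<forall>x. f differentiable (at x)) \<and> (\<forall>i. pd i f \<in> smooth_functions)"
  using assms
proof induction
  case (const a)
  then show ?case by (auto intro: smooth_functions.const)
next
  case (coord j)
  have "(\<lambda>x::real^3. x $ j) differentiable (at x)" for x
    by (intro bounded_linear_imp_differentiable bounded_linear_vec_nth)
  moreover have "pd i (\<lambda>x. x $ j) = (\<lambda>x. if i = j then 1 else 0)" for i
    by (rule ext) (rule pd_coord)
  ultimately show ?case by (auto intro: smooth_functions.const)
next
  case (add f g)
  then have "pd i (\<lambda>x. f x + g x) = (\<lambda>x. pd i f x + pd i g x)" for i
    using pd_add by blast
  moreover have "(\<lambda>x. pd i f x + pd i g x) \<in> smooth_functions" for i
    by (rule smooth_functions.add) (use add in auto)
  ultimately show ?case using add by (auto intro: differentiable_add)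
next
  case (mult f g)
  then have "pd i (\<lambda>x. f x * g x) = (\<lambda>x. pd i f x * g x + f x * pd i g x)" for i
    using pd_mult by blast
  moreover have "(\<lambda>x. pd i f x * g x + f x * pd i g x) \<in> smooth_functions" for i
    by (rule smooth_functions.add; rule smooth_functions.mult) (use mult in auto)
  ultimately show ?case using mult by (auto intro: differentiable_mult)
next
  case (flat f P)
  then have "pd i (\<lambda>x. flat P (f x)) = (\<lambda>x. flat ([:0, 0, 1:] * (P - pderiv P)) (f x) * pd i f x)" for i
    using pd_chain(2)[OF _ flat_has_derivative] by blast
  moreover have "(\<lambda>x. flat ([:0, 0, 1:] * (P - pderiv P)) (f x) * pd i f x) \<in> smooth_functions" for i
    by (rule smooth_functions.mult; (rule smooth_functions.flat)?) (use flat in auto)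
  moreover have "(\<lambda>x. flat P (f x)) differentiable (at x)" for x
    by (rule pd_chain(1)[OF _ flat_has_derivative]) (use flat in auto)
  ultimately show ?case by simp
qed

lemma smooth_functions_Ck: "f \<in> smooth_functions \<Longrightarrow> Ck n f"
proof (induction n arbitrary: f)
  case 0
  then have "continuous_on UNIV f"
    using smooth_functions_pd by (intro differentiable_imp_continuous_on) blast
  then show ?case by simp
next
  case (Suc n)
  then show ?case using smooth_functions_pd by auto
qed

lemma smooth_functions_diff:
  "f \<in> smooth_functions \<Longrightarrow> g \<in> smooth_functions \<Longrightarrow> (\<lambda>x. f x - g x) \<in> smooth_functions"
  using smooth_functions.add[OF _ smooth_functions.mult[OF smooth_functions.const[of "-1"]], of f g] by simp

lemma smooth_functions_prod:
  assumes "finite I" "\<And>i. i \<in> I \<Longrightarrow> f i \<in> smooth_functions"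
  shows "(\<lambda>x. \<Prod>i\<in>I. f i x) \<in> smooth_functions"
  using assms by (induction I) (auto intro: smooth_functions.const smooth_functions.mult)

lemma smooth_functions_sum:
  assumes "finite I" "\<And>i. i \<in> I \<Longrightarrow> f i \<in> smooth_functions"
  shows "(\<lambda>x. \<Sum>i\<in>I. f i x) \<in> smooth_functions"
  using assms by (induction I) (auto intro: smooth_functions.const smooth_functions.add)

lemma test_functionD:
  assumes "test_function U \<psi>"
  shows "\<psi> differentiable (at x)" "continuous_on UNIV \<psi>" "test_function U (pd i \<psi>)"
    "\<exists>C. compact C \<and> C \<subseteq> U \<and> (\<forall>x. x \<notin> C \<longrightarrow> \<psi> x = 0)"
proof -
  have Ck: "Ck n \<psi>" for n using assms by (simp add: test_function_def)
  show "\<psi> differentiable (at x)" using Ck[of 1] by simp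
  show "continuous_on UNIV \<psi>" using Ck[of 0] by simp
  show "\<exists>C. compact C \<and> C \<subseteq> U \<and> (\<forall>x. x \<notin> C \<longrightarrow> \<psi> x = 0)"
    using assms by (simp add: test_function_def)
  then obtain C where C: "compact C" "C \<subseteq> U" "\<And>x. x \<notin> C \<Longrightarrow> \<psi> x = 0" by blast
  have "Ck n (pd i \<psi>)" for n using Ck[of "Suc n"] by simp
  moreover have "pd i \<psi> x = 0" if "x \<notin> C" for x
    by (rule pd_outside_support[of C]) (use C that compact_imp_closed in auto)
  ultimately show "test_function U (pd i \<psi>)"
    unfolding test_function_def using C by auto
qed

lemma test_function_mono: "test_function U \<psi> \<Longrightarrow> U \<subseteq> V \<Longrightarrow> test_function V \<psi>"
  unfolding test_function_def by blast

lemma test_function_zero: "test_function U (\<lambda>x. 0)"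
  unfolding test_function_def
  using smooth_functions_Ck[OF smooth_functions.const] by blast

lemma test_field_axis:
  assumes "test_function U \<psi>"
  shows "test_field U (\<lambda>x. \<psi> x *\<^sub>R axis i 1)"
proof -
  have "(\<lambda>x. (\<psi> x *\<^sub>R axis i 1 :: real^3) $ j) = (if i = j then \<psi> else (\<lambda>x. 0))" for j
    by (auto simp: axis_def)
  then show ?thesis unfolding test_field_def using assms test_function_zero by simp
qed

lemma test_function_pd_commute:
  assumes "test_function U \<psi>"
  shows "pd i (pd j \<psi>) x = pd j (pd i \<psi>) x"
  by (rule pd_commute) (use assms test_functionD in blast)+

lemma curl_grad_test_function:
  assumes "test_function U \<psi>"
  shows "curl (grad \<psi>) x = 0"
proof -
  have "curl (grad \<psi>) x $ i = 0" for i
    unfolding curl_nth grad_def using test_function_pd_commute[OF assms] by simp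
  then show ?thesis by (simp add: vec_eq_iff)
qed

lemma test_field_grad:
  assumes "test_function U \<psi>"
  shows "test_field U (grad \<psi>)"
  unfolding test_field_def grad_def using test_functionD(3)[OF assms] by simp

text \<open>The gradient of a scalar test function is an admissible vector test field with vanishing curl, by Schwarz's theorem.\<close>

lemma is_weak_div_weak_curl:
  assumes "is_weak_curl \<Omega> E g"
  shows "is_weak_div \<Omega> g (\<lambda>x. 0)"
  unfolding is_weak_div_def
proof (intro allI impI)
  fix \<psi> assume \<psi>: "test_function \<Omega> \<psi>"
  have "(LINT x|lebesgue_on \<Omega>. g x \<bullet> grad \<psi> x) = (LINT x|lebesgue_on \<Omega>. E x \<bullet> curl (grad \<psi>) x)"
    using assms[unfolded is_weak_curl_def, rule_format, OF test_field_grad[OF \<psi>]] by (rule sym)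
  then show "(LINT x|lebesgue_on \<Omega>. g x \<bullet> grad \<psi> x) = - (LINT x|lebesgue_on \<Omega>. 0 * \<psi> x)"
    by (simp add: curl_grad_test_function[OF \<psi>])
qed

lemma integral_lebesgue_on_lborel:
  fixes f :: "real^3 \<Rightarrow> real"
  assumes "\<Omega> \<in> sets lebesgue" "f \<in> borel_measurable borel" "\<And>x. x \<notin> \<Omega> \<Longrightarrow> f x = 0"
  shows "(LINT x|lebesgue_on \<Omega>. f x) = (LINT x|lborel. f x)"
proof -
  have "(LINT x|lebesgue_on \<Omega>. f x) = (LINT x|lebesgue. indicator \<Omega> x *\<^sub>R f x)"
    using assms(1) by (subst integral_restrict_space) auto
  also have "\<dots> = (LINT x|lebesgue. f x)"
    using assms(3) by (intro Bochner_Integration.integral_cong) (auto simp: indicator_def)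
  also have "\<dots> = (LINT x|lborel. f x)"
    using assms(2) by (intro integral_completion) auto
  finally show ?thesis .
qed

text \<open>The product \<open>p \<psi>\<close> inherits the compact support of \<open>\<psi>\<close>, so the integral of its derivative vanishes.\<close>

lemma integration_by_parts:
  assumes \<psi>: "test_function U \<psi>" "U \<subseteq> \<Omega>" and \<Omega>: "\<Omega> \<in> sets lebesgue"
    and p: "\<And>x. p differentiable (at x)" "continuous_on UNIV (pd i p)"
  shows "(LINT x|lebesgue_on \<Omega>. p x * pd i \<psi> x) = - (LINT x|lebesgue_on \<Omega>. pd i p x * \<psi> x)"
proof -
  obtain C where C: "compact C" "C \<subseteq> U" "\<And>x. x \<notin> C \<Longrightarrow> \<psi> x = 0"
    using test_functionD(4)[OF \<psi>(1)] by blast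
  have z: "pd i \<psi> x = 0" if "x \<notin> C" for x
    using pd_outside_support[of C] C that compact_imp_closed by blast
  have cp: "continuous_on UNIV p"
    using p(1) by (rule differentiable_imp_continuous_on)
  note c = cp p(2) test_functionD(2)[OF \<psi>(1)] test_functionD(2)[OF test_functionD(3)[OF \<psi>(1)], of i]
  have pd: "pd i (\<lambda>x. p x * \<psi> x) = (\<lambda>x. pd i p x * \<psi> x + p x * pd i \<psi> x)"
    using pd_mult[OF p(1) test_functionD(1)[OF \<psi>(1)]] by blast
  have int: "integrable lborel f" if "continuous_on UNIV f" "\<And>x. x \<notin> C \<Longrightarrow> f x = 0" for f :: sfield
    by (rule integrable_compact_support[OF that(1) C(1) that(2)])
  have "0 = (LINT x|lborel. pd i (\<lambda>x. p x * \<psi> x) x)"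
    by (rule integral_pd_zero[symmetric, OF _ _ C(1)])
      (use C p test_functionD(1)[OF \<psi>(1)] c in \<open>auto simp: pd intro!: differentiable_mult continuous_intros\<close>)
  also have "\<dots> = (LINT x|lborel. pd i p x * \<psi> x) + (LINT x|lborel. p x * pd i \<psi> x)"
    unfolding pd by (intro Bochner_Integration.integral_add int continuous_on_mult c) (use C z in auto)
  finally have "(LINT x|lborel. p x * pd i \<psi> x) = - (LINT x|lborel. pd i p x * \<psi> x)" by simp
  moreover have "(LINT x|lebesgue_on \<Omega>. p x * pd i \<psi> x) = (LINT x|lborel. p x * pd i \<psi> x)"
    by (intro integral_lebesgue_on_lborel \<Omega> borel_measurable_continuous_onI continuous_on_mult c)
      (use C z \<psi>(2) in auto)
  moreover have "(LINT x|lebesgue_on \<Omega>. pd i p x * \<psi> x) = (LINT x|lborel. pd i p x * \<psi> x)"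
    by (intro integral_lebesgue_on_lborel \<Omega> borel_measurable_continuous_onI continuous_on_mult c)
      (use C z \<psi>(2) in auto)
  ultimately show ?thesis by simp
qed

section \<open>The fundamental lemma of the calculus of variations\<close>

text \<open>Each factor vanishes beyond one side of the box. Since \<open>flat 1\<close> tends to 1 at infinity, scaling the
arguments by \<open>n\<close> makes the product converge to the indicator of the open box, and stay below it.\<close>

definition box_bump :: "point \<Rightarrow> point \<Rightarrow> nat \<Rightarrow> sfield"
  where "box_bump a b n x = (\<Prod>i\<in>UNIV. flat 1 (real n * (x $ i - a $ i)) * flat 1 (real n * (b $ i - x $ i)))"

lemma flat_1_bounds: "0 \<le> flat 1 t" "flat 1 t \<le> 1"
  by (auto simp: flat_def)

lemma box_bump_bounds: "0 \<le> box_bump a b n x" "box_bump a b n x \<le> 1"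
  unfolding box_bump_def
  by (auto intro!: prod_nonneg prod_le_1 mult_le_one simp: flat_1_bounds)

lemma box_bump_outside: "x \<notin> box a b \<Longrightarrow> box_bump a b n x = 0"
  unfolding box_bump_def mem_box_cart
  by (auto simp: flat_def mult_le_0_iff not_less)

lemma box_bump_tendsto: "(\<lambda>n. box_bump a b n x) \<longlonglongrightarrow> indicator (box a b) x"
proof (cases "x \<in> box a b")
  case True
  have 1: "(\<lambda>n. flat 1 (real n * c)) \<longlonglongrightarrow> 1" if "c > 0" for c
  proof -
    have "(\<lambda>n. 1 / c * inverse (real n)) \<longlonglongrightarrow> 1 / c * 0"
      by (intro tendsto_mult tendsto_const lim_inverse_n)
    then have "(\<lambda>n. exp (- (1 / c * inverse (real n)))) \<longlonglongrightarrow> exp (- 0)"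
      by (intro tendsto_exp tendsto_minus) simp
    moreover have "\<forall>\<^sub>F n in sequentially. exp (- (1 / c * inverse (real n))) = flat 1 (real n * c)"
      using eventually_gt_at_top[of 0] by eventually_elim (use that in \<open>simp add: flat_def field_simps not_le\<close>)
    ultimately have "(\<lambda>n. flat 1 (real n * c)) \<longlonglongrightarrow> exp (- 0)"
      by (rule Lim_transform_eventually)
    then show ?thesis by simp
  qed
  have "(\<lambda>n. box_bump a b n x) \<longlonglongrightarrow> (\<Prod>i\<in>(UNIV::3 set). 1 * 1)"
    unfolding box_bump_def using True
    by (intro tendsto_prod tendsto_mult 1) (auto simp: mem_box_cart)
  then show ?thesis using True by simp
next
  case False
  then show ?thesis by (simp add: box_bump_outside)
qed

lemma test_function_box_bump:
  assumes "cbox a b \<subseteq> U"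
  shows "test_function U (box_bump a b n)"
proof -
  have "box_bump a b n \<in> smooth_functions"
    unfolding box_bump_def[abs_def]
    by (intro smooth_functions_prod smooth_functions.mult smooth_functions.flat smooth_functions_diff
        smooth_functions.const smooth_functions.coord) auto
  moreover have "box_bump a b n x = 0" if "x \<notin> cbox a b" for x
    using that box_bump_outside box_subset_cbox by blast
  ultimately show ?thesis
    unfolding test_function_def using assms smooth_functions_Ck
    by (intro conjI allI exI[of _ "cbox a b"]) auto
qed

lemma continuous_AE_zero:
  fixes p :: "real^3 \<Rightarrow> 'b::real_normed_vector"
  assumes "open U" "continuous_on UNIV p" "AE x in lebesgue. x \<in> U \<longrightarrow> p x = 0" "x \<in> U"
  shows "p x = 0"
proof (rule ccontr)
  assume "p x \<noteq> 0"
  let ?V = "U \<inter> {x. p x \<noteq> 0}"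
  have "open ?V" using assms(1,2) by (intro open_Int open_Collect_neq) auto
  moreover have "?V \<in> null_sets lebesgue"
  proof -
    have "AE x in lebesgue. x \<notin> ?V" using assms(3) by eventually_elim auto
    then show ?thesis
      using AE_iff_null_sets[of ?V lebesgue] \<open>open ?V\<close> by simp
  qed
  ultimately show False
    using open_not_negligible[of ?V] \<open>p x \<noteq> 0\<close> assms(4) negligible_iff_null_sets by blast
qed

text \<open>Open boxes form an intersection-stable generator of the Borel sets, so the integral vanishes over every Borel subset
of the box, in particular over the sets where the function is positive or negative. Those two sets must be Borel for
this, which is why a Borel representative \<open>G'\<close> is used to define them.\<close>

lemma AE_zero_if_box_integrals_zero:
  fixes G :: sfield
  assumes G: "integrable lebesgue G"
    and box: "\<And>c d. cbox c d \<subseteq> cbox a b \<Longrightarrow> (LINT x|lebesgue. indicator (box c d) x * G x) = 0"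
  shows "AE x in lebesgue. x \<in> cbox a b \<longrightarrow> G x = 0"
proof -
  let ?A = "box a b"
  have mA: "?A \<in> sets lebesgue" by simp
  have int: "integrable lebesgue (\<lambda>x. indicator S x * G x)" if "S \<in> sets lebesgue" for S
    using integrable_mult_indicator[OF that G] by simp
  have zero: "(LINT x|lebesgue. indicator (?A \<inter> S) x * G x) = 0" if S: "S \<in> sets borel" for S
  proof -
    let ?g = "range (\<lambda>(a, b). box a b :: (real^3) set)"
    have "Int_stable ?g"
      unfolding Int_stable_def by (clarsimp simp: box_Int_box) blast
    moreover have "?g \<subseteq> Pow UNIV" by simp
    moreover have "S \<in> sigma_sets UNIV ?g"
      using S by (simp add: borel_eq_box)
    ultimately show ?thesis
    proof (induction rule: sigma_sets_induct_disjoint)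
      case (basic S)
      then obtain c d where S: "S = box c d" by auto
      obtain p q where pq: "?A \<inter> S = box p q" unfolding S box_Int_box by blast
      show ?case
      proof (cases "box p q = {}")
        case True
        then show ?thesis unfolding pq by simp
      next
        case False
        have "closure (box p q) \<subseteq> closure ?A"
          using pq by (intro closure_mono) blast
        then have "cbox p q \<subseteq> cbox a b"
          using False pq by (metis closure_box inf_bot_left)
        then show ?thesis unfolding pq by (rule box)
      qed
    next
      case empty
      then show ?case by simp
    next
      case (compl S)
      then have S: "S \<in> sets borel" by (simp add: borel_eq_box)
      have "(LINT x|lebesgue. indicator (?A \<inter> (UNIV - S)) x * G x)
          = (LINT x|lebesgue. indicator ?A x * G x - indicator (?A \<inter> S) x * G x)"
        by (intro Bochner_Integration.integral_cong) (auto simp: indicator_def)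
      also have "\<dots> = (LINT x|lebesgue. indicator ?A x * G x) - (LINT x|lebesgue. indicator (?A \<inter> S) x * G x)"
        by (intro Bochner_Integration.integral_diff int) (use S in auto)
      finally show ?case using compl.IH box[of a b] by simp
    next
      case (union S)
      then have S: "S i \<in> sets borel" for i using union(2) by (auto simp: borel_eq_box)
      have mU: "(\<Union>i. ?A \<inter> S i) \<in> sets lebesgue"
        using S by (intro sets.countable_UN) auto
      have "(LINT x:(\<Union>i. ?A \<inter> S i)|lebesgue. G x) = (\<Sum>i. LINT x:(?A \<inter> S i)|lebesgue. G x)"
        by (rule lebesgue_integral_countable_add)
          (use S union(1) int[OF mU] in \<open>auto simp: disjoint_family_on_def set_integrable_def\<close>)
      moreover have "(\<Union>i. ?A \<inter> S i) = ?A \<inter> (\<Union>i. S i)" by blast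
      ultimately show ?case using union.IH by (simp add: set_lebesgue_integral_def)
    qed
  qed
  obtain G' where G': "G' \<in> borel_measurable lborel" "AE x in lborel. G x = G' x"
    using completion_ex_borel_measurable_real[of G lborel] G by auto
  have ae: "AE x in lebesgue. G x = G' x" using G'(2) by (rule AE_completion)
  have mG': "G' \<in> borel_measurable borel" using G' by simp
  have sign: "AE x in lebesgue. indicator (?A \<inter> {x. s * G' x > 0}) x * (s * G x) = 0" if "s = 1 \<or> s = -1" for s
  proof -
    have m: "{x. s * G' x > 0} \<in> sets borel" using mG' by measurable
    let ?f = "\<lambda>x. indicator (?A \<inter> {x. s * G' x > 0}) x * (s * G x)"
    have "(LINT x|lebesgue. ?f x) = s * (LINT x|lebesgue. indicator (?A \<inter> {x. s * G' x > 0}) x * G x)"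
      by (subst Bochner_Integration.integral_mult_right_zero[symmetric]) (simp add: mult_ac)
    also have "\<dots> = 0" using zero[OF m] by simp
    finally have 0: "(LINT x|lebesgue. ?f x) = 0" .
    have "integrable lebesgue (\<lambda>x. s * (indicator (?A \<inter> {x. s * G' x > 0}) x * G x))"
      by (intro Bochner_Integration.integrable_mult_right int) (use m in auto)
    then have "integrable lebesgue ?f" by (simp add: mult_ac)
    moreover have "AE x in lebesgue. 0 \<le> ?f x"
      using ae by eventually_elim (auto simp: indicator_def)
    ultimately show ?thesis using 0 integral_nonneg_eq_0_iff_AE by blast
  qed
  have "negligible (cbox a b - box a b)" by (rule negligible_frontier_interval)
  then have "AE x in lebesgue. x \<notin> cbox a b - box a b"
    unfolding negligible_iff_null_sets by (rule AE_not_in)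
  moreover have "AE x in lebesgue. indicator (?A \<inter> {x. 1 * G' x > 0}) x * (1 * G x) = 0"
    by (rule sign) simp
  moreover have "AE x in lebesgue. indicator (?A \<inter> {x. -1 * G' x > 0}) x * (-1 * G x) = 0"
    by (rule sign) simp
  ultimately show ?thesis
    using ae
  proof eventually_elim
    case (elim x)
    show ?case
    proof
      assume "x \<in> cbox a b"
      then have "x \<in> ?A" using elim by blast
      then have "G' x > 0 \<Longrightarrow> G x = 0" "G' x < 0 \<Longrightarrow> G x = 0" using elim by auto
      then show "G x = 0" using elim(4) by (cases "G' x" "0::real" rule: linorder_cases) auto
    qed
  qed
qed

text \<open>Dominated convergence along the box bumps turns the hypothesis on test functions into vanishing integrals over all
boxes in \<open>U\<close>; countably many closed boxes cover \<open>U\<close>.\<close>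

lemma fundamental_lemma_of_variations:
  assumes U: "open U" "U \<subseteq> \<Omega>" and \<Omega>: "\<Omega> \<in> sets lebesgue"
    and g: "integrable (lebesgue_on \<Omega>) g"
    and zero: "\<And>\<psi>. test_function U \<psi> \<Longrightarrow> (LINT x|lebesgue_on \<Omega>. g x * \<psi> x) = 0"
  shows "AE x in lebesgue_on \<Omega>. x \<in> U \<longrightarrow> g x = 0"
proof -
  define G where "G x = indicator \<Omega> x * g x" for x
  have iG: "integrable lebesgue G"
    using g \<Omega> unfolding G_def by (subst (asm) integrable_restrict_space) auto
  have box: "(LINT x|lebesgue. indicator (box c d) x * G x) = 0" if "cbox c d \<subseteq> U" for c d
  proof -
    have "(\<lambda>n. LINT x|lebesgue. box_bump c d n x * G x) \<longlonglongrightarrow> (LINT x|lebesgue. indicator (box c d) x * G x)"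
    proof (rule integral_dominated_convergence[where w = "\<lambda>x. \<bar>G x\<bar>"])
      show "(\<lambda>x. indicator (box c d) x * G x) \<in> borel_measurable lebesgue"
        using iG by (intro borel_measurable_times borel_measurable_indicator) auto
      have "box_bump c d n \<in> borel_measurable borel" for n
        using test_functionD(2)[OF test_function_box_bump[OF that]] borel_measurable_continuous_onI by blast
      then have "box_bump c d n \<in> borel_measurable lebesgue" for n
        by (intro measurable_completion) simp
      then show "(\<lambda>x. box_bump c d n x * G x) \<in> borel_measurable lebesgue" for n
        using iG by (intro borel_measurable_times) auto
      show "integrable lebesgue (\<lambda>x. \<bar>G x\<bar>)" using iG by (rule integrable_abs)
      show "AE x in lebesgue. (\<lambda>n. box_bump c d n x * G x) \<longlonglongrightarrow> indicator (box c d) x * G x"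
        by (intro AE_I2 tendsto_mult box_bump_tendsto tendsto_const)
      show "AE x in lebesgue. norm (box_bump c d n x * G x) \<le> \<bar>G x\<bar>" for n
        using box_bump_bounds[of c d n] by (intro AE_I2) (auto simp: abs_mult intro!: mult_left_le_one_le)
    qed
    moreover have "(LINT x|lebesgue. box_bump c d n x * G x) = 0" for n
    proof -
      have "(LINT x|lebesgue_on \<Omega>. g x * box_bump c d n x) = (LINT x|lebesgue. box_bump c d n x * G x)"
        using \<Omega> by (subst integral_restrict_space) (auto simp: G_def mult_ac)
      then show ?thesis using zero[OF test_function_box_bump[OF that]] by simp
    qed
    ultimately show ?thesis by (simp add: LIMSEQ_const_iff)
  qed
  obtain D where D: "countable D" "D \<subseteq> Pow U" "\<And>X. X \<in> D \<Longrightarrow> \<exists>a b. X = cbox a b" "\<Union>D = U"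
    using open_countable_Union_open_cbox[OF U(1)] by blast
  have "AE x in lebesgue. \<forall>X\<in>D. x \<in> X \<longrightarrow> G x = 0"
  proof (subst AE_ball_countable[OF D(1)], intro ballI)
    fix X assume X: "X \<in> D"
    then obtain a b where ab: "X = cbox a b" using D by blast
    have "cbox c d \<subseteq> U" if "cbox c d \<subseteq> cbox a b" for c d
      using that X D(2) ab by blast
    then show "AE x in lebesgue. x \<in> X \<longrightarrow> G x = 0"
      unfolding ab using AE_zero_if_box_integrals_zero[OF iG] box by blast
  qed
  then show ?thesis
    using \<Omega> D(4) U(2) by (subst AE_restrict_space_iff) (auto simp: G_def elim!: eventually_mono)
qed

section \<open>Square-integrable functions\<close>

lemma L2_inner_integrable:
  fixes f g :: "real^3 \<Rightarrow> 'b::euclidean_space"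
  assumes "f \<in> L2 \<Omega>" "g \<in> L2 \<Omega>"
  shows "integrable (lebesgue_on \<Omega>) (\<lambda>x. f x \<bullet> g x)"
proof (rule Bochner_Integration.integrable_bound)
  show "integrable (lebesgue_on \<Omega>) (\<lambda>x. (norm (f x))\<^sup>2 + (norm (g x))\<^sup>2)"
    using assms by (auto simp: L2_def)
  show "(\<lambda>x. f x \<bullet> g x) \<in> borel_measurable (lebesgue_on \<Omega>)"
    using assms by (auto simp: L2_def)
  have "\<bar>f x \<bullet> g x\<bar> \<le> (norm (f x))\<^sup>2 + (norm (g x))\<^sup>2" for x
  proof -
    have "\<bar>f x \<bullet> g x\<bar> \<le> norm (f x) * norm (g x)" by (rule Cauchy_Schwarz_ineq2)
    also have "\<dots> \<le> (norm (f x))\<^sup>2 + (norm (g x))\<^sup>2"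
      using sum_squares_bound[of "norm (f x)" "norm (g x)"]
        mult_nonneg_nonneg[OF norm_ge_zero[of "f x"] norm_ge_zero[of "g x"]] by linarith
    finally show ?thesis .
  qed
  then show "AE x in lebesgue_on \<Omega>. norm (f x \<bullet> g x) \<le> norm ((norm (f x))\<^sup>2 + (norm (g x))\<^sup>2)"
    by (intro AE_I2) auto
qed

lemma L2_mult_integrable:
  fixes f g :: sfield
  assumes "f \<in> L2 \<Omega>" "g \<in> L2 \<Omega>"
  shows "integrable (lebesgue_on \<Omega>) (\<lambda>x. f x * g x)"
  using L2_inner_integrable[OF assms] by simp

lemma integral_inner_cong_AE:
  fixes f f' h :: "real^3 \<Rightarrow> 'b::euclidean_space"
  assumes "f \<in> L2 \<Omega>" "f' \<in> L2 \<Omega>" "h \<in> L2 \<Omega>" "AE x in lebesgue_on \<Omega>. f x = f' x"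
  shows "(LINT x|lebesgue_on \<Omega>. f x \<bullet> h x) = (LINT x|lebesgue_on \<Omega>. f' x \<bullet> h x)"
proof (rule integral_cong_AE)
  show "AE x in lebesgue_on \<Omega>. f x \<bullet> h x = f' x \<bullet> h x"
    using assms(4) by eventually_elim simp
qed (use L2_inner_integrable assms in blast)+

lemma L2_scaleR:
  fixes f :: "real^3 \<Rightarrow> 'b::euclidean_space"
  assumes "f \<in> L2 \<Omega>"
  shows "(\<lambda>x. a *\<^sub>R f x) \<in> L2 \<Omega>"
  using assms by (auto simp: L2_def power_mult_distrib)

lemma L2_add:
  fixes f g :: "real^3 \<Rightarrow> 'b::euclidean_space"
  assumes "f \<in> L2 \<Omega>" "g \<in> L2 \<Omega>"
  shows "(\<lambda>x. f x + g x) \<in> L2 \<Omega>"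
proof -
  have "integrable (lebesgue_on \<Omega>) (\<lambda>x. (norm (f x))\<^sup>2 + 2 * (f x \<bullet> g x) + (norm (g x))\<^sup>2)"
    using assms L2_inner_integrable[OF assms] by (auto simp: L2_def)
  moreover have "(norm (f x))\<^sup>2 + 2 * (f x \<bullet> g x) + (norm (g x))\<^sup>2 = (norm (f x + g x))\<^sup>2" for x
    by (simp add: power2_norm_eq_inner inner_add inner_commute)
  ultimately show ?thesis using assms by (auto simp: L2_def)
qed

lemma L2_diff:
  fixes f g :: "real^3 \<Rightarrow> 'b::euclidean_space"
  assumes "f \<in> L2 \<Omega>" "g \<in> L2 \<Omega>"
  shows "(\<lambda>x. f x - g x) \<in> L2 \<Omega>"
  using L2_add[OF assms(1) L2_scaleR[OF assms(2), of "-1"]] by simp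

lemma L2_nth:
  fixes f :: vfield
  assumes "f \<in> L2 \<Omega>"
  shows "(\<lambda>x. f x $ i) \<in> L2 \<Omega>"
proof -
  have m: "(\<lambda>x. f x $ i) \<in> borel_measurable (lebesgue_on \<Omega>)"
    using borel_measurable_inner[of f "lebesgue_on \<Omega>" "\<lambda>_. axis i 1"] assms
    by (simp add: L2_def inner_axis)
  have "integrable (lebesgue_on \<Omega>) (\<lambda>x. (f x $ i)\<^sup>2)"
  proof (rule Bochner_Integration.integrable_bound)
    show "integrable (lebesgue_on \<Omega>) (\<lambda>x. (norm (f x))\<^sup>2)" using assms by (simp add: L2_def)
    have "(f x $ i)\<^sup>2 \<le> (norm (f x))\<^sup>2" for x
      using power_mono[OF component_le_norm_cart abs_ge_zero, where n = 2] by (metis power2_abs)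
    then show "AE x in lebesgue_on \<Omega>. norm ((f x $ i)\<^sup>2) \<le> norm ((norm (f x))\<^sup>2)"
      by (intro AE_I2) simp
  qed (use m in auto)
  then show ?thesis using m by (simp add: L2_def)
qed

lemma AE_eq_if_components:
  fixes f g :: vfield
  assumes "\<And>i. AE x in M. f x $ i = g x $ i"
  shows "AE x in M. f x = g x"
proof -
  have "AE x in M. \<forall>i\<in>UNIV. f x $ i = g x $ i"
    using assms by (subst AE_finite_all) auto
  then show ?thesis by eventually_elim (simp add: vec_eq_iff)
qed

lemma L2_AE_bounded:
  fixes f :: "real^3 \<Rightarrow> 'b::euclidean_space"
  assumes "\<Omega> \<in> lmeasurable" "f \<in> borel_measurable (lebesgue_on \<Omega>)"
    and "AE x in lebesgue_on \<Omega>. norm (f x) \<le> b"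
  shows "f \<in> L2 \<Omega>"
proof -
  interpret finite_measure "lebesgue_on \<Omega>"
    using assms(1) by (simp add: finite_measure_lebesgue_on)
  have "integrable (lebesgue_on \<Omega>) (\<lambda>x. (norm (f x))\<^sup>2)"
  proof (rule integrable_const_bound)
    show "AE x in lebesgue_on \<Omega>. norm ((norm (f x))\<^sup>2) \<le> b\<^sup>2"
      using assms(3) by eventually_elim (simp add: power_mono)
  qed (use assms in auto)
  then show ?thesis using assms by (simp add: L2_def)
qed

lemma L2_const: "\<Omega> \<in> lmeasurable \<Longrightarrow> (\<lambda>x. a) \<in> L2 \<Omega>" for a :: "'b::euclidean_space"
  by (rule L2_AE_bounded[where b = "norm a"]) auto

lemma L2_integrable:
  fixes f :: sfield
  assumes "\<Omega> \<in> lmeasurable" "f \<in> L2 \<Omega>"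
  shows "integrable (lebesgue_on \<Omega>) f"
  using L2_mult_integrable[OF assms(2) L2_const[OF assms(1), of 1]] by simp

section \<open>Polynomials of bounded degree\<close>

definition monomial :: "(3 \<Rightarrow> nat) \<Rightarrow> sfield"
  where "monomial \<alpha> x = (\<Prod>i\<in>UNIV. (x $ i) ^ \<alpha> i)"

lemma finite_multi_indices: "finite {\<alpha> :: 3 \<Rightarrow> nat. (\<Sum>i\<in>UNIV. \<alpha> i) \<le> k}"
proof (rule finite_subset)
  show "{\<alpha> :: 3 \<Rightarrow> nat. (\<Sum>i\<in>UNIV. \<alpha> i) \<le> k} \<subseteq> PiE UNIV (\<lambda>_. {..k})"
  proof
    fix \<alpha> :: "3 \<Rightarrow> nat" assume "\<alpha> \<in> {\<alpha>. (\<Sum>i\<in>UNIV. \<alpha> i) \<le> k}"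
    then have "\<alpha> i \<le> k" for i
      using member_le_sum[of i UNIV \<alpha>] by simp
    then show "\<alpha> \<in> PiE UNIV (\<lambda>_. {..k})" by (simp add: PiE_UNIV_domain)
  qed
qed (auto intro: finite_PiE)

lemma Pol_iff: "p \<in> Pol k \<longleftrightarrow> (\<exists>a. p = (\<lambda>x. \<Sum>\<alpha> | (\<Sum>i\<in>UNIV. \<alpha> i) \<le> k. a \<alpha> * monomial \<alpha> x))"
  unfolding Pol_def monomial_def[abs_def] fun_eq_iff by simp

lemma Pol_add: "p \<in> Pol k \<Longrightarrow> q \<in> Pol k \<Longrightarrow> (\<lambda>x. p x + q x) \<in> Pol k"
proof -
  assume "p \<in> Pol k" "q \<in> Pol k"
  then obtain a b where "p = (\<lambda>x. \<Sum>\<alpha> | (\<Sum>i\<in>UNIV. \<alpha> i) \<le> k. a \<alpha> * monomial \<alpha> x)"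
    "q = (\<lambda>x. \<Sum>\<alpha> | (\<Sum>i\<in>UNIV. \<alpha> i) \<le> k. b \<alpha> * monomial \<alpha> x)" unfolding Pol_iff by blast
  then show ?thesis unfolding Pol_iff
    by (intro exI[of _ "\<lambda>\<alpha>. a \<alpha> + b \<alpha>"]) (simp add: distrib_right sum.distrib)
qed

lemma Pol_cmult: "p \<in> Pol k \<Longrightarrow> (\<lambda>x. c * p x) \<in> Pol k"
proof -
  assume "p \<in> Pol k"
  then obtain a where "p = (\<lambda>x. \<Sum>\<alpha> | (\<Sum>i\<in>UNIV. \<alpha> i) \<le> k. a \<alpha> * monomial \<alpha> x)"
    unfolding Pol_iff by blast
  then show ?thesis unfolding Pol_iff
    by (intro exI[of _ "\<lambda>\<alpha>. c * a \<alpha>"]) (simp add: sum_distrib_left mult.assoc)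
qed

lemma Pol_monomial:
  assumes "(\<Sum>i\<in>UNIV. \<alpha> i) \<le> k"
  shows "monomial \<alpha> \<in> Pol k"
  unfolding Pol_iff
proof (intro exI ext)
  show "monomial \<alpha> x = (\<Sum>\<beta> | (\<Sum>i\<in>UNIV. \<beta> i) \<le> k. (if \<beta> = \<alpha> then 1 else 0) * monomial \<beta> x)" for x
    using assms finite_multi_indices by (simp add: if_distrib[of "\<lambda>c. c * _"] cong: if_cong)
qed

lemma Pol_const: "(\<lambda>x. c) \<in> Pol k"
  using Pol_cmult[OF Pol_monomial[of "\<lambda>_. 0" k], of c] by (simp add: monomial_def)

lemma Pol_diff: "p \<in> Pol k \<Longrightarrow> q \<in> Pol k \<Longrightarrow> (\<lambda>x. p x - q x) \<in> Pol k"
  using Pol_add[OF _ Pol_cmult[of q k "-1"], of p] by simp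

lemma Pol_induct [consumes 1, case_names add monomial]:
  assumes "p \<in> Pol k"
    and add: "\<And>p q. P p \<Longrightarrow> P q \<Longrightarrow> P (\<lambda>x. p x + q x)"
    and mono: "\<And>a \<alpha>. (\<Sum>i\<in>UNIV. \<alpha> i) \<le> k \<Longrightarrow> P (\<lambda>x. a * monomial \<alpha> x)"
  shows "P p"
proof -
  obtain a where p: "p = (\<lambda>x. \<Sum>\<alpha> | (\<Sum>i\<in>UNIV. \<alpha> i) \<le> k. a \<alpha> * monomial \<alpha> x)"
    using assms(1) unfolding Pol_iff by blast
  have "P (\<lambda>x. \<Sum>\<alpha>\<in>A. a \<alpha> * monomial \<alpha> x)"
    if "finite A" "A \<subseteq> {\<alpha>. (\<Sum>i\<in>UNIV. \<alpha> i) \<le> k}" for A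
    using that
  proof (induction A)
    case empty
    show ?case using mono[of "\<lambda>_. 0" 0] by simp
  next
    case (insert \<alpha> A)
    then show ?case using add[OF mono[of \<alpha> "a \<alpha>"]] by simp
  qed
  from this[OF finite_multi_indices] show ?thesis unfolding p by blast
qed

lemma Pol_mono:
  assumes "k \<le> l" "p \<in> Pol k"
  shows "p \<in> Pol l"
  using assms(2)
proof (induction rule: Pol_induct)
  case (monomial a \<alpha>)
  then show ?case using assms(1) by (intro Pol_cmult Pol_monomial) simp
qed (rule Pol_add)

lemma monomial_Suc: "monomial (\<alpha>(j := Suc (\<alpha> j))) x = x $ j * monomial \<alpha> x"
proof -
  have "monomial (\<alpha>(j := Suc (\<alpha> j))) x = (x $ j) ^ Suc (\<alpha> j) * (\<Prod>i\<in>UNIV - {j}. (x $ i) ^ \<alpha> i)"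
    unfolding monomial_def by (subst prod.remove[of UNIV j]) auto
  moreover have "monomial \<alpha> x = (x $ j) ^ \<alpha> j * (\<Prod>i\<in>UNIV - {j}. (x $ i) ^ \<alpha> i)"
    unfolding monomial_def by (subst prod.remove[of UNIV j]) auto
  ultimately show ?thesis by simp
qed

lemma sum_fun_upd_Suc: "(\<Sum>i\<in>UNIV. (\<alpha>(j := Suc (\<alpha> j))) i) = Suc (\<Sum>i\<in>UNIV. \<alpha> i)" for \<alpha> :: "3 \<Rightarrow> nat"
  by (simp add: sum.remove[of UNIV j])

lemma Pol_coord_mult:
  assumes "p \<in> Pol k"
  shows "(\<lambda>x. x $ j * p x) \<in> Pol (Suc k)"
  using assms
proof (induction rule: Pol_induct)
  case (add p q)
  then show ?case using Pol_add[of "\<lambda>x. x $ j * p x" _ "\<lambda>x. x $ j * q x"] by (simp add: distrib_left)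
next
  case (monomial a \<alpha>)
  then have "monomial (\<alpha>(j := Suc (\<alpha> j))) \<in> Pol (Suc k)"
    using sum_fun_upd_Suc by (intro Pol_monomial) simp
  from Pol_cmult[OF this, of a] show ?case by (simp add: monomial_Suc mult.left_commute)
qed

text \<open>Induction on the degree, splitting off one coordinate: \<open>monomial \<alpha> = x $ j * monomial \<beta>\<close>. The claim that the
derivatives of a constant vanish is carried along because \<open>n - 1\<close> is truncated: for \<open>\<alpha>\<close> of degree one the term
\<open>x $ j * pd i (monomial \<beta>)\<close> has to lie in \<open>Pol 0\<close>.\<close>

lemma monomial_pd:
  "(\<Sum>i\<in>UNIV. \<alpha> i) = n \<Longrightarrow> (\<forall>x. monomial \<alpha> differentiable (at x)) \<and>
    (\<forall>i. pd i (monomial \<alpha>) \<in> Pol (n - 1) \<and> (n = 0 \<longrightarrow> pd i (monomial \<alpha>) = (\<lambda>x. 0)))"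
proof (induction n arbitrary: \<alpha>)
  case 0
  then have "monomial \<alpha> = (\<lambda>x. 1)" by (auto simp: monomial_def)
  then show ?case using Pol_const by simp
next
  case (Suc n)
  then obtain j where j: "\<alpha> j > 0" by (metis gr0I sum.neutral old.nat.distinct(2))
  define \<beta> where "\<beta> = \<alpha>(j := \<alpha> j - 1)"
  have \<alpha>: "\<alpha> = \<beta>(j := Suc (\<beta> j))" using j by (auto simp: \<beta>_def)
  have s: "(\<Sum>i\<in>UNIV. \<beta> i) = n" using Suc.prems unfolding \<alpha> sum_fun_upd_Suc by simp
  note IH = Suc.IH[OF s]
  have m: "monomial \<alpha> = (\<lambda>x. x $ j * monomial \<beta> x)" unfolding \<alpha> by (rule ext) (rule monomial_Suc)
  have c: "(\<lambda>x::real^3. x $ j) differentiable (at x)" for x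
    by (intro bounded_linear_imp_differentiable bounded_linear_vec_nth)
  have pd: "pd i (monomial \<alpha>) = (\<lambda>x. (if i = j then 1 else 0) * monomial \<beta> x + x $ j * pd i (monomial \<beta>) x)" for i
    unfolding m using pd_mult[OF c, of "monomial \<beta>"] IH by (auto simp: pd_coord)
  have "(\<lambda>x. x $ j * pd i (monomial \<beta>) x) \<in> Pol n" for i
  proof (cases n)
    case 0
    then show ?thesis using IH Pol_const by simp
  next
    case (Suc l)
    then show ?thesis using Pol_coord_mult[of _ l] IH by simp
  qed
  then have "pd i (monomial \<alpha>) \<in> Pol n" for i
    unfolding pd using s by (intro Pol_add Pol_cmult Pol_monomial) auto
  moreover have "monomial \<alpha> differentiable (at x)" for x
    unfolding m using IH c by (intro differentiable_mult) auto
  ultimately show ?case by simp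
qed

lemma Pol_derivatives:
  assumes "p \<in> Pol k"
  shows "(\<forall>x. p differentiable (at x)) \<and> (\<forall>i. pd i p \<in> Pol (k - 1))"
  using assms
proof (induction rule: Pol_induct)
  case (add p q)
  then have "pd i (\<lambda>x. p x + q x) = (\<lambda>x. pd i p x + pd i q x)" for i
    using pd_add by blast
  with add show ?case by (auto intro: Pol_add differentiable_add)
next
  case (monomial a \<alpha>)
  have d: "monomial \<alpha> differentiable (at x)" for x using monomial_pd[OF refl] by blast
  then have "pd i (\<lambda>x. a * monomial \<alpha> x) = (\<lambda>x. a * pd i (monomial \<alpha>) x)" for i
    using pd_cmult by blast
  moreover have "pd i (monomial \<alpha>) \<in> Pol (k - 1)" for i
    using monomial_pd[OF refl, of \<alpha>] monomial by (meson Pol_mono diff_le_mono)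
  ultimately show ?case using d by (auto intro: Pol_cmult)
qed

lemma Pol_differentiable: "p \<in> Pol k \<Longrightarrow> p differentiable (at x)"
  using Pol_derivatives by blast

lemma Pol_pd: "p \<in> Pol (Suc k) \<Longrightarrow> pd i p \<in> Pol k"
  using Pol_derivatives[of p "Suc k"] by simp

lemma Pol_pd_same: "p \<in> Pol k \<Longrightarrow> pd i p \<in> Pol k"
  using Pol_derivatives[of p k] Pol_mono[of "k - 1" k] by simp

lemma Pol_continuous: "p \<in> Pol k \<Longrightarrow> continuous_on UNIV p"
  by (rule differentiable_imp_continuous_on) (rule Pol_differentiable)

lemma PolV_continuous: "p \<in> PolV k \<Longrightarrow> continuous_on UNIV p"
  by (rule continuous_on_vecI) (auto simp: PolV_def intro: Pol_continuous)

section \<open>Linear functionals on finitely spanned function spaces\<close>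

text \<open>The functions of \<open>V\<close> are spanned on \<open>S\<close> by the \<open>b i\<close>, which need not belong to \<open>V\<close>, and the inner
product may be degenerate. So the proof is an induction on the number of spanning functions rather than a choice
of basis. The subspace \<open>V'\<close> of functions that can be written without \<open>b j\<close> has a representing function by induction,
and codimension at most one; what remains is a correction along a vector \<open>v\<close> orthogonal to \<open>V'\<close>.\<close>

lemma Riesz_representation_spanned:
  fixes V :: "('a \<Rightarrow> real) set" and b :: "'i \<Rightarrow> 'a \<Rightarrow> real"
  assumes "finite I"
    and V0: "(\<lambda>x. 0) \<in> V" and lin: "\<And>f g a. f \<in> V \<Longrightarrow> g \<in> V \<Longrightarrow> (\<lambda>x. f x + a * g x) \<in> V"
    and int: "\<And>f g. f \<in> V \<Longrightarrow> g \<in> V \<Longrightarrow> integrable M (\<lambda>x. f x * g x)"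
    and \<Lambda>: "\<And>f g a. f \<in> V \<Longrightarrow> g \<in> V \<Longrightarrow> \<Lambda> (\<lambda>x. f x + a * g x) = \<Lambda> f + a * \<Lambda> g"
    and null: "\<And>f. f \<in> V \<Longrightarrow> (LINT x|M. f x * f x) = 0 \<Longrightarrow> \<Lambda> f = 0"
    and S: "AE x in M. x \<in> S"
    and span: "\<And>f. f \<in> V \<Longrightarrow> \<exists>a. \<forall>x\<in>S. f x = (\<Sum>i\<in>I. a i * b i x)"
  shows "\<exists>d\<in>V. \<forall>f\<in>V. (LINT x|M. d x * f x) = \<Lambda> f"
  using assms
proof (induction I arbitrary: V \<Lambda> rule: finite_induct)
  case empty
  have "(LINT x|M. 0 * f x) = \<Lambda> f" if f: "f \<in> V" for f
  proof -
    have "\<forall>x\<in>S. f x = 0" using empty.prems(7)[OF f] by simp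
    then have "AE x in M. f x * f x = 0" using S by (auto elim!: eventually_mono)
    then have "(LINT x|M. f x * f x) = 0" by (rule integral_eq_zero_AE)
    then show ?thesis using empty.prems(5)[OF f] by simp
  qed
  then show ?case using empty.prems(1) by (intro bexI[of _ "\<lambda>x. 0"]) auto
next
  case (insert j I)
  note V0 = insert.prems(1) and lin = insert.prems(2) and int = insert.prems(3)
    and \<Lambda> = insert.prems(4) and null = insert.prems(5) and span = insert.prems(7)
  define V' where "V' = {f \<in> V. \<exists>a. \<forall>x\<in>S. f x = (\<Sum>i\<in>I. a i * b i x)}"
  have V'V: "f \<in> V" if "f \<in> V'" for f using that by (simp add: V'_def)
  have V'0: "(\<lambda>x. 0) \<in> V'" unfolding V'_def using V0 by (auto intro: exI[of _ "\<lambda>_. 0"])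
  have V'lin: "(\<lambda>x. f x + a * g x) \<in> V'" if fg: "f \<in> V'" "g \<in> V'" for f g a
  proof -
    obtain p q where "\<forall>x\<in>S. f x = (\<Sum>i\<in>I. p i * b i x)" "\<forall>x\<in>S. g x = (\<Sum>i\<in>I. q i * b i x)"
      using fg unfolding V'_def by blast
    then have "\<forall>x\<in>S. f x + a * g x = (\<Sum>i\<in>I. (p i + a * q i) * b i x)"
      by (simp add: sum.distrib sum_distrib_left distrib_right mult.assoc)
    then have "\<exists>c. \<forall>x\<in>S. f x + a * g x = (\<Sum>i\<in>I. c i * b i x)"
      by (intro exI[of _ "\<lambda>i. p i + a * q i"])
    then show ?thesis using lin[OF V'V[OF fg(1)] V'V[OF fg(2)]] by (simp add: V'_def)
  qed
  have IH: "\<exists>d\<in>V'. \<forall>f\<in>V'. (LINT x|M. d x * f x) = \<Lambda>' f"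
    if "\<And>f g a. f \<in> V' \<Longrightarrow> g \<in> V' \<Longrightarrow> \<Lambda>' (\<lambda>x. f x + a * g x) = \<Lambda>' f + a * \<Lambda>' g"
      and "\<And>f. f \<in> V' \<Longrightarrow> (LINT x|M. f x * f x) = 0 \<Longrightarrow> \<Lambda>' f = 0" for \<Lambda>'
    by (rule insert.IH[of V' \<Lambda>', OF V'0 V'lin int[OF V'V V'V] that S]) (simp_all add: V'_def)
  obtain d where d: "d \<in> V'" "\<And>f. f \<in> V' \<Longrightarrow> (LINT x|M. d x * f x) = \<Lambda> f"
    using IH[of \<Lambda>] \<Lambda> null V'V by blast
  show ?case
  proof (cases "V \<subseteq> V'")
    case True
    then show ?thesis using d V'V by blast
  next
    case False
    then obtain u where u: "u \<in> V" "u \<notin> V'" by blast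
    obtain a where a: "\<And>x. x \<in> S \<Longrightarrow> u x = (\<Sum>i\<in>insert j I. a i * b i x)"
      using span[OF u(1)] by blast
    have aj: "a j \<noteq> 0"
    proof
      assume "a j = 0"
      then have "\<forall>x\<in>S. u x = (\<Sum>i\<in>I. a i * b i x)" using a insert.hyps by simp
      then show False using u by (auto simp: V'_def)
    qed
    have decomp: "\<exists>t. (\<lambda>x. f x + t * u x) \<in> V'" if f: "f \<in> V" for f
    proof -
      obtain c where c: "\<And>x. x \<in> S \<Longrightarrow> f x = (\<Sum>i\<in>insert j I. c i * b i x)"
        using span[OF f] by blast
      let ?t = "- c j / a j"
      have "f x + ?t * u x = (\<Sum>i\<in>I. (c i + ?t * a i) * b i x)" if "x \<in> S" for x
      proof -
        have "f x + ?t * u x = (\<Sum>i\<in>insert j I. (c i + ?t * a i) * b i x)"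
          unfolding a[OF that] c[OF that] sum_distrib_left sum.distrib[symmetric]
          by (simp add: algebra_simps)
        then show ?thesis using insert.hyps aj by simp
      qed
      then have "\<exists>e. \<forall>x\<in>S. f x + ?t * u x = (\<Sum>i\<in>I. e i * b i x)"
        by (intro exI[of _ "\<lambda>i. c i + ?t * a i"]) simp
      then show ?thesis unfolding V'_def using lin[OF f u(1), of ?t] by blast
    qed
    \<comment> \<open>The orthogonal projection of \<open>u\<close> exists by the induction hypothesis, applied to \<open>\<langle>u, -\<rangle>\<close>.\<close>
    obtain p where p: "p \<in> V'" "\<And>f. f \<in> V' \<Longrightarrow> (LINT x|M. p x * f x) = (LINT x|M. u x * f x)"
    proof -
      have "(LINT x|M. u x * f x) = 0" if f: "f \<in> V'" and z: "(LINT x|M. f x * f x) = 0" for f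
      proof -
        have "AE x in M. f x * f x = 0"
          using integral_nonneg_eq_0_iff_AE[OF int[OF V'V[OF f] V'V[OF f]]] z by simp
        then have "AE x in M. u x * f x = 0" by eventually_elim simp
        then show ?thesis by (rule integral_eq_zero_AE)
      qed
      moreover have "(LINT x|M. u x * (f x + a * g x)) = (LINT x|M. u x * f x) + a * (LINT x|M. u x * g x)"
        if "f \<in> V'" "g \<in> V'" for f g a
        using int[OF u(1) V'V[OF that(1)]] int[OF u(1) V'V[OF that(2)]]
        by (simp add: distrib_left mult.left_commute[of _ a])
      ultimately show ?thesis using IH[of "\<lambda>f. LINT x|M. u x * f x"] that by blast
    qed
    define v where "v x = u x + (- 1) * p x" for x
    have v: "v \<in> V" unfolding v_def[abs_def] by (rule lin[OF u(1) V'V[OF p(1)]])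
    have orth: "(LINT x|M. v x * f x) = 0" if f: "f \<in> V'" for f
      using p(2)[OF f] int[OF u(1) V'V[OF f]] int[OF V'V[OF p(1)] V'V[OF f]]
      by (simp add: v_def left_diff_distrib)
    \<comment> \<open>If \<open>v\<close> is a null vector, both sides of the equation for \<open>s\<close> are zero, with \<open>x / 0 = 0\<close>.\<close>
    define s where "s = \<Lambda> v / (LINT x|M. v x * v x)"
    have s: "s * (LINT x|M. v x * v x) = \<Lambda> v" using null[OF v] by (auto simp: s_def)
    have rep: "(LINT x|M. (d x + s * v x) * f x) = \<Lambda> f" if f: "f \<in> V" for f
    proof -
      obtain t where t: "(\<lambda>x. f x + t * u x) \<in> V'" using decomp[OF f] by blast
      define h where "h x = (f x + t * u x) + (- t) * p x" for x
      have h: "h \<in> V'" unfolding h_def[abs_def] by (rule V'lin[OF t p(1)])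
      have f_eq: "f = (\<lambda>x. h x + (- t) * v x)" by (auto simp: h_def v_def algebra_simps)
      have "\<Lambda> f = \<Lambda> h + (- t) * \<Lambda> v" unfolding f_eq by (rule \<Lambda>[OF V'V[OF h] v])
      moreover have "(LINT x|M. (d x + s * v x) * f x)
          = (LINT x|M. d x * h x + (- t) * (v x * d x) + s * (v x * h x) + (- t * s) * (v x * v x))"
        unfolding f_eq by (simp add: algebra_simps)
      moreover have "\<dots> = (LINT x|M. d x * h x) + (- t) * (LINT x|M. v x * d x)
          + s * (LINT x|M. v x * h x) + (- t * s) * (LINT x|M. v x * v x)"
        using int[OF V'V[OF d(1)] V'V[OF h]] int[OF v V'V[OF d(1)]] int[OF v V'V[OF h]] int[OF v v]
        by simp
      ultimately show ?thesis using d(2)[OF h] orth[OF h] orth[OF d(1)] s by simp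
    qed
    have "(\<lambda>x. d x + s * v x) \<in> V" by (rule lin[OF V'V[OF d(1)] v])
    then show ?thesis using rep by (rule_tac bexI[of _ "\<lambda>x. d x + s * v x"]) auto
  qed
qed

section \<open>Convex cells and plane faces\<close>

lemma affine_hull_eq_plane:
  fixes F :: "point set"
  assumes "aff_dim F = 2" "n \<noteq> 0" "\<And>x. x \<in> F \<Longrightarrow> n \<bullet> x = b"
  shows "affine hull F = {x. n \<bullet> x = b}"
proof (rule affine_dim_equal)
  show "affine hull F \<noteq> {}" using assms(1) by auto
  show "affine hull F \<subseteq> {x. n \<bullet> x = b}"
    by (rule hull_minimal) (use assms(3) affine_hyperplane in auto)
  show "aff_dim (affine hull F) = aff_dim {x. n \<bullet> x = b}"
    using assms by simp
qed (auto simp: affine_hyperplane)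

lemma closure_eqI:
  fixes f g :: "real^3 \<Rightarrow> 'b::real_normed_vector"
  assumes "continuous_on UNIV f" "continuous_on UNIV g"
    and "\<And>x. x \<in> S \<Longrightarrow> f x = g x" "x \<in> closure S"
  shows "f x = g x"
proof -
  have "closed {x. f x = g x}" using assms by (intro closed_Collect_eq) auto
  then have "closure S \<subseteq> {x. f x = g x}" using assms(3) by (intro closure_minimal) auto
  then show ?thesis using assms(4) by blast
qed

lemma subset_closure_rel_interior:
  fixes F :: "point set"
  assumes "convex F" shows "F \<subseteq> closure (rel_interior F)"
  using convex_closure_rel_interior[OF assms] closure_subset by blast

text \<open>At a relatively interior point a short segment in a tangential direction stays in the face, where \<open>p\<close> vanishes.
The other points are reached by continuity of the derivatives.\<close>

lemma tangential_derivative_zero: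
  assumes F: "convex F" "aff_dim F = 2" "n \<noteq> 0" "\<And>x y. x \<in> F \<Longrightarrow> y \<in> F \<Longrightarrow> n \<bullet> (x - y) = 0"
    and p: "\<And>x. p differentiable (at x)" "\<And>i. continuous_on UNIV (pd i p)"
    and zero: "\<And>x. x \<in> F \<Longrightarrow> p x = 0"
    and x: "x \<in> F" and t: "n \<bullet> t = 0"
  shows "(\<Sum>i\<in>UNIV. t $ i * pd i p x) = 0"
proof -
  have "n \<bullet> y = n \<bullet> x" if "y \<in> F" for y
    using F(4)[OF that x] by (simp add: inner_diff_right)
  then have hull: "affine hull F = {y. n \<bullet> y = n \<bullet> x}"
    by (rule affine_hull_eq_plane[OF F(2,3)])
  have "(\<Sum>i\<in>UNIV. t $ i * pd i p y) = 0" if y: "y \<in> rel_interior F" for y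
  proof -
    obtain r where r: "r > 0" "ball y r \<inter> affine hull F \<subseteq> F" and yF: "y \<in> F"
      using y mem_rel_interior_ball by blast
    have D: "((\<lambda>s::real. p (y + s *\<^sub>R t)) has_derivative (\<lambda>s. \<Sum>i\<in>UNIV. (s *\<^sub>R t) $ i * pd i p y)) (at 0)"
    proof -
      have "((\<lambda>s::real. y + s *\<^sub>R t) has_derivative (\<lambda>s. s *\<^sub>R t)) (at 0)"
        by (auto intro!: derivative_eq_intros)
      moreover have "(p has_derivative (\<lambda>v. \<Sum>i\<in>UNIV. v $ i * pd i p y)) (at (y + 0 *\<^sub>R t))"
        using has_derivative_pd[OF p(1)[of y]] by simp
      ultimately show ?thesis by (rule has_derivative_compose)
    qed
    have "((\<lambda>s::real. 0) has_derivative (\<lambda>s. 0)) (at 0)" by simp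
    then have "((\<lambda>s::real. p (y + s *\<^sub>R t)) has_derivative (\<lambda>s. 0)) (at 0)"
    proof (rule has_derivative_transform_within_open)
      show "open (ball 0 (r / (norm t + 1)) :: real set)" by simp
      show "0 \<in> (ball 0 (r / (norm t + 1)) :: real set)"
        using r by (simp add: add_nonneg_pos)
      fix s :: real assume s: "s \<in> ball 0 (r / (norm t + 1))"
      have pos: "norm t + 1 > 0" by (simp add: add_nonneg_pos)
      have "\<bar>s\<bar> * norm t \<le> \<bar>s\<bar> * (norm t + 1)" by (intro mult_left_mono) auto
      also have "\<dots> < r" using s pos by (simp add: pos_less_divide_eq)
      finally have "y + s *\<^sub>R t \<in> ball y r" by (simp add: dist_norm)
      moreover have "n \<bullet> (y + s *\<^sub>R t) = n \<bullet> x"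
        using F(4)[OF yF x] t by (simp add: inner_add_right inner_diff_right)
      ultimately have "y + s *\<^sub>R t \<in> F" using r hull by blast
      then show "0 = p (y + s *\<^sub>R t)" using zero by simp
    qed
    then have "(\<lambda>s. \<Sum>i\<in>UNIV. (s *\<^sub>R t) $ i * pd i p y) = (\<lambda>s. 0)"
      by (rule has_derivative_unique[OF D])
    from fun_cong[OF this, of 1] show ?thesis by simp
  qed
  moreover have "continuous_on UNIV (\<lambda>x. \<Sum>i\<in>UNIV. t $ i * pd i p x)"
    by (intro continuous_intros p(2))
  moreover have "x \<in> closure (rel_interior F)"
    using x subset_closure_rel_interior[OF F(1)] by blast
  ultimately show ?thesis
    using closure_eqI[of "\<lambda>x. \<Sum>i\<in>UNIV. t $ i * pd i p x" "\<lambda>_. 0" "rel_interior F" x] by simp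
qed

text \<open>Take a unit vector \<open>a\<close> orthogonal to \<open>n\<close> and \<open>b = n \<times> a\<close>; then \<open>a \<times> (n \<times> a) = n\<close>.\<close>

lemma orthonormal_frame:
  fixes n :: point
  assumes "norm n = 1"
  obtains a b where "n \<bullet> a = 0" "n \<bullet> b = 0" "cross3 a b = n"
proof -
  obtain a :: point where a: "a \<noteq> 0" "orthogonal n a"
    using orthogonal_to_vector_exists[of n] by auto
  define a' where "a' = a /\<^sub>R norm a"
  have a': "n \<bullet> a' = 0" "a' \<bullet> a' = 1"
    unfolding norm_eq_1[symmetric] using a by (simp_all add: a'_def orthogonal_def)
  have "cross3 a' (cross3 n a') = n"
    using a' Lagrange[of n a' a'] by (simp add: cross_triple cross_skew[of a'] Lagrange inner_commute)
  moreover have "n \<bullet> cross3 n a' = 0" by (simp add: dot_cross_self)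
  ultimately show ?thesis using that a'(1) by blast
qed

lemma unit_normal_nonzero: "unit_normal F n \<Longrightarrow> n \<noteq> 0"
  by (auto simp: unit_normal_def)

lemma interior_halfspace:
  fixes K :: "'a::euclidean_space set"
  assumes "n \<noteq> 0" "K \<subseteq> {x. n \<bullet> x \<le> b}" "z \<in> interior K"
  shows "n \<bullet> z < b"
proof -
  have "z \<in> interior {x. n \<bullet> x \<le> b}" using assms interior_mono by blast
  then show ?thesis using interior_halfspace_le[OF assms(1)] by auto
qed

text \<open>Near a relatively interior point of a face, the cell fills its side of the plane of the face. A small displacement
\<open>w\<close> to that side splits into a positive multiple \<open>s w\<close> of the direction to an interior point
\<open>z\<close> and a tangential part \<open>t w\<close>, both small. So \<open>x0 + w\<close> is a convex combination of \<open>z\<close> and a point of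
the face.\<close>

lemma one_sided_neighbourhood:
  fixes K :: "point set"
  assumes K: "convex K" "F \<subseteq> K" "z \<in> interior K" "n \<bullet> z < b"
    and F: "affine hull F = {x. n \<bullet> x = b}" "x0 \<in> rel_interior F"
  shows "\<exists>\<delta>>0. \<forall>w. norm w < \<delta> \<longrightarrow> (n \<bullet> w < 0 \<longrightarrow> x0 + w \<in> interior K) \<and> (n \<bullet> w = 0 \<longrightarrow> x0 + w \<in> K)"
proof -
  obtain r where r: "r > 0" "ball x0 r \<inter> affine hull F \<subseteq> F" and x0F: "x0 \<in> F"
    using F(2) mem_rel_interior_ball by blast
  have nx0: "n \<bullet> x0 = b" using F(1) x0F hull_subset[of F] by blast
  define c where "c = n \<bullet> (z - x0)"
  have c: "c < 0" using K(4) nx0 by (simp add: c_def inner_diff_right)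
  define s where "s w = (n \<bullet> w) / c" for w
  define t where "t w = w - s w *\<^sub>R (z - x0)" for w
  have nt: "n \<bullet> t w = 0" for w
    using c by (simp add: t_def s_def inner_diff_right c_def)
  have s0: "(s \<longlongrightarrow> 0) (at 0)"
    unfolding s_def using c by (auto intro!: tendsto_eq_intros)
  have "((\<lambda>w. t w /\<^sub>R (1 - s w)) \<longlongrightarrow> (0 - 0 *\<^sub>R (z - x0)) /\<^sub>R (1 - 0)) (at 0)"
    unfolding t_def by (intro tendsto_intros s0) auto
  then have "((\<lambda>w. t w /\<^sub>R (1 - s w)) \<longlongrightarrow> 0) (at 0)" by simp
  then have "((\<lambda>w. norm (t w /\<^sub>R (1 - s w))) \<longlongrightarrow> 0) (at 0)" by (rule tendsto_norm_zero)
  then have "\<forall>\<^sub>F w in at 0. norm (t w /\<^sub>R (1 - s w)) < r"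
    using r(1) by (rule order_tendstoD)
  moreover have "\<forall>\<^sub>F w in at 0. s w < 1" using s0 by (rule order_tendstoD) simp
  ultimately have "\<forall>\<^sub>F w in at 0. norm (t w /\<^sub>R (1 - s w)) < r \<and> s w < 1"
    by eventually_elim simp
  then obtain \<delta> where \<delta>: "\<delta> > 0" "\<And>w. w \<noteq> 0 \<Longrightarrow> norm w < \<delta> \<Longrightarrow> norm (t w /\<^sub>R (1 - s w)) < r \<and> s w < 1"
    unfolding eventually_at by (auto simp: dist_norm)
  show ?thesis
  proof (intro exI[of _ \<delta>] conjI allI impI \<delta>(1))
    fix w :: point assume w: "norm w < \<delta>"
    have *: "x0 + t w /\<^sub>R (1 - s w) \<in> F \<and> s w < 1" if "w \<noteq> 0"
    proof -
      have "x0 + t w /\<^sub>R (1 - s w) \<in> ball x0 r"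
        using \<delta>(2)[OF that w] by (metis add_diff_cancel_left' dist_commute dist_norm mem_ball)
      moreover have "x0 + t w /\<^sub>R (1 - s w) \<in> affine hull F"
        unfolding F(1) using nt[of w] nx0 by (simp add: inner_add_right)
      ultimately show ?thesis using r(2) \<delta>(2)[OF that w] by blast
    qed
    {
      assume nw: "n \<bullet> w < 0"
      then have "w \<noteq> 0" by auto
      note P = *[OF this]
      have sp: "s w > 0" using nw c by (simp add: s_def divide_neg_neg)
      let ?y = "x0 + t w /\<^sub>R (1 - s w)"
      have "?y - s w *\<^sub>R (?y - z) \<in> interior K"
        by (rule mem_interior_convex_shrink[OF K(1,3)]) (use P K(2) sp in auto)
      moreover have "?y - s w *\<^sub>R (?y - z) = x0 + w"
      proof -
        have "?y - s w *\<^sub>R (?y - z) = (1 - s w) *\<^sub>R ?y + s w *\<^sub>R z" by (simp add: algebra_simps)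
        also have "(1 - s w) *\<^sub>R ?y = (1 - s w) *\<^sub>R x0 + t w" using P by (simp add: scaleR_add_right)
        also have "\<dots> + s w *\<^sub>R z = x0 + w" by (simp add: t_def algebra_simps)
        finally show ?thesis .
      qed
      ultimately show "x0 + w \<in> interior K" by simp
    }
    assume nw: "n \<bullet> w = 0"
    show "x0 + w \<in> K"
    proof (cases "w = 0")
      case True
      then show ?thesis using x0F K(2) by auto
    next
      case False
      have "s w = 0" "t w = w" using nw by (simp_all add: s_def t_def)
      then show ?thesis using *[OF False] K(2) by auto
    qed
  qed
qed

section \<open>Meshes, traces and piecewise continuous functions\<close>

text \<open>A convex cell is the closure of its interior, so each of its points can be approached from inside, and the limit there
is unique.\<close>

lemma trace_eq:
  fixes f :: "real^3 \<Rightarrow> 'b::t2_space"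
  assumes "convex K" "interior K \<noteq> {}" "x \<in> K"
    and "continuous_on UNIV p" "\<And>y. y \<in> interior K \<Longrightarrow> f y = p y"
  shows "trace K f x = p x"
proof -
  have "x \<in> closure (interior K)"
    using convex_closure_interior[OF assms(1,2)] assms(3) closure_subset by blast
  then have "x islimpt interior K"
    using interior_limit_point[of x "interior K"] unfolding closure_def by auto
  then have nt: "at x within interior K \<noteq> bot" using trivial_limit_within by blast
  have "(p \<longlongrightarrow> p x) (at x within interior K)"
    using assms(4) by (meson UNIV_I continuous_on_def tendsto_within_subset top_greatest)
  moreover have "\<forall>\<^sub>F y in at x within interior K. p y = f y"
    using assms(5) by (auto simp: eventually_at_filter)
  ultimately have "(f \<longlongrightarrow> p x) (at x within interior K)"
    by (rule Lim_transform_eventually)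
  then show ?thesis unfolding trace_def by (rule tendsto_Lim[OF nt])
qed

lemma face_integral_zero:
  assumes "\<And>x. x \<in> F \<Longrightarrow> g x = 0"
  shows "face_integral F g = 0"
proof -
  have "(LINT y|lebesgue_on {y. a + L y \<in> F}. g (a + L y)) = 0" for a :: point and L :: "real^2 \<Rightarrow> real^3"
  proof -
    have "(LINT y|lebesgue_on {y. a + L y \<in> F}. g (a + L y)) = (LINT y|lebesgue_on {y. a + L y \<in> F}. 0)"
      by (rule Bochner_Integration.integral_cong) (auto simp: space_restrict_space assms)
    then show ?thesis by simp
  qed
  then show ?thesis unfolding face_integral_def Let_def by (simp add: case_prod_beta)
qed

locale mesh =
  fixes \<Omega> :: "point set" and \<T> :: "point set set"
  assumes bounded: "bounded \<Omega>" and conforming: "conforming_mesh \<Omega> \<T>"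
begin

abbreviation "\<mu> \<equiv> lebesgue_on \<Omega>"
abbreviation "cells_interior \<equiv> \<Union>K\<in>\<T>. interior K"

lemma finite_cells: "finite \<T>"
  and domain: "\<Omega> = interior (\<Union>\<T>)"
  using conforming unfolding conforming_mesh_def by blast+

lemma cell_properties:
  assumes "K \<in> \<T>"
  shows "convex K" "compact K" "interior K \<noteq> {}" "interior K \<subseteq> \<Omega>"
proof -
  have "polytope K" "interior K \<noteq> {}"
    using assms conforming unfolding conforming_mesh_def by blast+
  then show "convex K" "compact K" "interior K \<noteq> {}"
    by (simp_all add: polytope_imp_compact polytope_imp_convex)
  show "interior K \<subseteq> \<Omega>"
    unfolding domain using assms by (intro interior_mono) blast
qed

lemma domain_open: "open \<Omega>" by (simp add: domain)

lemma domain_lmeasurable: "\<Omega> \<in> lmeasurable"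
  using bounded domain_open by (rule lmeasurable_open)

lemma domain_sets: "\<Omega> \<in> sets lebesgue"
  using domain_lmeasurable by blast

text \<open>If an interior point of \<open>K\<close> lay in \<open>K'\<close>, the face \<open>K \<inter> K'\<close> of \<open>K\<close> would be all of \<open>K\<close>, so
\<open>K\<close> would be a proper face of \<open>K'\<close> and miss the interior of \<open>K'\<close>, which contains that of \<open>K\<close>.\<close>

lemma interiors_disjoint:
  assumes "K \<in> \<T>" "K' \<in> \<T>" "K \<noteq> K'"
  shows "interior K \<inter> K' = {}"
proof -
  have f: "(K \<inter> K') face_of K" "(K \<inter> K') face_of K'"
    using assms conforming unfolding conforming_mesh_def by blast+
  have False if x: "x \<in> interior K \<inter> K'" for x
  proof -
    have "K \<inter> K' = K"
      using face_of_disjoint_interior[OF f(1)] x interior_subset by blast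
    then have "K face_of K'" using f(2) by simp
    moreover have "K' \<inter> interior K \<noteq> {}" using x by blast
    moreover have "interior K \<subseteq> interior K'"
      using \<open>K \<inter> K' = K\<close> by (intro interior_mono) blast
    ultimately show False
      using face_of_disjoint_interior[of K K'] assms(3) cell_properties(3)[OF assms(1)] interior_subset by blast
  qed
  then show ?thesis by blast
qed

lemma skeleton_negligible: "negligible (\<Union>\<T> - cells_interior)"
proof -
  have "negligible (\<Union>K\<in>\<T>. frontier K)"
    using finite_cells cell_properties by (intro negligible_Union) (auto intro: negligible_convex_frontier)
  moreover have "\<Union>\<T> - cells_interior \<subseteq> (\<Union>K\<in>\<T>. frontier K)"
    unfolding frontier_def using closure_subset by fastforce
  ultimately show ?thesis by (rule negligible_subset)
qed

lemma AE_cells_interior: "AE x in \<mu>. x \<in> cells_interior"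
proof -
  have "AE x in lebesgue. x \<notin> \<Union>\<T> - cells_interior"
    using skeleton_negligible unfolding negligible_iff_null_sets by (rule AE_not_in)
  moreover have "\<Omega> \<subseteq> \<Union>\<T>" unfolding domain by (rule interior_subset)
  ultimately show ?thesis
    using domain_sets by (subst AE_restrict_space_iff) (auto elim!: eventually_mono)
qed

lemma borel_measurable_cong_AE:
  fixes f g :: "real^3 \<Rightarrow> 'b::euclidean_space"
  assumes "f \<in> borel_measurable (\<mu>)" "AE x in \<mu>. f x = g x"
  shows "g \<in> borel_measurable (\<mu>)"
proof -
  have "(\<lambda>x. if x \<in> \<Omega> then f x else 0) \<in> borel_measurable lebesgue"
    using assms(1) domain_sets by (rule borel_measurable_if_I)
  moreover have "AE x in lebesgue. (if x \<in> \<Omega> then f x else 0) = (if x \<in> \<Omega> then g x else 0)"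
    using assms(2) domain_sets by (subst (asm) AE_restrict_space_iff) (auto elim!: eventually_mono)
  ultimately have "(\<lambda>x. if x \<in> \<Omega> then g x else 0) \<in> borel_measurable lebesgue"
    by (rule borel_measurable_AE)
  then show ?thesis using domain_sets borel_measurable_if_D by blast
qed

lemma piecewise_borel:
  fixes f :: "real^3 \<Rightarrow> 'b::euclidean_space"
  assumes "\<And>K. K \<in> \<T> \<Longrightarrow> \<exists>p. continuous_on UNIV p \<and> (\<forall>x\<in>interior K. f x = p x)"
  shows "(\<lambda>x. if x \<in> cells_interior then f x else 0) \<in> borel_measurable borel"
proof -
  obtain p where p: "\<And>K. K \<in> \<T> \<Longrightarrow> continuous_on UNIV (p K)"
    "\<And>K x. K \<in> \<T> \<Longrightarrow> x \<in> interior K \<Longrightarrow> f x = p K x" using assms by metis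
  define h where "h x = (\<Sum>K\<in>\<T>. indicator (interior K) x *\<^sub>R p K x)" for x
  have in_cell: "h x = f x" if x: "x \<in> cells_interior" for x
  proof -
    obtain K where K: "K \<in> \<T>" "x \<in> interior K" using x by blast
    have "indicator (interior L) x = (0::real)" if "L \<in> \<T> - {K}" for L
      using interiors_disjoint[of K L] interior_subset[of L] K that by (auto simp: indicator_def)
    then have "h x = indicator (interior K) x *\<^sub>R p K x"
      unfolding h_def using finite_cells K by (subst sum.remove[of _ K]) auto
    then show ?thesis using K p(2) by simp
  qed
  have "h x = 0" if "x \<notin> cells_interior" for x
    unfolding h_def using that by (intro sum.neutral) (auto simp: indicator_def)
  with in_cell have "h = (\<lambda>x. if x \<in> cells_interior then f x else 0)" by auto
  moreover have "h \<in> borel_measurable borel"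
    unfolding h_def using p(1) borel_measurable_continuous_onI
    by (intro borel_measurable_sum borel_measurable_scaleR borel_measurable_indicator) auto
  ultimately show ?thesis by simp
qed

lemma piecewise_measurable:
  fixes f :: "real^3 \<Rightarrow> 'b::euclidean_space"
  assumes "\<And>K. K \<in> \<T> \<Longrightarrow> \<exists>p. continuous_on UNIV p \<and> (\<forall>x\<in>interior K. f x = p x)"
  shows "f \<in> borel_measurable (\<mu>)"
proof -
  let ?h = "\<lambda>x. if x \<in> cells_interior then f x else 0"
  have "?h \<in> borel_measurable (\<mu>)"
    using piecewise_borel[of f] assms by (intro measurable_restrict_space1 measurable_completion) simp
  moreover have "AE x in \<mu>. ?h x = f x"
    using AE_cells_interior by (auto elim!: eventually_mono)
  ultimately show ?thesis by (rule borel_measurable_cong_AE)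
qed

lemma piecewise_bounded:
  fixes f :: "real^3 \<Rightarrow> 'b::euclidean_space"
  assumes "\<And>K. K \<in> \<T> \<Longrightarrow> \<exists>p. continuous_on UNIV p \<and> (\<forall>x\<in>interior K. f x = p x)"
  shows "\<exists>b. \<forall>x\<in>cells_interior. norm (f x) \<le> b"
proof -
  have "bounded (\<Union>K\<in>\<T>. f ` interior K)"
  proof (rule bounded_UN[OF finite_cells], rule ballI)
    fix K assume K: "K \<in> \<T>"
    then obtain p where p: "continuous_on UNIV p" "\<And>x. x \<in> interior K \<Longrightarrow> f x = p x"
      using assms by metis
    have "compact (p ` K)"
      using p(1) cell_properties(2)[OF K] by (meson compact_continuous_image continuous_on_subset top_greatest)
    moreover have "f ` interior K \<subseteq> p ` K" using p(2) interior_subset by fastforce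
    ultimately show "bounded (f ` interior K)" using compact_imp_bounded bounded_subset by blast
  qed
  then show ?thesis unfolding bounded_iff by blast
qed

lemma piecewise_L2:
  fixes f :: "real^3 \<Rightarrow> 'b::euclidean_space"
  assumes "\<And>K. K \<in> \<T> \<Longrightarrow> \<exists>p. continuous_on UNIV p \<and> (\<forall>x\<in>interior K. f x = p x)"
  shows "f \<in> L2 \<Omega>"
proof -
  obtain b where "\<And>x. x \<in> cells_interior \<Longrightarrow> norm (f x) \<le> b"
    using piecewise_bounded[of f] assms by blast
  then have "AE x in \<mu>. norm (f x) \<le> b"
    using AE_cells_interior by (auto elim!: eventually_mono)
  then show ?thesis
    using domain_lmeasurable piecewise_measurable[of f] assms L2_AE_bounded by blast
qed

lemma AE_domain_if_AE_cells:
  assumes "\<And>K. K \<in> \<T> \<Longrightarrow> AE x in \<mu>. x \<in> interior K \<longrightarrow> P x"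
  shows "AE x in \<mu>. P x"
proof -
  have "AE x in \<mu>. \<forall>K\<in>\<T>. x \<in> interior K \<longrightarrow> P x"
    using finite_cells assms by (subst AE_finite_all) auto
  then show ?thesis using AE_cells_interior by eventually_elim blast
qed

lemma interior_face:
  assumes "F \<in> interior_faces \<T>"
  obtains "cell1 \<T> F \<in> \<T>" "cell2 \<T> F \<in> \<T>" "cell1 \<T> F \<noteq> cell2 \<T> F"
    "F = cell1 \<T> F \<inter> cell2 \<T> F" "aff_dim F = 2"
proof -
  have "\<exists>p. case p of (K1, K2) \<Rightarrow> K1 \<in> \<T> \<and> K2 \<in> \<T> \<and> K1 \<noteq> K2 \<and> F = K1 \<inter> K2"
    using assms unfolding interior_faces_def by auto
  from someI_ex[OF this] have "case face_cells \<T> F of (K1, K2) \<Rightarrow> K1 \<in> \<T> \<and> K2 \<in> \<T> \<and> K1 \<noteq> K2 \<and> F = K1 \<inter> K2"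
    unfolding face_cells_def .
  then have "cell1 \<T> F \<in> \<T> \<and> cell2 \<T> F \<in> \<T> \<and> cell1 \<T> F \<noteq> cell2 \<T> F \<and> F = cell1 \<T> F \<inter> cell2 \<T> F"
    by (simp add: cell1_def cell2_def case_prod_beta)
  moreover have "aff_dim F = 2" using assms unfolding interior_faces_def by auto
  ultimately show ?thesis using that by blast
qed

text \<open>The interiors of the two cells are disjoint convex sets, so a plane separates them. It contains the common face and,
the face being two-dimensional, equals its affine hull. Both cells fill their sides of it near \<open>x0\<close>,
so their union contains a ball.\<close>

lemma interior_face_neighbourhood:
  assumes K: "K1 \<in> \<T>" "K2 \<in> \<T>" "K1 \<noteq> K2" and F: "aff_dim (K1 \<inter> K2) = 2"
    and x0: "x0 \<in> rel_interior (K1 \<inter> K2)"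
  obtains n \<delta> where "n \<noteq> 0" "\<delta> > 0" "ball x0 \<delta> \<subseteq> \<Omega>"
    "\<And>w. norm w < \<delta> \<Longrightarrow> n \<bullet> w < 0 \<Longrightarrow> x0 + w \<in> interior K1"
    "\<And>w. norm w < \<delta> \<Longrightarrow> n \<bullet> w > 0 \<Longrightarrow> x0 + w \<in> interior K2"
proof -
  have "interior K1 \<inter> interior K2 = {}"
    using interiors_disjoint[OF K] interior_subset by blast
  then obtain n b where n: "n \<noteq> 0" "\<And>x. x \<in> interior K1 \<Longrightarrow> n \<bullet> x \<le> b" "\<And>x. x \<in> interior K2 \<Longrightarrow> n \<bullet> x \<ge> b"
    using separating_hyperplane_sets[of "interior K1" "interior K2"] cell_properties K by (metis convex_interior)
  have cl: "K \<subseteq> closure (interior K)" if "K \<in> \<T>" for K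
    using convex_closure_interior[OF cell_properties(1,3)] that closure_subset by blast
  have le: "K1 \<subseteq> {x. n \<bullet> x \<le> b}"
    using cl[OF K(1)] closure_minimal[of "interior K1" "{x. n \<bullet> x \<le> b}"] n(2) closed_halfspace_le by blast
  have ge: "K2 \<subseteq> {x. n \<bullet> x \<ge> b}"
    using cl[OF K(2)] closure_minimal[of "interior K2" "{x. n \<bullet> x \<ge> b}"] n(3) closed_halfspace_ge by blast
  have hull: "affine hull (K1 \<inter> K2) = {x. n \<bullet> x = b}"
    by (rule affine_hull_eq_plane[OF F n(1)]) (use le ge in force)
  have hull': "affine hull (K1 \<inter> K2) = {x. - n \<bullet> x = - b}"
    unfolding hull by simp
  obtain z1 z2 where z: "z1 \<in> interior K1" "z2 \<in> interior K2" using cell_properties(3) K by blast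
  have z1: "n \<bullet> z1 < b" using interior_halfspace[OF n(1) le z(1)] .
  have z2: "- n \<bullet> z2 < - b"
    by (rule interior_halfspace[of "- n" K2]) (use n(1) ge z(2) in auto)
  obtain \<delta>1 where \<delta>1: "\<delta>1 > 0" "\<And>w. norm w < \<delta>1 \<Longrightarrow> (n \<bullet> w < 0 \<longrightarrow> x0 + w \<in> interior K1) \<and> (n \<bullet> w = 0 \<longrightarrow> x0 + w \<in> K1)"
    using one_sided_neighbourhood[OF cell_properties(1)[OF K(1)] _ z(1) z1 hull x0] by blast
  obtain \<delta>2 where \<delta>2: "\<delta>2 > 0" "\<And>w. norm w < \<delta>2 \<Longrightarrow> (- n \<bullet> w < 0 \<longrightarrow> x0 + w \<in> interior K2) \<and> (- n \<bullet> w = 0 \<longrightarrow> x0 + w \<in> K2)"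
    using one_sided_neighbourhood[OF cell_properties(1)[OF K(2)] _ z(2) z2 hull' x0] by blast
  let ?\<delta> = "min \<delta>1 \<delta>2"
  have "ball x0 ?\<delta> \<subseteq> \<Union>\<T>"
  proof
    fix y assume y: "y \<in> ball x0 ?\<delta>"
    define w where "w = y - x0"
    have w: "norm w < ?\<delta>" using y by (simp add: w_def dist_norm norm_minus_commute)
    have "x0 + w \<in> K1 \<union> K2"
      using \<delta>1(2)[of w] \<delta>2(2)[of w] w interior_subset
      by (cases "n \<bullet> w" "0::real" rule: linorder_cases) (auto simp: subset_iff)
    then show "y \<in> \<Union>\<T>" using K by (auto simp: w_def)
  qed
  then have "ball x0 ?\<delta> \<subseteq> \<Omega>" unfolding domain by (simp add: interior_maximal)
  then show ?thesis
    using that[of n ?\<delta>] n(1) \<delta>1 \<delta>2 by auto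
qed

section \<open>Weak and classical derivatives of piecewise polynomials\<close>

lemma continuous_L2:
  fixes f :: "real^3 \<Rightarrow> 'b::euclidean_space"
  assumes "continuous_on UNIV f"
  shows "f \<in> L2 \<Omega>"
  by (rule piecewise_L2) (use assms in blast)

lemma L2_zero: "(\<lambda>x. 0 :: 'b::euclidean_space) \<in> L2 \<Omega>"
  by (rule L2_const[OF domain_lmeasurable])

lemma test_function_L2: "test_function U \<psi> \<Longrightarrow> \<psi> \<in> L2 \<Omega>"
  by (rule continuous_L2) (rule test_functionD(2))

lemma test_function_grad_L2: "test_function U \<psi> \<Longrightarrow> grad \<psi> \<in> L2 \<Omega>"
  by (rule continuous_L2, rule continuous_on_vecI)
    (simp add: grad_def test_functionD(2)[OF test_functionD(3)])

lemma integral_test_function_cell: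
  assumes "test_function (interior K) \<psi>" "\<And>x. x \<in> interior K \<Longrightarrow> f x = p x"
  shows "(LINT x|\<mu>. f x * \<psi> x) = (LINT x|\<mu>. p x * \<psi> x)"
proof (rule Bochner_Integration.integral_cong[OF refl])
  fix x
  obtain C where "C \<subseteq> interior K" "\<And>x. x \<notin> C \<Longrightarrow> \<psi> x = 0"
    using test_functionD(4)[OF assms(1)] by blast
  then show "f x * \<psi> x = p x * \<psi> x" using assms(2) by (cases "x \<in> C") auto
qed

lemma integration_by_parts_cell:
  assumes K: "K \<in> \<T>" and \<psi>: "test_function (interior K) \<psi>"
    and p: "p \<in> Pol k" "\<And>x. x \<in> interior K \<Longrightarrow> f x = p x"
  shows "(LINT x|\<mu>. f x * pd i \<psi> x) = - (LINT x|\<mu>. pd i f x * \<psi> x)"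
proof -
  have pd: "pd i f x = pd i p x" if "x \<in> interior K" for x
    by (rule pd_transform[OF open_interior that p(2)])
  have "(LINT x|\<mu>. f x * pd i \<psi> x) = (LINT x|\<mu>. p x * pd i \<psi> x)"
    by (rule integral_test_function_cell[OF test_functionD(3)[OF \<psi>] p(2)])
  also have "\<dots> = - (LINT x|\<mu>. pd i p x * \<psi> x)"
    by (rule integration_by_parts[OF \<psi> cell_properties(4)[OF K] domain_sets])
      (use p(1) Pol_differentiable Pol_continuous Pol_pd_same in blast)+
  also have "(LINT x|\<mu>. pd i p x * \<psi> x) = (LINT x|\<mu>. pd i f x * \<psi> x)"
    by (rule integral_test_function_cell[OF \<psi>, symmetric]) (rule pd)
  finally show ?thesis .
qed

lemma piecewise_Pol_L2:
  assumes "\<And>K. K \<in> \<T> \<Longrightarrow> \<exists>p\<in>Pol k. \<forall>x\<in>interior K. f x = p x"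
  shows "f \<in> L2 \<Omega>" "pd i f \<in> L2 \<Omega>"
proof -
  show "f \<in> L2 \<Omega>"
    by (rule piecewise_L2) (use assms Pol_continuous in blast)
  show "pd i f \<in> L2 \<Omega>"
  proof (rule piecewise_L2)
    fix K assume "K \<in> \<T>"
    then obtain p where "p \<in> Pol k" "\<And>x. x \<in> interior K \<Longrightarrow> f x = p x" using assms by blast
    then show "\<exists>q. continuous_on UNIV q \<and> (\<forall>x\<in>interior K. pd i f x = q x)"
      by (intro exI[of _ "pd i p"]) (auto intro: Pol_continuous Pol_pd_same pd_transform[OF open_interior])
  qed
qed

lemma AE_eq_if_test_functions:
  assumes f: "f \<in> L2 \<Omega>" and g: "g \<in> L2 \<Omega>" and U: "open U" "U \<subseteq> \<Omega>"
    and eq: "\<And>\<psi>. test_function U \<psi> \<Longrightarrow>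
      (LINT x|\<mu>. f x * \<psi> x) = (LINT x|\<mu>. g x * \<psi> x)"
  shows "AE x in \<mu>. x \<in> U \<longrightarrow> f x = (g x :: real)"
proof -
  have "AE x in \<mu>. x \<in> U \<longrightarrow> f x - g x = 0"
  proof (rule fundamental_lemma_of_variations[OF U domain_sets])
    show "integrable (\<mu>) (\<lambda>x. f x - g x)"
      using L2_integrable[OF domain_lmeasurable L2_diff[OF f g]] .
    fix \<psi> assume \<psi>: "test_function U \<psi>"
    have "(LINT x|\<mu>. f x * \<psi> x - g x * \<psi> x) = 0"
      using eq[OF \<psi>] L2_mult_integrable[OF f test_function_L2[OF \<psi>]]
        L2_mult_integrable[OF g test_function_L2[OF \<psi>]] by simp
    then show "(LINT x|\<mu>. (f x - g x) * \<psi> x) = 0"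
      by (simp add: left_diff_distrib)
  qed
  then show ?thesis by simp
qed

text \<open>Test functions supported inside one cell see only the polynomial on that cell, where integration by parts is
classical. The fundamental lemma then identifies the weak gradient cell by cell, and the skeleton is a null set.\<close>

lemma weak_grad_eq_grad:
  assumes f: "\<And>K. K \<in> \<T> \<Longrightarrow> \<exists>p\<in>Pol k. \<forall>x\<in>interior K. f x = p x"
    and g: "g \<in> L2 \<Omega>" "is_weak_grad \<Omega> f g"
  shows "AE x in \<mu>. g x = grad f x"
proof (rule AE_eq_if_components)
  fix i
  have "AE x in \<mu>. g x $ i = pd i f x"
  proof (rule AE_domain_if_AE_cells)
    fix K assume K: "K \<in> \<T>"
    obtain p where p: "p \<in> Pol k" "\<And>x. x \<in> interior K \<Longrightarrow> f x = p x" using f[OF K] by blast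
    show "AE x in \<mu>. x \<in> interior K \<longrightarrow> g x $ i = pd i f x"
    proof (rule AE_eq_if_test_functions[OF L2_nth[OF g(1)] piecewise_Pol_L2(2)[OF f] open_interior cell_properties(4)[OF K]])
      fix \<psi> assume \<psi>: "test_function (interior K) \<psi>"
      have "(LINT x|\<mu>. f x * pd i \<psi> x) = - (LINT x|\<mu>. g x $ i * \<psi> x)"
        using g(2) test_function_mono[OF \<psi> cell_properties(4)[OF K]] unfolding is_weak_grad_def by blast
      moreover have "(LINT x|\<mu>. f x * pd i \<psi> x) = - (LINT x|\<mu>. pd i f x * \<psi> x)"
        by (rule integration_by_parts_cell[OF K \<psi> p])
      ultimately show "(LINT x|\<mu>. g x $ i * \<psi> x) = (LINT x|\<mu>. pd i f x * \<psi> x)"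
        by simp
    qed
  qed
  then show "AE x in \<mu>. g x $ i = grad f x $ i" by (simp add: grad_def)
qed

lemma curl_L2:
  assumes "\<And>K. K \<in> \<T> \<Longrightarrow> \<exists>p\<in>PolV k. \<forall>x\<in>interior K. E x = p x"
  shows "curl E \<in> L2 \<Omega>" 
proof (rule piecewise_L2)
  fix K assume "K \<in> \<T>"
  then obtain p where p: "p \<in> PolV k" "\<And>x. x \<in> interior K \<Longrightarrow> E x = p x" using assms by blast
  have "curl E x = curl p x" if "x \<in> interior K" for x
    by (rule curl_transform[OF open_interior that p(2)])
  moreover have "continuous_on UNIV (curl p)"
  proof (rule continuous_on_vecI)
    have "continuous_on UNIV (pd i (\<lambda>y. p y $ j))" for i j
      using p(1) Pol_continuous Pol_pd_same unfolding PolV_def by blast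
    then show "continuous_on UNIV (\<lambda>x. curl p x $ i)" for i
      unfolding curl_nth by (intro continuous_on_diff)
  qed
  ultimately show "\<exists>q. continuous_on UNIV q \<and> (\<forall>x\<in>interior K. curl E x = q x)" by blast
qed

text \<open>As for gradients, cell by cell; the test field \<open>\<psi> e\<^sub>i\<close> isolates the \<open>i\<close>-th component of the curl.\<close>

lemma weak_curl_eq_curl:
  assumes E: "\<And>K. K \<in> \<T> \<Longrightarrow> \<exists>p\<in>PolV k. \<forall>x\<in>interior K. E x = p x"
    and g: "g \<in> L2 \<Omega>" "is_weak_curl \<Omega> E g"
  shows "AE x in \<mu>. g x = curl E x"
proof (rule AE_eq_if_components, rule AE_domain_if_AE_cells)
  fix i K assume K: "K \<in> \<T>"
  obtain p where p: "p \<in> PolV k" "\<And>x. x \<in> interior K \<Longrightarrow> E x = p x" using E[OF K] by blast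
  have p': "(\<lambda>x. p x $ j) \<in> Pol k" for j using p(1) by (simp add: PolV_def)
  have Ej: "\<exists>q\<in>Pol k. \<forall>x\<in>interior K. E x $ j = q x" if K': "K \<in> \<T>" for K j
  proof -
    obtain q where "q \<in> PolV k" "\<forall>x\<in>interior K. E x = q x" by (rule bexE[OF E[OF K']])
    then show ?thesis by (intro bexI[of _ "\<lambda>x. q x $ j"]) (auto simp: PolV_def)
  qed
  note L2 = piecewise_Pol_L2[OF Ej]
  show "AE x in \<mu>. x \<in> interior K \<longrightarrow> g x $ i = curl E x $ i"
  proof (rule AE_eq_if_test_functions[OF L2_nth[OF g(1)] L2_nth[OF curl_L2[OF E]] open_interior cell_properties(4)[OF K]])
    fix \<psi> assume \<psi>: "test_function (interior K) \<psi>"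
    have parts: "(LINT x|\<mu>. E x $ j * pd l \<psi> x) = - (LINT x|\<mu>. pd l (\<lambda>x. E x $ j) x * \<psi> x)" for j l
      by (rule integration_by_parts_cell[OF K \<psi> p']) (simp add: p(2))
    have int: "integrable (\<mu>) (\<lambda>x. E x $ j * pd l \<psi> x)"
      "integrable (\<mu>) (\<lambda>x. pd l (\<lambda>x. E x $ j) x * \<psi> x)" for j l
      using L2_mult_integrable[OF L2(1) test_function_L2[OF test_functionD(3)[OF \<psi>]]]
        L2_mult_integrable[OF L2(2) test_function_L2[OF \<psi>]] by blast+
    have "(LINT x|\<mu>. g x $ i * \<psi> x) = (LINT x|\<mu>. g x \<bullet> (\<psi> x *\<^sub>R axis i 1))"
      by (simp add: inner_axis mult.commute)
    also have "\<dots> = (LINT x|\<mu>. E x \<bullet> curl (\<lambda>x. \<psi> x *\<^sub>R axis i 1) x)"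
      using g(2)[unfolded is_weak_curl_def, rule_format, OF test_field_axis[OF test_function_mono[OF \<psi> cell_properties(4)[OF K]]]]
      by (rule sym)
    also have "\<dots> = (LINT x|\<mu>. E x $ (i + 1) * pd (i + 2) \<psi> x - E x $ (i + 2) * pd (i + 1) \<psi> x)"
      by (simp add: inner_curl_axis)
    also have "\<dots> = (LINT x|\<mu>. pd (i + 1) (\<lambda>x. E x $ (i + 2)) x * \<psi> x)
        - (LINT x|\<mu>. pd (i + 2) (\<lambda>x. E x $ (i + 1)) x * \<psi> x)"
      using int by (simp add: parts)
    also have "\<dots> = (LINT x|\<mu>. curl E x $ i * \<psi> x)"
      using int by (simp add: curl_nth left_diff_distrib)
    finally show "(LINT x|\<mu>. g x $ i * \<psi> x) = (LINT x|\<mu>. curl E x $ i * \<psi> x)" .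
  qed
qed

lemma weak_curl_properties:
  assumes "f \<in> Hcurl \<Omega>"
  shows "weak_curl \<Omega> f \<in> L2 \<Omega>" "is_weak_curl \<Omega> f (weak_curl \<Omega> f)"
proof -
  have "\<exists>g. g \<in> L2 \<Omega> \<and> is_weak_curl \<Omega> f g" using assms unfolding Hcurl_def by blast
  from someI_ex[OF this] show "weak_curl \<Omega> f \<in> L2 \<Omega>" "is_weak_curl \<Omega> f (weak_curl \<Omega> f)"
    unfolding weak_curl_def by auto
qed

lemma weak_div_properties:
  assumes "f \<in> Hdiv \<Omega>"
  shows "weak_div \<Omega> f \<in> L2 \<Omega>" "is_weak_div \<Omega> f (weak_div \<Omega> f)"
proof -
  have "\<exists>g. g \<in> L2 \<Omega> \<and> is_weak_div \<Omega> f g" using assms unfolding Hdiv_def by blast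
  from someI_ex[OF this] show "weak_div \<Omega> f \<in> L2 \<Omega>" "is_weak_div \<Omega> f (weak_div \<Omega> f)"
    unfolding weak_div_def by auto
qed

lemma weak_div_unique:
  assumes "g \<in> L2 \<Omega>" "g' \<in> L2 \<Omega>" "is_weak_div \<Omega> f g" "is_weak_div \<Omega> f g'"
  shows "AE x in \<mu>. g x = g' x"
proof -
  have "AE x in \<mu>. x \<in> \<Omega> \<longrightarrow> g x = g' x"
    using assms domain_open
    by (intro AE_eq_if_test_functions) (auto simp: is_weak_div_def)
  then show ?thesis using domain_sets by (simp add: AE_restrict_space_iff)
qed

lemma weak_curl_unique:
  assumes "g \<in> L2 \<Omega>" "g' \<in> L2 \<Omega>" "is_weak_curl \<Omega> f g" "is_weak_curl \<Omega> f g'"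
  shows "AE x in \<mu>. g x = g' x"
proof (rule AE_eq_if_components)
  fix i
  have "AE x in \<mu>. x \<in> \<Omega> \<longrightarrow> g x $ i = g' x $ i"
  proof (intro AE_eq_if_test_functions L2_nth assms domain_open subset_refl)
    fix \<psi> assume "test_function \<Omega> \<psi>"
    note t = test_field_axis[OF this, of i]
    have "(LINT x|\<mu>. h x $ i * \<psi> x) = (LINT x|\<mu>. f x \<bullet> curl (\<lambda>x. \<psi> x *\<^sub>R axis i 1) x)"
      if "is_weak_curl \<Omega> f h" for h
      using that t unfolding is_weak_curl_def by (simp add: inner_axis mult.commute)
    then show "(LINT x|\<mu>. g x $ i * \<psi> x) = (LINT x|\<mu>. g' x $ i * \<psi> x)"
      using assms by simp
  qed
  then show "AE x in \<mu>. g x $ i = g' x $ i" using domain_sets by (simp add: AE_restrict_space_iff)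
qed

lemma is_weak_curl_cong_AE:
  assumes "f \<in> L2 \<Omega>" "f' \<in> L2 \<Omega>" "AE x in \<mu>. f x = f' x" "is_weak_curl \<Omega> f g"
  shows "is_weak_curl \<Omega> f' g"
  unfolding is_weak_curl_def
proof (intro allI impI)
  fix \<Psi> assume \<Psi>: "test_field \<Omega> \<Psi>"
  have "curl \<Psi> \<in> L2 \<Omega>"
  proof (rule continuous_L2, rule continuous_on_vecI)
    have "continuous_on UNIV (pd i (\<lambda>x. \<Psi> x $ j))" for i j
      using \<Psi> test_functionD(2)[OF test_functionD(3)] unfolding test_field_def by blast
    then show "continuous_on UNIV (\<lambda>x. curl \<Psi> x $ i)" for i
      unfolding curl_nth by (intro continuous_on_diff)
  qed
  from integral_inner_cong_AE[OF assms(1,2) this assms(3)]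
  show "(LINT x|\<mu>. f' x \<bullet> curl \<Psi> x) = (LINT x|\<mu>. g x \<bullet> \<Psi> x)"
    using assms(4)[unfolded is_weak_curl_def, rule_format, OF \<Psi>] by simp
qed

lemma is_weak_div_cong_AE:
  assumes "f \<in> L2 \<Omega>" "f' \<in> L2 \<Omega>" "AE x in \<mu>. f x = f' x" "is_weak_div \<Omega> f g"
  shows "is_weak_div \<Omega> f' g"
  unfolding is_weak_div_def
proof (intro allI impI)
  fix \<psi> assume \<psi>: "test_function \<Omega> \<psi>"
  from integral_inner_cong_AE[OF assms(1,2) test_function_grad_L2[OF \<psi>] assms(3)]
  show "(LINT x|\<mu>. f' x \<bullet> grad \<psi> x) = - (LINT x|\<mu>. g x * \<psi> x)"
    using assms(4)[unfolded is_weak_div_def, rule_format, OF \<psi>] by simp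
qed

text \<open>Moving the gradient onto the test field produces the antisymmetric part of its second derivatives, which is zero.\<close>

lemma is_weak_curl_weak_grad:
  assumes f: "is_weak_grad \<Omega> f g" and g: "g \<in> L2 \<Omega>"
  shows "is_weak_curl \<Omega> g (\<lambda>x. 0)"
  unfolding is_weak_curl_def
proof (intro allI impI)
  fix \<Psi> assume "test_field \<Omega> \<Psi>"
  then have \<Psi>: "test_function \<Omega> (\<lambda>x. \<Psi> x $ k)" for k by (simp add: test_field_def)
  \<comment> \<open>The curl pairing is the alternating sum of these numbers, which are symmetric in \<open>i\<close> and \<open>j\<close>.\<close>
  define A where "A i j k = (LINT x|\<mu>. g x $ i * pd j (\<lambda>x. \<Psi> x $ k) x)" for i j k
  have sym: "A i j k = A j i k" for i j k
  proof -
    have "A i j k = - (LINT x|\<mu>. f x * pd i (pd j (\<lambda>x. \<Psi> x $ k)) x)" for i j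
      using f[unfolded is_weak_grad_def, rule_format, OF test_functionD(3)[OF \<Psi>]]
      unfolding A_def by simp
    then show ?thesis using test_function_pd_commute[OF \<Psi>, of i j] by simp
  qed
  have int: "integrable (\<mu>) (\<lambda>x. g x $ i * pd j (\<lambda>x. \<Psi> x $ k) x)" for i j k
    by (intro L2_mult_integrable L2_nth g test_function_L2[OF test_functionD(3)[OF \<Psi>]])
  have "(LINT x|\<mu>. g x \<bullet> curl \<Psi> x) = (\<Sum>i\<in>UNIV. A i (i + 1) (i + 2) - A i (i + 2) (i + 1))"
    unfolding inner_vec_def curl_nth A_def
    using int by (simp add: right_diff_distrib)
  also have "\<dots> = 0"
  proof -
    have e: "(1::3) + 1 = 2" "(1::3) + 2 = 3" "(2::3) + 1 = 3" "(2::3) + 2 = 1" "(3::3) + 1 = 1" "(3::3) + 2 = 2"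
      by auto
    show ?thesis
      unfolding sum_3 e using sym[of 1 2 3] sym[of 1 3 2] sym[of 2 3 1] by simp
  qed
  finally show "(LINT x|\<mu>. g x \<bullet> curl \<Psi> x) = (LINT x|\<mu>. 0 \<bullet> \<Psi> x)" by simp
qed

end

section \<open>Continuity across interior faces\<close>

definition ball_bump :: "point \<Rightarrow> real \<Rightarrow> sfield"
  where "ball_bump x0 \<epsilon> x = flat 1 (1 - (\<Sum>i\<in>UNIV. ((x $ i - x0 $ i) / \<epsilon>)\<^sup>2))"

text \<open>The radial derivative profile of the unit bump: by \<open>pd_ball_bump\<close>, the partial derivatives of \<open>ball_bump x0 \<epsilon>\<close>
at \<open>x0 + \<epsilon> y\<close> are \<open>- 2 / \<epsilon>\<close> times \<open>bump_slope y * y $ i\<close>.\<close>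

definition bump_slope :: sfield
  where "bump_slope y = flat [:0, 0, 1:] (1 - (norm y)\<^sup>2)"

lemma sum_squares_eq_norm: "(\<Sum>i\<in>UNIV. ((x $ i - x0 $ i) / \<epsilon>)\<^sup>2) = (norm ((x - x0) /\<^sub>R \<epsilon>))\<^sup>2" for x x0 :: point
  unfolding power2_norm_eq_inner inner_vec_def
  by (simp add: power2_eq_square divide_inverse mult.commute)

lemma ball_bump_rescale: "\<epsilon> \<noteq> 0 \<Longrightarrow> ball_bump x0 \<epsilon> (x0 + \<epsilon> *\<^sub>R y) = ball_bump 0 1 y"
  unfolding ball_bump_def by simp

lemma ball_bump_outside:
  assumes "\<epsilon> > 0" "x \<notin> cball x0 \<epsilon>"
  shows "ball_bump x0 \<epsilon> x = 0"
proof -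
  have "norm (x - x0) > \<epsilon>" using assms by (simp add: dist_norm norm_minus_commute)
  then have "norm ((x - x0) /\<^sub>R \<epsilon>) > 1"
    using assms(1) unfolding norm_scaleR by (simp add: pos_less_divide_eq flip: divide_inverse_commute)
  then have "(norm ((x - x0) /\<^sub>R \<epsilon>))\<^sup>2 > 1" by (simp add: one_less_power)
  then show ?thesis unfolding ball_bump_def sum_squares_eq_norm by (simp add: flat_def)
qed

lemma ball_bump_smooth: "ball_bump x0 \<epsilon> \<in> smooth_functions"
  unfolding ball_bump_def[abs_def] power2_eq_square divide_inverse
  by (intro smooth_functions.flat smooth_functions_diff smooth_functions_sum smooth_functions.mult
      smooth_functions.const smooth_functions.coord finite)

lemma test_function_ball_bump:
  assumes "\<epsilon> > 0" "cball x0 \<epsilon> \<subseteq> U"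
  shows "test_function U (ball_bump x0 \<epsilon>)"
  unfolding test_function_def
  using assms smooth_functions_Ck[OF ball_bump_smooth] ball_bump_outside[OF assms(1)]
  by (intro conjI allI exI[of _ "cball x0 \<epsilon>"]) auto

lemma pd_ball_bump:
  assumes "\<epsilon> > 0"
  shows "pd i (ball_bump x0 \<epsilon>) (x0 + \<epsilon> *\<^sub>R y) = - (2 / \<epsilon>) * (bump_slope y * y $ i)"
proof -
  let ?q = "\<lambda>x::point. 1 - (\<Sum>i\<in>UNIV. ((x $ i - x0 $ i) / \<epsilon>)\<^sup>2)"
  let ?x = "x0 + \<epsilon> *\<^sub>R y"
  have sq: "((\<lambda>x. ((x $ j - x0 $ j) / \<epsilon>)\<^sup>2) has_derivative
      (\<lambda>v. 2 * ((?x $ j - x0 $ j) / \<epsilon>) * (v $ j / \<epsilon>))) (at ?x)" for j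
  proof -
    have "((\<lambda>x::point. x $ j - x0 $ j) has_derivative (\<lambda>v. v $ j - 0)) (at ?x)"
      by (intro has_derivative_diff has_derivative_const bounded_linear_imp_has_derivative bounded_linear_vec_nth)
    from has_derivative_mult_left[OF this, of "1 / \<epsilon>"]
    have l: "((\<lambda>x::point. (x $ j - x0 $ j) / \<epsilon>) has_derivative (\<lambda>v. v $ j / \<epsilon>)) (at ?x)" by simp
    show ?thesis
      unfolding power2_eq_square
      by (rule has_derivative_eq_rhs[OF has_derivative_mult[OF l l]]) (auto simp: algebra_simps)
  qed
  have D: "(?q has_derivative (\<lambda>v. 0 - (\<Sum>j\<in>UNIV. 2 * ((?x $ j - x0 $ j) / \<epsilon>) * (v $ j / \<epsilon>)))) (at ?x)"
    by (intro has_derivative_diff has_derivative_const has_derivative_sum sq)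
  have q: "pd i ?q ?x = - (2 / \<epsilon>) * y $ i"
  proof -
    have "(\<Sum>j\<in>UNIV. 2 * ((?x $ j - x0 $ j) / \<epsilon>) * (axis i 1 $ j / \<epsilon>))
        = (\<Sum>j\<in>UNIV. if j = i then 2 * y $ i / \<epsilon> else 0)"
      using assms by (intro sum.cong) (auto simp: axis_def)
    then show ?thesis using pd_eqI[OF D, of i] by simp
  qed
  have "pd i (\<lambda>x. flat 1 (?q x)) ?x = flat ([:0, 0, 1:] * (1 - pderiv 1)) (?q ?x) * pd i ?q ?x"
    by (rule pd_chain(2)[OF differentiableI[OF D] flat_has_derivative])
  moreover have "?q ?x = 1 - (norm y)\<^sup>2"
    unfolding sum_squares_eq_norm using assms by simp
  ultimately show ?thesis
    unfolding ball_bump_def[abs_def] q by (simp add: bump_slope_def pderiv_1)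
qed

lemma continuous_bump_slope: "continuous_on UNIV bump_slope"
  unfolding bump_slope_def[abs_def]
  by (intro continuous_on_compose2[OF continuous_flat] continuous_intros) auto

lemma bump_slope_nonneg: "bump_slope y \<ge> 0"
  by (simp add: bump_slope_def flat_def)

lemma bump_slope_outside: "y \<notin> cball 0 1 \<Longrightarrow> bump_slope y = 0"
  by (simp add: bump_slope_def flat_def abs_square_le_1 not_le)

lemma bump_slope_integrable:
  assumes "continuous_on UNIV g"
  shows "integrable lborel (\<lambda>y. bump_slope y * g y)"
  by (rule integrable_compact_support[of _ "cball 0 1"])
    (use assms continuous_bump_slope bump_slope_outside in \<open>auto intro!: continuous_on_mult\<close>)

text \<open>The radial weight is even, so its first moment \<open>\<integral> bump_slope y (n \<bullet> y)\<close> vanishes and the hypothesis reduces to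
\<open>(a2 - a1) / 2\<close> times the integral of \<open>bump_slope y \<bar>n \<bullet> y\<bar>\<close>, which is positive.\<close>

lemma two_sided_moment_zero:
  assumes n: "n \<noteq> 0"
    and zero: "(LINT y|lborel. (if n \<bullet> y < 0 then a1 else a2) * (bump_slope y * (n \<bullet> y))) = 0"
  shows "a1 = a2"
proof -
  have c: "continuous_on UNIV (\<lambda>y. n \<bullet> y)" "continuous_on UNIV (\<lambda>y. \<bar>n \<bullet> y\<bar>)"
    by (intro continuous_intros)+
  note int = bump_slope_integrable[OF c(1)] bump_slope_integrable[OF c(2)]
  have "(LINT y|lborel. bump_slope y * (n \<bullet> y)) = (LINT y|lborel. bump_slope (- y) * (n \<bullet> (- y)))"
    using integral_affine[of "\<lambda>y. bump_slope y * (n \<bullet> y)" "-1" 0] int by auto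
  also have "\<dots> = - (LINT y|lborel. bump_slope y * (n \<bullet> y))"
    by (simp add: bump_slope_def)
  finally have odd: "(LINT y|lborel. bump_slope y * (n \<bullet> y)) = 0" by simp
  have "(if n \<bullet> y < 0 then a1 else a2) * (bump_slope y * (n \<bullet> y))
      = (a1 + a2) / 2 * (bump_slope y * (n \<bullet> y)) + (a2 - a1) / 2 * (bump_slope y * \<bar>n \<bullet> y\<bar>)" for y
    by (auto simp: field_simps)
  then have "(a2 - a1) / 2 * (LINT y|lborel. bump_slope y * \<bar>n \<bullet> y\<bar>) = 0"
    using zero int odd by simp
  moreover have "(LINT y|lborel. bump_slope y * \<bar>n \<bullet> y\<bar>) \<noteq> 0"
  proof
    assume "(LINT y|lborel. bump_slope y * \<bar>n \<bullet> y\<bar>) = 0"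
    then have "AE y in lborel. bump_slope y * \<bar>n \<bullet> y\<bar> = 0"
      using integral_nonneg_eq_0_iff_AE[OF int(2)] bump_slope_nonneg by simp
    then have "AE y in lebesgue. y \<in> UNIV \<longrightarrow> bump_slope y * \<bar>n \<bullet> y\<bar> = 0"
      using AE_completion by fastforce
    then have "bump_slope ((1 / (2 * norm n)) *\<^sub>R n) * \<bar>n \<bullet> ((1 / (2 * norm n)) *\<^sub>R n)\<bar> = 0"
      by (rule continuous_AE_zero[rotated 2]) (auto intro!: continuous_on_mult continuous_bump_slope c)
    moreover have "norm ((1 / (2 * norm n)) *\<^sub>R n) = 1 / 2" using n by simp
    then have "bump_slope ((1 / (2 * norm n)) *\<^sub>R n) \<noteq> 0"
      by (simp add: bump_slope_def flat_def power2_eq_square)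
    ultimately show False using n by simp
  qed
  ultimately show ?thesis by simp
qed

context mesh
begin

text \<open>A Borel representative of a function known only on the open cells; a Lebesgue measurable one would not do under
rescaling and integration with respect to \<open>lborel\<close>.\<close>

definition zero_off_cells :: "sfield \<Rightarrow> sfield"
  where "zero_off_cells f x = (if x \<in> cells_interior then f x else 0)"

text \<open>Test the weak derivative with the bump \<open>\<psi>\<^sub>\<epsilon>\<close> of radius \<open>\<epsilon>\<close>. The weak gradient
agrees with the bounded cellwise gradient, so its pairing with \<open>\<psi>\<^sub>\<epsilon>\<close> is of order \<open>\<epsilon>\<^sup>3\<close>. The pairing of
\<open>\<phi>\<close> with the derivative of \<open>\<psi>\<^sub>\<epsilon>\<close>, rescaled to the unit ball, is \<open>- 2 \<epsilon>\<^sup>2\<close> times the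
integral in question.\<close>

lemma rescaled_weak_derivative_bound:
  assumes \<phi>: "\<phi> \<in> Q \<Omega> \<T> k" and \<delta>: "ball x0 \<delta> \<subseteq> \<Omega>"
  shows "\<exists>C. \<forall>\<epsilon>. 0 < \<epsilon> \<longrightarrow> \<epsilon> < \<delta> \<longrightarrow>
    \<bar>LINT y|lborel. zero_off_cells \<phi> (x0 + \<epsilon> *\<^sub>R y) * (bump_slope y * y $ i)\<bar> \<le> \<epsilon> * C"
proof -
  have pw: "\<exists>p\<in>Pol k. \<forall>x\<in>interior K. \<phi> x = p x" if "K \<in> \<T>" for K
    using \<phi> that unfolding Q_def by blast
  obtain g where g: "g \<in> L2 \<Omega>" "is_weak_grad \<Omega> \<phi> g"
    using \<phi> unfolding Q_def H1_def by blast
  have gg: "AE x in \<mu>. g x = grad \<phi> x"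
    by (rule weak_grad_eq_grad[OF pw g])
  have pwc: "\<exists>p. continuous_on UNIV p \<and> (\<forall>x\<in>interior K. \<phi> x = p x)" if "K \<in> \<T>" for K
    using pw[OF that] Pol_continuous by blast
  have "\<exists>p. continuous_on UNIV p \<and> (\<forall>x\<in>interior K. pd i \<phi> x = p x)" if K: "K \<in> \<T>" for K
  proof -
    obtain p where "p \<in> Pol k" "\<And>x. x \<in> interior K \<Longrightarrow> \<phi> x = p x" using pw[OF K] by blast
    then show ?thesis
      by (intro exI[of _ "pd i p"]) (auto intro: Pol_continuous Pol_pd_same pd_transform[OF open_interior])
  qed
  then have "\<exists>B. \<forall>x\<in>cells_interior. norm (pd i \<phi> x) \<le> B"
    by (intro piecewise_bounded)
  then obtain B where B: "\<And>x. x \<in> cells_interior \<Longrightarrow> \<bar>pd i \<phi> x\<bar> \<le> B"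
    unfolding real_norm_def by blast
  define \<Phi> where "\<Phi> = zero_off_cells \<phi>"
  have m\<Phi>: "\<Phi> \<in> borel_measurable borel"
    unfolding \<Phi>_def zero_off_cells_def[abs_def] using piecewise_borel[OF pwc] by simp
  define J where "J = (LINT y|lborel. ball_bump 0 1 y)"
  have bound: "\<bar>LINT y|lborel. \<Phi> (x0 + \<epsilon> *\<^sub>R y) * (bump_slope y * y $ i)\<bar> \<le> \<epsilon> * (B * J / 2)"
    if \<epsilon>: "0 < \<epsilon>" "\<epsilon> < \<delta>" for \<epsilon>
  proof -
    let ?\<psi> = "ball_bump x0 \<epsilon>"
    have sub: "cball x0 \<epsilon> \<subseteq> \<Omega>" using \<epsilon> \<delta> by auto
    have \<psi>: "test_function \<Omega> ?\<psi>" by (rule test_function_ball_bump[OF \<epsilon>(1) sub])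
    have out: "?\<psi> x = 0" "pd i ?\<psi> x = 0" if "x \<notin> \<Omega>" for x
    proof -
      have "x \<notin> cball x0 \<epsilon>" using sub that by blast
      then show "?\<psi> x = 0" "pd i ?\<psi> x = 0"
        using ball_bump_outside[OF \<epsilon>(1)] pd_outside_support[of "cball x0 \<epsilon>" ?\<psi>] by auto
    qed
    note cont = test_functionD(2)[OF \<psi>] test_functionD(2)[OF test_functionD(3)[OF \<psi>], of i]
    have nonneg: "?\<psi> x \<ge> 0" for x unfolding ball_bump_def by (rule flat_1_bounds)
    have "(LINT x|\<mu>. \<phi> x * pd i ?\<psi> x) = (LINT x|\<mu>. \<Phi> x * pd i ?\<psi> x)"
    proof (rule integral_cong_AE)
      show "AE x in \<mu>. \<phi> x * pd i ?\<psi> x = \<Phi> x * pd i ?\<psi> x"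
        using AE_cells_interior by eventually_elim (simp add: \<Phi>_def zero_off_cells_def)
      show "(\<lambda>x. \<phi> x * pd i ?\<psi> x) \<in> borel_measurable (\<mu>)"
        using L2_mult_integrable[OF piecewise_Pol_L2(1)[OF pw] test_function_L2[OF test_functionD(3)[OF \<psi>]]] by blast
      show "(\<lambda>x. \<Phi> x * pd i ?\<psi> x) \<in> borel_measurable (\<mu>)"
        using m\<Phi> cont(2) borel_measurable_continuous_onI
        by (intro measurable_restrict_space1 measurable_completion borel_measurable_times) auto
    qed
    also have "\<dots> = (LINT x|lborel. \<Phi> x * pd i ?\<psi> x)"
      using m\<Phi> cont(2) borel_measurable_continuous_onI out
      by (intro integral_lebesgue_on_lborel domain_sets borel_measurable_times) auto
    also have "\<dots> = \<epsilon> ^ 3 * (LINT y|lborel. \<Phi> (x0 + \<epsilon> *\<^sub>R y) * pd i ?\<psi> (x0 + \<epsilon> *\<^sub>R y))"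
      using m\<Phi> cont(2) borel_measurable_continuous_onI \<epsilon>(1)
      by (subst integral_affine[of _ \<epsilon> x0]) (auto intro!: borel_measurable_times)
    also have "\<dots> = \<epsilon> ^ 3 * (LINT y|lborel. - (2 / \<epsilon>) * (\<Phi> (x0 + \<epsilon> *\<^sub>R y) * (bump_slope y * y $ i)))"
      by (simp add: pd_ball_bump[OF \<epsilon>(1)] mult_ac)
    also have "\<dots> = - (2 * \<epsilon>\<^sup>2) * (LINT y|lborel. \<Phi> (x0 + \<epsilon> *\<^sub>R y) * (bump_slope y * y $ i))"
      by (subst Bochner_Integration.integral_mult_right_zero) (use \<epsilon> in \<open>simp add: power3_eq_cube power2_eq_square\<close>)
    finally have lhs: "(LINT x|\<mu>. \<phi> x * pd i ?\<psi> x)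
        = - (2 * \<epsilon>\<^sup>2) * (LINT y|lborel. \<Phi> (x0 + \<epsilon> *\<^sub>R y) * (bump_slope y * y $ i))" .
    have i\<psi>: "integrable (\<mu>) (\<lambda>x. ?\<psi> x)"
      using L2_integrable[OF domain_lmeasurable test_function_L2[OF \<psi>]] .
    have ig: "integrable (\<mu>) (\<lambda>x. g x $ i * ?\<psi> x)"
      by (rule L2_mult_integrable[OF L2_nth[OF g(1)] test_function_L2[OF \<psi>]])
    have "\<bar>LINT x|\<mu>. g x $ i * ?\<psi> x\<bar> \<le> (LINT x|\<mu>. \<bar>g x $ i * ?\<psi> x\<bar>)"
      by (rule integral_abs_bound)
    also have "\<dots> \<le> (LINT x|\<mu>. B * ?\<psi> x)"
    proof (rule integral_mono_AE)
      show "AE x in \<mu>. \<bar>g x $ i * ?\<psi> x\<bar> \<le> B * ?\<psi> x"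
        using gg AE_cells_interior
        by eventually_elim (use B nonneg in \<open>auto simp: grad_def abs_mult intro!: mult_right_mono\<close>)
    qed (use ig i\<psi> in auto)
    also have "\<dots> = B * (LINT x|lborel. ?\<psi> x)"
      using integral_lebesgue_on_lborel[OF domain_sets borel_measurable_continuous_onI[OF cont(1)] out(1)] by simp
    also have "(LINT x|lborel. ?\<psi> x) = \<epsilon> ^ 3 * J"
      using integral_affine[OF borel_measurable_continuous_onI[OF cont(1)], of \<epsilon> x0] \<epsilon>(1)
      by (simp add: J_def ball_bump_rescale)
    finally have rhs: "\<bar>LINT x|\<mu>. g x $ i * ?\<psi> x\<bar> \<le> B * (\<epsilon> ^ 3 * J)" .
    have "(LINT x|\<mu>. \<phi> x * pd i ?\<psi> x) = - (LINT x|\<mu>. g x $ i * ?\<psi> x)"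
      using g(2) \<psi> unfolding is_weak_grad_def by blast
    then have "(2 * \<epsilon>\<^sup>2) * \<bar>LINT y|lborel. \<Phi> (x0 + \<epsilon> *\<^sub>R y) * (bump_slope y * y $ i)\<bar> \<le> (2 * \<epsilon>\<^sup>2) * (\<epsilon> * (B * J / 2))"
      using lhs rhs by (simp add: abs_mult power3_eq_cube power2_eq_square mult_ac)
    then show ?thesis
      using \<epsilon> by (subst (asm) mult_le_cancel_left_pos) auto
  qed
  then show ?thesis unfolding \<Phi>_def by blast
qed

text \<open>Blow-up at \<open>x0\<close>. The rescaled function \<open>\<phi> (x0 + \<epsilon> y)\<close> converges to the two one-sided values on the
two sides of the plane, while its first moments with weight \<open>bump_slope\<close> tend to zero. So the limit has vanishing first moment
in the direction \<open>n\<close>, which forces the two values to agree.\<close>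

lemma Q_continuous_at_face:
  assumes K: "K1 \<in> \<T>" "K2 \<in> \<T>" "K1 \<noteq> K2" and F: "aff_dim (K1 \<inter> K2) = 2"
    and \<phi>: "\<phi> \<in> Q \<Omega> \<T> k" and x0: "x0 \<in> rel_interior (K1 \<inter> K2)"
    and p1: "continuous_on UNIV p1" "\<And>x. x \<in> interior K1 \<Longrightarrow> \<phi> x = p1 x"
    and p2: "continuous_on UNIV p2" "\<And>x. x \<in> interior K2 \<Longrightarrow> \<phi> x = p2 x"
  shows "p1 x0 = p2 x0"
proof -
  obtain n \<delta> where n: "n \<noteq> 0" and \<delta>: "\<delta> > 0" "ball x0 \<delta> \<subseteq> \<Omega>"
    and side1: "\<And>w. norm w < \<delta> \<Longrightarrow> n \<bullet> w < 0 \<Longrightarrow> x0 + w \<in> interior K1"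
    and side2: "\<And>w. norm w < \<delta> \<Longrightarrow> n \<bullet> w > 0 \<Longrightarrow> x0 + w \<in> interior K2"
    using interior_face_neighbourhood[OF K F x0] by metis
  have pw: "\<exists>p\<in>Pol k. \<forall>x\<in>interior K. \<phi> x = p x" if "K \<in> \<T>" for K
    using \<phi> that unfolding Q_def by blast
  have pwc: "\<exists>p. continuous_on UNIV p \<and> (\<forall>x\<in>interior K. \<phi> x = p x)" if "K \<in> \<T>" for K
    using pw[OF that] Pol_continuous by blast
  obtain b where b: "\<And>x. x \<in> cells_interior \<Longrightarrow> \<bar>\<phi> x\<bar> \<le> b"
    using piecewise_bounded[OF pwc] by auto
  define \<Phi> where "\<Phi> = zero_off_cells \<phi>"
  have m\<Phi>: "\<Phi> \<in> borel_measurable borel"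
    unfolding \<Phi>_def zero_off_cells_def[abs_def] using piecewise_borel[OF pwc] by simp
  have b0: "b \<ge> 0" using b cell_properties(3)[OF K(1)] K(1) by (metis UN_I abs_ge_zero ex_in_conv order_trans)
  have \<Phi>b: "\<bar>\<Phi> x\<bar> \<le> b" for x using b b0 by (auto simp: \<Phi>_def zero_off_cells_def)
  have mm: "(\<lambda>y. \<Phi> (x0 + \<epsilon> *\<^sub>R y)) \<in> borel_measurable borel" for \<epsilon>
    using m\<Phi> by measurable
  have intc: "integrable lborel (\<lambda>y. \<Phi> (x0 + \<epsilon> *\<^sub>R y) * (bump_slope y * h y))" 
    if "continuous_on UNIV h" for \<epsilon> h
  proof (rule Bochner_Integration.integrable_bound)
    show "integrable lborel (\<lambda>y. b * (bump_slope y * h y))"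
      using bump_slope_integrable[OF that] by simp
    show "(\<lambda>y. \<Phi> (x0 + \<epsilon> *\<^sub>R y) * (bump_slope y * h y)) \<in> borel_measurable lborel"
      by (rule borel_measurable_times[OF _ borel_measurable_integrable[OF bump_slope_integrable[OF that]]])
        (use mm in simp)
    show "AE y in lborel. norm (\<Phi> (x0 + \<epsilon> *\<^sub>R y) * (bump_slope y * h y)) \<le> norm (b * (bump_slope y * h y))"
      using \<Phi>b b0 by (intro AE_I2) (auto simp: abs_mult intro!: mult_right_mono)
  qed
  have "\<forall>i. \<exists>C. \<forall>\<epsilon>. 0 < \<epsilon> \<longrightarrow> \<epsilon> < \<delta> \<longrightarrow>
      \<bar>LINT y|lborel. \<Phi> (x0 + \<epsilon> *\<^sub>R y) * (bump_slope y * y $ i)\<bar> \<le> \<epsilon> * C"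
    unfolding \<Phi>_def using rescaled_weak_derivative_bound[OF \<phi> \<delta>(2)] by blast
  from choice[OF this] obtain C where C: "\<forall>i. \<forall>\<epsilon>. 0 < \<epsilon> \<longrightarrow> \<epsilon> < \<delta> \<longrightarrow>
      \<bar>LINT y|lborel. \<Phi> (x0 + \<epsilon> *\<^sub>R y) * (bump_slope y * y $ i)\<bar> \<le> \<epsilon> * C i" by (rule exE)
  note bound = C[rule_format]
  define r where "r m = \<delta> * inverse (real (Suc (Suc m)))" for m :: nat
  have r: "0 < r m" "r m < \<delta>" for m using \<delta>(1) by (auto simp: r_def field_simps add_pos_nonneg)
  have rlim: "r \<longlonglongrightarrow> 0"
    unfolding r_def using tendsto_mult[OF tendsto_const LIMSEQ_Suc[OF LIMSEQ_inverse_real_of_nat], of \<delta>] by simp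
  define I where "I m = (LINT y|lborel. \<Phi> (x0 + r m *\<^sub>R y) * (bump_slope y * (n \<bullet> y)))" for m
  have "I \<longlonglongrightarrow> 0"
  proof (rule Lim_null_comparison)
    have "\<bar>I m\<bar> \<le> (\<Sum>i\<in>UNIV. \<bar>n $ i\<bar> * (r m * C i))" for m
    proof -
      have "\<Phi> (x0 + r m *\<^sub>R y) * (bump_slope y * (n \<bullet> y))
          = (\<Sum>i\<in>UNIV. n $ i * (\<Phi> (x0 + r m *\<^sub>R y) * (bump_slope y * y $ i)))" for y
        by (simp add: inner_vec_def sum_distrib_left mult_ac)
      then have "I m = (\<Sum>i\<in>UNIV. n $ i * (LINT y|lborel. \<Phi> (x0 + r m *\<^sub>R y) * (bump_slope y * y $ i)))"
        unfolding I_def using intc[of "\<lambda>y. y $ _"] by (simp add: continuous_on_component)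
      then have "\<bar>I m\<bar> \<le> (\<Sum>i\<in>UNIV. \<bar>n $ i * (LINT y|lborel. \<Phi> (x0 + r m *\<^sub>R y) * (bump_slope y * y $ i))\<bar>)"
        by (simp add: sum_abs)
      also have "\<dots> \<le> (\<Sum>i\<in>UNIV. \<bar>n $ i\<bar> * (r m * C i))"
        unfolding abs_mult using bound[OF r] by (intro sum_mono mult_left_mono) auto
      finally show ?thesis .
    qed
    then show "\<forall>\<^sub>F m in sequentially. norm (I m) \<le> (\<Sum>i\<in>UNIV. \<bar>n $ i\<bar> * (r m * C i))" by simp
    have "(\<lambda>m. \<Sum>i\<in>UNIV. \<bar>n $ i\<bar> * (r m * C i)) \<longlonglongrightarrow> (\<Sum>i\<in>UNIV. \<bar>n $ i\<bar> * (0 * C i))"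
      by (intro tendsto_intros rlim)
    then show "(\<lambda>m. \<Sum>i\<in>UNIV. \<bar>n $ i\<bar> * (r m * C i)) \<longlonglongrightarrow> 0" by simp
  qed
  moreover have "I \<longlonglongrightarrow> (LINT y|lborel. (if n \<bullet> y < 0 then p1 x0 else p2 x0) * (bump_slope y * (n \<bullet> y)))"
    unfolding I_def
  proof (rule integral_dominated_convergence[where w = "\<lambda>y. b * (bump_slope y * \<bar>n \<bullet> y\<bar>)"])
    have c: "continuous_on UNIV (\<lambda>y. n \<bullet> y)" "continuous_on UNIV (\<lambda>y. \<bar>n \<bullet> y\<bar>)"
      by (intro continuous_intros)+
    show "integrable lborel (\<lambda>y. b * (bump_slope y * \<bar>n \<bullet> y\<bar>))"
      using bump_slope_integrable[OF c(2)] by simp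
    show "(\<lambda>y. \<Phi> (x0 + r m *\<^sub>R y) * (bump_slope y * (n \<bullet> y))) \<in> borel_measurable lborel" for m
      using intc[OF c(1)] by blast
    show "(\<lambda>y. (if n \<bullet> y < 0 then p1 x0 else p2 x0) * (bump_slope y * (n \<bullet> y))) \<in> borel_measurable lborel"
      by (rule borel_measurable_times[OF _ borel_measurable_integrable[OF bump_slope_integrable[OF c(1)]]]) simp
    show "AE y in lborel. norm (\<Phi> (x0 + r m *\<^sub>R y) * (bump_slope y * (n \<bullet> y))) \<le> b * (bump_slope y * \<bar>n \<bullet> y\<bar>)" for m
      using \<Phi>b bump_slope_nonneg by (intro AE_I2) (auto simp: abs_mult intro!: mult_right_mono)
    show "AE y in lborel. (\<lambda>m. \<Phi> (x0 + r m *\<^sub>R y) * (bump_slope y * (n \<bullet> y)))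
        \<longlonglongrightarrow> (if n \<bullet> y < 0 then p1 x0 else p2 x0) * (bump_slope y * (n \<bullet> y))"
    proof (rule AE_I2)
      fix y :: point
      have w: "(\<lambda>m. r m *\<^sub>R y) \<longlonglongrightarrow> 0" using tendsto_scaleR[OF rlim tendsto_const[of y]] by simp
      then have "(\<lambda>m. norm (r m *\<^sub>R y)) \<longlonglongrightarrow> 0" by (rule tendsto_norm_zero)
      then have small: "\<forall>\<^sub>F m in sequentially. norm (r m *\<^sub>R y) < \<delta>"
        using \<delta>(1) by (rule order_tendstoD)
      have lim: "(\<lambda>m. p (x0 + r m *\<^sub>R y)) \<longlonglongrightarrow> p x0" if "continuous_on UNIV p" for p :: sfield
      proof (rule isCont_tendsto_compose[of x0 p])
        show "isCont p x0" using that by (simp add: continuous_on_eq_continuous_at)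
        show "(\<lambda>m. x0 + r m *\<^sub>R y) \<longlonglongrightarrow> x0" using tendsto_add[OF tendsto_const w] by simp
      qed
      consider "n \<bullet> y < 0" | "n \<bullet> y = 0" | "n \<bullet> y > 0" by linarith
      then have "(\<lambda>m. \<Phi> (x0 + r m *\<^sub>R y)) \<longlonglongrightarrow> (if n \<bullet> y < 0 then p1 x0 else p2 x0) \<or> n \<bullet> y = 0"
      proof cases
        case 1
        have "\<forall>\<^sub>F m in sequentially. p1 (x0 + r m *\<^sub>R y) = \<Phi> (x0 + r m *\<^sub>R y)"
          using small
        proof eventually_elim
          case (elim m)
          have "x0 + r m *\<^sub>R y \<in> interior K1"
            using side1[OF elim] 1 r[of m] by (simp add: mult_pos_neg)
          then show ?case using p1(2) K(1) by (auto simp: \<Phi>_def zero_off_cells_def)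
        qed
        then show ?thesis using Lim_transform_eventually[OF lim[OF p1(1)]] 1 by simp
      next
        case 3
        have "\<forall>\<^sub>F m in sequentially. p2 (x0 + r m *\<^sub>R y) = \<Phi> (x0 + r m *\<^sub>R y)"
          using small
        proof eventually_elim
          case (elim m)
          have "x0 + r m *\<^sub>R y \<in> interior K2"
            using side2[OF elim] 3 r[of m] by simp
          then show ?case using p2(2) K(2) by (auto simp: \<Phi>_def zero_off_cells_def)
        qed
        then show ?thesis using Lim_transform_eventually[OF lim[OF p2(1)]] 3 by simp
      qed simp
      then show "(\<lambda>m. \<Phi> (x0 + r m *\<^sub>R y) * (bump_slope y * (n \<bullet> y)))
        \<longlonglongrightarrow> (if n \<bullet> y < 0 then p1 x0 else p2 x0) * (bump_slope y * (n \<bullet> y))"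
        by (elim disjE) (simp_all add: tendsto_mult_right)
    qed
  qed
  ultimately have "(LINT y|lborel. (if n \<bullet> y < 0 then p1 x0 else p2 x0) * (bump_slope y * (n \<bullet> y))) = 0"
    using LIMSEQ_unique by blast
  then show ?thesis by (rule two_sided_moment_zero[OF n])
qed

lemma Q_piecewise: "f \<in> Q \<Omega> \<T> k \<Longrightarrow> K \<in> \<T> \<Longrightarrow> \<exists>p\<in>Pol k. \<forall>x\<in>interior K. f x = p x"
  unfolding Q_def by blast

text \<open>The polynomials on the two sides agree at relatively interior points of the face, hence by continuity on all of it.\<close>

lemma jump_s_Q_zero:
  assumes \<phi>: "\<phi> \<in> Q \<Omega> \<T> k" and F: "F \<in> interior_faces \<T>" and x: "x \<in> F"
  shows "jump_s \<T> F \<phi> x = 0"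
proof -
  let ?K1 = "cell1 \<T> F" and ?K2 = "cell2 \<T> F"
  have K: "?K1 \<in> \<T>" "?K2 \<in> \<T>" "?K1 \<noteq> ?K2" "F = ?K1 \<inter> ?K2" "aff_dim F = 2"
    using interior_face[OF F] by metis+
  have "\<exists>p\<in>Pol k. \<forall>x\<in>interior ?K1. \<phi> x = p x" "\<exists>p\<in>Pol k. \<forall>x\<in>interior ?K2. \<phi> x = p x"
    using \<phi> K(1,2) unfolding Q_def by blast+
  then obtain p1 p2 where p: "p1 \<in> Pol k" "p2 \<in> Pol k"
    "\<And>x. x \<in> interior ?K1 \<Longrightarrow> \<phi> x = p1 x" "\<And>x. x \<in> interior ?K2 \<Longrightarrow> \<phi> x = p2 x" by blast
  have aff: "aff_dim (?K1 \<inter> ?K2) = 2" using K by simp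
  have "p1 y = p2 y" if "y \<in> rel_interior F" for y
    by (rule Q_continuous_at_face[OF K(1-3) aff \<phi> _ Pol_continuous[OF p(1)] p(3) Pol_continuous[OF p(2)] p(4)])
      (use that K(4) in auto)
  moreover have "convex F" using K(4) cell_properties(1)[OF K(1)] cell_properties(1)[OF K(2)] convex_Int by metis
  then have "x \<in> closure (rel_interior F)" using subset_closure_rel_interior x by blast
  ultimately have "p1 x = p2 x"
    using closure_eqI[OF Pol_continuous[OF p(1)] Pol_continuous[OF p(2)]] by blast
  moreover have "x \<in> ?K1" "x \<in> ?K2" using x K(4) by blast+
  then have "trace ?K1 \<phi> x = p1 x" "trace ?K2 \<phi> x = p2 x"
    using trace_eq[OF cell_properties(1,3)[OF K(1)] _ Pol_continuous[OF p(1)] p(3)]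
      trace_eq[OF cell_properties(1,3)[OF K(2)] _ Pol_continuous[OF p(2)] p(4)] by auto
  ultimately show ?thesis by (simp add: jump_s_def)
qed

section \<open>Gradients and curls in the finite element spaces\<close>

lemma boundary_face:
  assumes "K \<in> \<T>" "F \<in> boundary_faces \<Omega> K"
  shows "convex F" "aff_dim F = 2" "F \<subseteq> K"
proof -
  have F: "F facet_of K" using assms(2) by (simp add: boundary_faces_def)
  then show "convex F" "F \<subseteq> K" by (auto simp: facet_of_def face_of_imp_convex face_of_imp_subset)
  have "aff_dim K = 3" using cell_properties(3)[OF assms(1)] by (simp add: aff_dim_nonempty_interior)
  then show "aff_dim F = 2" using F by (simp add: facet_of_def)
qed

lemma trace_cell:
  fixes f :: "real^3 \<Rightarrow> 'b::t2_space"
  assumes "K \<in> \<T>" "x \<in> K" "continuous_on UNIV p" "\<And>y. y \<in> interior K \<Longrightarrow> f y = p y"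
  shows "trace K f x = p x"
  by (rule trace_eq[OF cell_properties(1,3)[OF assms(1)] assms(2-4)])

lemma const_Q: "(\<lambda>x. a) \<in> Q \<Omega> \<T> k"
proof -
  have "is_weak_grad \<Omega> (\<lambda>x. a) (\<lambda>x. 0)"
    unfolding is_weak_grad_def
    using integration_by_parts[OF _ subset_refl domain_sets, of _ "\<lambda>x. a"] by simp
  then have "(\<lambda>x. a) \<in> H1 \<Omega>"
    unfolding H1_def
    by (intro CollectI conjI bexI[of _ "\<lambda>x. 0"] L2_const[OF domain_lmeasurable])
  then show ?thesis
    unfolding Q_def by (intro CollectI conjI ballI bexI[of _ "\<lambda>x. a"] Pol_const) simp_all
qed

lemma Q_DG: "f \<in> Q \<Omega> \<T> k \<Longrightarrow> f \<in> DG \<Omega> \<T> k"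
  by (auto simp: Q_def DG_def H1_def)

lemma zero_Q0: "(\<lambda>x. 0) \<in> Q0 \<Omega> \<T> k"
proof -
  have "trace K (\<lambda>x. 0::real) x = 0" if "K \<in> \<T>" "F \<in> boundary_faces \<Omega> K" "x \<in> F" for K F x
    by (rule trace_cell[OF that(1), of x "\<lambda>_. 0"]) (use boundary_face[OF that(1,2)] that(3) in auto)
  then show ?thesis unfolding Q0_def by (intro CollectI conjI const_Q) simp
qed

lemma grad_L2:
  assumes "f \<in> Q \<Omega> \<T> k"
  shows "grad f \<in> L2 \<Omega>"
proof (rule piecewise_L2)
  fix K assume K: "K \<in> \<T>"
  obtain p where p: "p \<in> Pol k" "\<forall>x\<in>interior K. f x = p x" using Q_piecewise[OF assms K] by blast
  have "continuous_on UNIV (grad p)"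
    by (rule continuous_on_vecI) (simp add: grad_def Pol_continuous[OF Pol_pd_same[OF p(1)]])
  moreover have "grad f x = grad p x" if "x \<in> interior K" for x
    by (rule grad_transform[OF open_interior that]) (use p(2) in simp)
  ultimately show "\<exists>q. continuous_on UNIV q \<and> (\<forall>x\<in>interior K. grad f x = q x)" by blast
qed

lemma is_weak_curl_grad:
  assumes f: "f \<in> Q \<Omega> \<T> k"
  shows "is_weak_curl \<Omega> (grad f) (\<lambda>x. 0)"
proof -
  obtain g where g: "g \<in> L2 \<Omega>" "is_weak_grad \<Omega> f g"
    using f unfolding Q_def H1_def by blast
  show ?thesis
    by (rule is_weak_curl_cong_AE[OF g(1) grad_L2[OF f] weak_grad_eq_grad[OF Q_piecewise[OF f] g]
          is_weak_curl_weak_grad[OF g(2,1)]])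
qed

lemma grad_Hcurl:
  assumes "f \<in> Q \<Omega> \<T> k"
  shows "grad f \<in> Hcurl \<Omega>" "AE x in \<mu>. weak_curl \<Omega> (grad f) x = 0"
proof -
  show H: "grad f \<in> Hcurl \<Omega>"
    unfolding Hcurl_def using grad_L2[OF assms] L2_zero is_weak_curl_grad[OF assms] by blast
  show "AE x in \<mu>. weak_curl \<Omega> (grad f) x = 0"
    by (rule weak_curl_unique[OF weak_curl_properties(1)[OF H] L2_zero weak_curl_properties(2)[OF H] is_weak_curl_grad[OF assms]])
qed

text \<open>On a boundary face \<open>f\<close> vanishes, hence so do its tangential derivatives: the trace of the gradient is a
multiple of the normal.\<close>

lemma grad_Q0_Ned0:
  assumes f: "f \<in> Q0 \<Omega> \<T> (k + 1)"
  shows "grad f \<in> Ned0 \<Omega> \<T> k"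
proof -
  have fQ: "f \<in> Q \<Omega> \<T> (k + 1)" using f by (simp add: Q0_def)
  have pw: "\<exists>p\<in>Pol (k + 1). (\<forall>x\<in>interior K. f x = p x) \<and> (\<forall>x\<in>interior K. grad f x = grad p x) \<and> grad p \<in> PolV k
     \<and> continuous_on UNIV (grad p)" if K: "K \<in> \<T>" for K
  proof -
    obtain p where p: "p \<in> Pol (k + 1)" "\<forall>x\<in>interior K. f x = p x" using Q_piecewise[OF fQ K] by blast
    have "grad f x = grad p x" if "x \<in> interior K" for x
      by (rule grad_transform[OF open_interior that]) (use p(2) in simp)
    moreover have "grad p \<in> PolV k" unfolding PolV_def grad_def using p(1) Pol_pd[of p k] by simp
    ultimately show ?thesis using p PolV_continuous by blast
  qed
  have "grad f \<in> Ned \<Omega> \<T> k"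
    unfolding Ned_def
  proof (intro CollectI conjI ballI grad_Hcurl(1)[OF fQ])
    fix K assume "K \<in> \<T>"
    then obtain p where p: "\<forall>x\<in>interior K. grad f x = grad p x" "grad p \<in> PolV k" using pw by blast
    have "(\<lambda>x. 0) \<in> PolV k" by (simp add: PolV_def Pol_const)
    then show "\<exists>p\<in>PolV k. \<exists>q\<in>PolV k. \<forall>x\<in>interior K. grad f x = p x + cross3 x (q x)"
      using p by (intro bexI[of _ "grad p"] bexI[of _ "\<lambda>x. 0"]) auto
  qed
  moreover have "cross3 n (trace K (grad f) x) = 0"
    if K: "K \<in> \<T>" and F: "F \<in> boundary_faces \<Omega> K" and n: "unit_normal F n" and x: "x \<in> F" for K F n x
  proof -
    obtain p where p: "p \<in> Pol (k + 1)" "\<forall>x\<in>interior K. f x = p x"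
      "\<forall>x\<in>interior K. grad f x = grad p x" "continuous_on UNIV (grad p)" using pw[OF K] by blast
    note bf = boundary_face[OF K F]
    have zero: "p y = 0" if "y \<in> F" for y
    proof -
      have "trace K f y = p y"
        using trace_cell[OF K _ Pol_continuous[OF p(1)], of y f] p(2) bf(3) that by blast
      then show ?thesis using f K F that unfolding Q0_def by auto
    qed
    have tr: "trace K (grad f) x = grad p x"
      using trace_cell[OF K _ p(4), of x "grad f"] p(3) bf(3) x by blast
    \<comment> \<open>The tangential part of the gradient, which is also a tangential direction.\<close>
    define t where "t = grad p x - (n \<bullet> grad p x) *\<^sub>R n"
    have nn: "n \<bullet> n = 1" using n by (simp add: unit_normal_def norm_eq_1)
    have nt: "n \<bullet> t = 0" by (simp add: t_def inner_diff_right nn)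
    have "(\<Sum>i\<in>UNIV. t $ i * pd i p x) = 0"
      by (rule tangential_derivative_zero[OF bf(1,2) unit_normal_nonzero[OF n] _ Pol_differentiable[OF p(1)]
            Pol_continuous[OF Pol_pd_same[OF p(1)]] zero x nt])
        (use n in \<open>auto simp: unit_normal_def\<close>)
    then have "t \<bullet> grad p x = 0" by (simp add: inner_vec_def grad_def)
    then have "t \<bullet> t = 0" using nt by (simp add: t_def inner_diff_right inner_commute)
    then have "grad p x = (n \<bullet> grad p x) *\<^sub>R n" by (simp add: t_def)
    then show ?thesis unfolding tr by (metis cross_mult_right cross_refl scaleR_zero_right)
  qed
  ultimately show ?thesis unfolding Ned0_def by blast
qed

lemma Ned_piecewise:
  assumes "f \<in> Ned \<Omega> \<T> k" "K \<in> \<T>"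
  shows "\<exists>p\<in>PolV (Suc k). \<forall>x\<in>interior K. f x = p x"
proof -
  obtain p q where pq: "p \<in> PolV k" "q \<in> PolV k" "\<forall>x\<in>interior K. f x = p x + cross3 x (q x)"
    using assms unfolding Ned_def by blast
  have "(\<lambda>x. p x $ i + (x $ (i + 1) * q x $ (i + 2) - x $ (i + 2) * q x $ (i + 1))) \<in> Pol (Suc k)" for i
    using pq(1,2) unfolding PolV_def by (intro Pol_add Pol_diff Pol_coord_mult) (auto intro: Pol_mono[of k])
  then have "(\<lambda>x. p x + cross3 x (q x)) \<in> PolV (Suc k)"
    unfolding PolV_def by (simp add: cross3_nth)
  then show ?thesis using pq(3) by (intro bexI[of _ "\<lambda>x. p x + cross3 x (q x)"])
qed

lemma RT_piecewise:
  assumes "f \<in> RT \<Omega> \<T> k" "K \<in> \<T>"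
  shows "\<exists>p\<in>PolV (Suc k). \<forall>x\<in>interior K. f x = p x"
proof -
  obtain p q where pq: "p \<in> PolV k" "q \<in> Pol k" "\<forall>x\<in>interior K. f x = p x + q x *\<^sub>R x"
    using assms unfolding RT_def by blast
  have "(\<lambda>x. p x $ i + x $ i * q x) \<in> Pol (Suc k)" for i
    using pq(1,2) unfolding PolV_def by (intro Pol_add Pol_coord_mult) (auto intro: Pol_mono[of k])
  then have "(\<lambda>x. p x + q x *\<^sub>R x) \<in> PolV (Suc k)"
    unfolding PolV_def by (simp add: mult.commute)
  then show ?thesis using pq(3) by (intro bexI[of _ "\<lambda>x. p x + q x *\<^sub>R x"])
qed

lemma RT0_add_scaled:
  assumes f: "f \<in> RT0 \<Omega> \<T> k" and g: "g \<in> RT0 \<Omega> \<T> k"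
  shows "(\<lambda>x. f x + a *\<^sub>R g x) \<in> RT0 \<Omega> \<T> k"
proof -
  have RT: "f \<in> RT \<Omega> \<T> k" "g \<in> RT \<Omega> \<T> k" using f g by (auto simp: RT0_def)
  have H: "f \<in> Hdiv \<Omega>" "g \<in> Hdiv \<Omega>" using RT by (auto simp: RT_def)
  then have L2: "f \<in> L2 \<Omega>" "g \<in> L2 \<Omega>" by (auto simp: Hdiv_def)
  obtain df dg where d: "df \<in> L2 \<Omega>" "is_weak_div \<Omega> f df" "dg \<in> L2 \<Omega>" "is_weak_div \<Omega> g dg"
    using H unfolding Hdiv_def by blast
  have "is_weak_div \<Omega> (\<lambda>x. f x + a *\<^sub>R g x) (\<lambda>x. df x + a *\<^sub>R dg x)"
    unfolding is_weak_div_def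
  proof (intro allI impI)
    fix \<psi> assume \<psi>: "test_function \<Omega> \<psi>"
    note int = L2_inner_integrable[OF L2(1) test_function_grad_L2[OF \<psi>]]
      L2_inner_integrable[OF L2(2) test_function_grad_L2[OF \<psi>]]
      L2_mult_integrable[OF d(1) test_function_L2[OF \<psi>]] L2_mult_integrable[OF d(3) test_function_L2[OF \<psi>]]
    have "(LINT x|\<mu>. (f x + a *\<^sub>R g x) \<bullet> grad \<psi> x)
        = (LINT x|\<mu>. f x \<bullet> grad \<psi> x) + a * (LINT x|\<mu>. g x \<bullet> grad \<psi> x)"
      using int by (simp add: inner_add_left)
    also have "\<dots> = - (LINT x|\<mu>. df x * \<psi> x) + a * - (LINT x|\<mu>. dg x * \<psi> x)"
      using d(2,4)[unfolded is_weak_div_def, rule_format, OF \<psi>] by simp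
    also have "\<dots> = - (LINT x|\<mu>. (df x + a *\<^sub>R dg x) * \<psi> x)"
      using int by (simp add: distrib_right mult.assoc)
    finally show "(LINT x|\<mu>. (f x + a *\<^sub>R g x) \<bullet> grad \<psi> x)
      = - (LINT x|\<mu>. (df x + a *\<^sub>R dg x) * \<psi> x)" .
  qed
  then have "(\<lambda>x. f x + a *\<^sub>R g x) \<in> Hdiv \<Omega>"
    unfolding Hdiv_def using L2_add[OF L2(1) L2_scaleR[OF L2(2)]] L2_add[OF d(1) L2_scaleR[OF d(3)]]
    by (intro CollectI conjI bexI[of _ "\<lambda>x. df x + a *\<^sub>R dg x"])
  moreover have "\<exists>p\<in>PolV k. \<exists>q\<in>Pol k. \<forall>x\<in>interior K. f x + a *\<^sub>R g x = p x + q x *\<^sub>R x" if K: "K \<in> \<T>" for K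
  proof -
    obtain p q p' q' where pq: "p \<in> PolV k" "q \<in> Pol k" "\<forall>x\<in>interior K. f x = p x + q x *\<^sub>R x"
      "p' \<in> PolV k" "q' \<in> Pol k" "\<forall>x\<in>interior K. g x = p' x + q' x *\<^sub>R x"
      using RT K unfolding RT_def by blast
    have "(\<lambda>x. p x + a *\<^sub>R p' x) \<in> PolV k"
      using pq(1,4) Pol_add[OF _ Pol_cmult] by (simp add: PolV_def)
    moreover have "(\<lambda>x. q x + a * q' x) \<in> Pol k"
      by (rule Pol_add[OF pq(2) Pol_cmult[OF pq(5)]])
    ultimately show ?thesis
      by (intro bexI[of _ "\<lambda>x. p x + a *\<^sub>R p' x"] bexI[of _ "\<lambda>x. q x + a * q' x"])
        (use pq(3,6) in \<open>auto simp: algebra_simps\<close>)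
  qed
  moreover have "n \<bullet> trace K (\<lambda>x. f x + a *\<^sub>R g x) x = 0"
    if K: "K \<in> \<T>" and F: "F \<in> boundary_faces \<Omega> K" and n: "unit_normal F n" and x: "x \<in> F" for K F n x
  proof -
    obtain p q where p: "p \<in> PolV (Suc k)" "\<forall>x\<in>interior K. f x = p x" and q: "q \<in> PolV (Suc k)" "\<forall>x\<in>interior K. g x = q x"
      using RT_piecewise[OF RT(1) K] RT_piecewise[OF RT(2) K] by blast
    have xK: "x \<in> K" using boundary_face[OF K F] x by blast
    note c = PolV_continuous[OF p(1)] PolV_continuous[OF q(1)]
    have "trace K f x = p x" by (rule trace_cell[OF K xK c(1)]) (use p(2) in simp)
    moreover have "trace K g x = q x" by (rule trace_cell[OF K xK c(2)]) (use q(2) in simp)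
    moreover have "trace K (\<lambda>x. f x + a *\<^sub>R g x) x = p x + a *\<^sub>R q x"
      by (rule trace_cell[OF K xK]) (use p(2) q(2) in \<open>auto intro!: continuous_intros c\<close>)
    moreover have "n \<bullet> trace K f x = 0" "n \<bullet> trace K g x = 0"
      using f g K F n x unfolding RT0_def by blast+
    ultimately show ?thesis by (simp add: inner_add_right)
  qed
  ultimately show ?thesis unfolding RT0_def RT_def by blast
qed

text \<open>On a boundary face the tangential components of \<open>E\<close> vanish. The normal component of the curl is made of their
tangential derivatives (\<open>cross3_inner_curl\<close>), which vanish as well. The degree fits because \<open>E\<close> has degree \<open>k + 1\<close> on
a cell.\<close>

lemma curl_Ned0_RT0:
  assumes E: "E \<in> Ned0 \<Omega> \<T> k"
  shows "curl E \<in> RT0 \<Omega> \<T> k" "AE x in \<mu>. weak_curl \<Omega> E x = curl E x"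
    "is_weak_div \<Omega> (curl E) (\<lambda>x. 0)"
proof -
  have EN: "E \<in> Ned \<Omega> \<T> k" using E by (simp add: Ned0_def)
  then have H: "E \<in> Hcurl \<Omega>" by (simp add: Ned_def)
  note pw = Ned_piecewise[OF EN] and wc = weak_curl_properties[OF H]
  note L2 = curl_L2[OF pw]
  show ae: "AE x in \<mu>. weak_curl \<Omega> E x = curl E x"
    by (rule weak_curl_eq_curl[OF pw wc])
  show div: "is_weak_div \<Omega> (curl E) (\<lambda>x. 0)"
    by (rule is_weak_div_cong_AE[OF wc(1) L2 ae is_weak_div_weak_curl[OF wc(2)]])
  have pwc: "\<exists>p\<in>PolV (Suc k). (\<forall>x\<in>interior K. E x = p x) \<and> (\<forall>x\<in>interior K. curl E x = curl p x) \<and> curl p \<in> PolV k"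
    if K: "K \<in> \<T>" for K
  proof -
    obtain p where p: "p \<in> PolV (Suc k)" "\<forall>x\<in>interior K. E x = p x" using pw[OF K] by blast
    have "curl E x = curl p x" if x: "x \<in> interior K" for x
      by (rule curl_transform[OF open_interior x]) (use p(2) in simp)
    moreover have "curl p \<in> PolV k"
    proof -
      have pj: "(\<lambda>y. p y $ j) \<in> Pol (Suc k)" for j using p(1) by (simp add: PolV_def)
      have "(\<lambda>x. curl p x $ i) \<in> Pol k" for i
        unfolding curl_nth by (rule Pol_diff[OF Pol_pd[OF pj] Pol_pd[OF pj]])
      then show ?thesis by (simp add: PolV_def)
    qed
    ultimately show ?thesis using p by blast
  qed
  have "curl E \<in> Hdiv \<Omega>" unfolding Hdiv_def using L2 L2_zero div by blast
  moreover have "\<exists>p\<in>PolV k. \<exists>q\<in>Pol k. \<forall>x\<in>interior K. curl E x = p x + q x *\<^sub>R x" if K: "K \<in> \<T>" for K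
  proof -
    obtain p where "\<forall>x\<in>interior K. curl E x = curl p x" "curl p \<in> PolV k" using pwc[OF K] by blast
    then show ?thesis by (intro bexI[of _ "curl p"] bexI[of _ "\<lambda>_. 0"]) (auto intro: Pol_const)
  qed
  moreover have "n \<bullet> trace K (curl E) x = 0"
    if K: "K \<in> \<T>" and F: "F \<in> boundary_faces \<Omega> K" and n: "unit_normal F n" and x: "x \<in> F" for K F n x
  proof -
    obtain p where p: "p \<in> PolV (Suc k)" "\<forall>x\<in>interior K. E x = p x"
      "\<forall>x\<in>interior K. curl E x = curl p x" "curl p \<in> PolV k" using pwc[OF K] by blast
    note bf = boundary_face[OF K F]
    have nn: "norm n = 1" using n by (simp add: unit_normal_def)
    have pj: "(\<lambda>y. p y $ j) \<in> Pol (Suc k)" for j using p(1) by (simp add: PolV_def)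
    have tr: "trace K (curl E) x = curl p x"
      using trace_cell[OF K _ PolV_continuous[OF p(4)], of x "curl E"] p(3) bf(3) x by blast
    have tang: "t \<bullet> p y = 0" if y: "y \<in> F" and t: "n \<bullet> t = 0" for y t
    proof -
      have "trace K E y = p y"
        using trace_cell[OF K _ PolV_continuous[OF p(1)], of y E] p(2) bf(3) y by blast
      then have "cross3 n (p y) = 0" using E K F n y unfolding Ned0_def by force
      then have "cross3 n (cross3 n (p y)) = 0" by simp
      then have "(n \<bullet> p y) *\<^sub>R n = p y"
        using Lagrange[of n n "p y"] nn by (simp add: norm_eq_1)
      then show ?thesis using t by (metis inner_commute inner_scaleR_right mult_zero_right)
    qed
    have deriv: "(\<Sum>i\<in>UNIV. \<Sum>j\<in>UNIV. s $ i * t $ j * pd i (\<lambda>y. p y $ j) x) = 0"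
      if s: "n \<bullet> s = 0" and t: "n \<bullet> t = 0" for s t
    proof -
      \<comment> \<open>The tangential component \<open>t \<bullet> p\<close>, a polynomial that vanishes on the face.\<close>
      let ?g = "\<lambda>y. \<Sum>j\<in>UNIV. t $ j * p y $ j"
      have g: "?g \<in> Pol (Suc k)" unfolding sum_3 by (intro Pol_add Pol_cmult pj)
      have "pd i ?g x = (\<Sum>j\<in>UNIV. t $ j * pd i (\<lambda>y. p y $ j) x)" for i
      proof -
        have D: "((\<lambda>y. p y $ j) has_derivative frechet_derivative (\<lambda>y. p y $ j) (at x)) (at x)" for j
          using Pol_differentiable[OF pj] frechet_derivative_works by blast
        have "(?g has_derivative (\<lambda>v. \<Sum>j\<in>UNIV. t $ j * frechet_derivative (\<lambda>y. p y $ j) (at x) v)) (at x)"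
          by (intro has_derivative_sum has_derivative_mult_right D)
        from pd_eqI[OF this, of i] show ?thesis by (simp add: pd_def)
      qed
      moreover have "(\<Sum>i\<in>UNIV. s $ i * pd i ?g x) = 0"
        by (rule tangential_derivative_zero[OF bf(1,2) unit_normal_nonzero[OF n] _ Pol_differentiable[OF g]
            Pol_continuous[OF Pol_pd_same[OF g]] _ x s])
          (use n tang[OF _ t] in \<open>auto simp: unit_normal_def inner_vec_def\<close>)
      ultimately show ?thesis by (simp add: sum_distrib_left mult.assoc)
    qed
    obtain a b where ab: "n \<bullet> a = 0" "n \<bullet> b = 0" "cross3 a b = n" using orthonormal_frame[OF nn] .
    have "n \<bullet> curl p x = 0"
      using cross3_inner_curl[of a b p x] deriv[OF ab(1,2)] deriv[OF ab(2,1)] ab(3) by simp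
    then show ?thesis unfolding tr .
  qed
  ultimately show "curl E \<in> RT0 \<Omega> \<T> k" unfolding RT0_def RT_def by blast
qed

section \<open>The discrete weak divergence\<close>

lemma Q0_add_scaled:
  assumes f: "f \<in> Q0 \<Omega> \<T> k" and g: "g \<in> Q0 \<Omega> \<T> k"
  shows "(\<lambda>x. f x + a * g x) \<in> Q0 \<Omega> \<T> k"
proof -
  have Q: "f \<in> Q \<Omega> \<T> k" "g \<in> Q \<Omega> \<T> k" using f g by (auto simp: Q0_def)
  have H: "f \<in> H1 \<Omega>" "g \<in> H1 \<Omega>" using Q by (auto simp: Q_def)
  then have L2: "f \<in> L2 \<Omega>" "g \<in> L2 \<Omega>" by (auto simp: H1_def)
  obtain df dg where d: "df \<in> L2 \<Omega>" "is_weak_grad \<Omega> f df" "dg \<in> L2 \<Omega>" "is_weak_grad \<Omega> g dg"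
    using H unfolding H1_def by blast
  have "is_weak_grad \<Omega> (\<lambda>x. f x + a * g x) (\<lambda>x. df x + a *\<^sub>R dg x)"
    unfolding is_weak_grad_def
  proof (intro allI impI)
    fix \<psi> i assume \<psi>: "test_function \<Omega> \<psi>"
    note \<psi>' = test_function_L2[OF \<psi>] test_function_L2[OF test_functionD(3)[OF \<psi>], of i]
    note int = L2_mult_integrable[OF L2(1) \<psi>'(2)] L2_mult_integrable[OF L2(2) \<psi>'(2)]
      L2_mult_integrable[OF L2_nth[OF d(1), of i] \<psi>'(1)] L2_mult_integrable[OF L2_nth[OF d(3), of i] \<psi>'(1)]
    have "(LINT x|\<mu>. (f x + a * g x) * pd i \<psi> x)
        = (LINT x|\<mu>. f x * pd i \<psi> x) + a * (LINT x|\<mu>. g x * pd i \<psi> x)"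
      using int by (simp add: distrib_right mult.assoc)
    also have "\<dots> = - (LINT x|\<mu>. df x $ i * \<psi> x) + a * - (LINT x|\<mu>. dg x $ i * \<psi> x)"
      using d(2,4)[unfolded is_weak_grad_def, rule_format, OF \<psi>] by simp
    also have "\<dots> = - (LINT x|\<mu>. (df x + a *\<^sub>R dg x) $ i * \<psi> x)"
      using int by (simp add: distrib_right mult.assoc)
    finally show "(LINT x|\<mu>. (f x + a * g x) * pd i \<psi> x)
      = - (LINT x|\<mu>. (df x + a *\<^sub>R dg x) $ i * \<psi> x)" .
  qed
  then have "(\<lambda>x. f x + a * g x) \<in> H1 \<Omega>"
    unfolding H1_def using L2_add[OF L2(1) L2_scaleR[OF L2(2), of a]] L2_add[OF d(1) L2_scaleR[OF d(3)]]
    by (intro CollectI conjI bexI[of _ "\<lambda>x. df x + a *\<^sub>R dg x"]) simp_all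
  moreover have "\<exists>p\<in>Pol k. \<forall>x\<in>interior K. f x + a * g x = p x" if K: "K \<in> \<T>" for K
  proof -
    obtain p q where pq: "p \<in> Pol k" "\<forall>x\<in>interior K. f x = p x" "q \<in> Pol k" "\<forall>x\<in>interior K. g x = q x"
      using Q_piecewise[OF Q(1) K] Q_piecewise[OF Q(2) K] by blast
    then show ?thesis
      by (intro bexI[of _ "\<lambda>x. p x + a * q x"] Pol_add[OF pq(1) Pol_cmult[OF pq(3)]]) simp
  qed
  moreover have "trace K (\<lambda>x. f x + a * g x) x = 0"
    if K: "K \<in> \<T>" and F: "F \<in> boundary_faces \<Omega> K" and x: "x \<in> F" for K F x
  proof -
    obtain p q where p: "p \<in> Pol k" "\<forall>x\<in>interior K. f x = p x" and q: "q \<in> Pol k" "\<forall>x\<in>interior K. g x = q x"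
      using Q_piecewise[OF Q(1) K] Q_piecewise[OF Q(2) K] by blast
    have xK: "x \<in> K" using boundary_face[OF K F] x by blast
    note c = Pol_continuous[OF p(1)] Pol_continuous[OF q(1)]
    have "trace K f x = p x" by (rule trace_cell[OF K xK c(1)]) (use p(2) in simp)
    moreover have "trace K g x = q x" by (rule trace_cell[OF K xK c(2)]) (use q(2) in simp)
    moreover have "trace K (\<lambda>x. f x + a * g x) x = p x + a * q x"
      by (rule trace_cell[OF K xK]) (use p(2) q(2) in \<open>auto intro!: continuous_intros c\<close>)
    moreover have "trace K f x = 0" "trace K g x = 0"
      using f g K F x unfolding Q0_def by blast+
    ultimately show ?thesis by simp
  qed
  ultimately show ?thesis unfolding Q0_def Q_def by simp
qed

text \<open>The spanning functions are the monomials cut off to single cells. In general they are discontinuous and span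
a larger space than \<open>Q0\<close>.\<close>

lemma Q0_spanned:
  assumes "f \<in> Q0 \<Omega> \<T> k"
  shows "\<exists>a. \<forall>x\<in>cells_interior. f x = (\<Sum>i\<in>\<T> \<times> {\<alpha>. (\<Sum>i\<in>UNIV. \<alpha> i) \<le> k}.
    a i * (indicator (interior (fst i)) x * monomial (snd i) x))"
proof -
  let ?A = "{\<alpha> :: 3 \<Rightarrow> nat. (\<Sum>i\<in>UNIV. \<alpha> i) \<le> k}"
  have "f \<in> Q \<Omega> \<T> k" using assms by (simp add: Q0_def)
  note pw = Q_piecewise[OF this]
  have "\<exists>a. \<forall>x\<in>interior K. f x = (\<Sum>\<alpha>\<in>?A. a \<alpha> * monomial \<alpha> x)" if K: "K \<in> \<T>" for K
  proof -
    obtain p where p: "p \<in> Pol k" "\<forall>x\<in>interior K. f x = p x" using pw[OF K] by blast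
    obtain a where "p = (\<lambda>x. \<Sum>\<alpha>\<in>?A. a \<alpha> * monomial \<alpha> x)" using p(1) unfolding Pol_iff by blast
    then show ?thesis using p(2) by (intro exI[of _ a]) simp
  qed
  then have "\<forall>K\<in>\<T>. \<exists>a. \<forall>x\<in>interior K. f x = (\<Sum>\<alpha>\<in>?A. a \<alpha> * monomial \<alpha> x)" by blast
  then obtain a where a: "\<And>K x. K \<in> \<T> \<Longrightarrow> x \<in> interior K \<Longrightarrow> f x = (\<Sum>\<alpha>\<in>?A. a K \<alpha> * monomial \<alpha> x)"
    by metis
  have "f x = (\<Sum>i\<in>\<T> \<times> ?A. a (fst i) (snd i) * (indicator (interior (fst i)) x * monomial (snd i) x))"
    if "x \<in> cells_interior" for x
  proof -
    obtain K where K: "K \<in> \<T>" "x \<in> interior K" using \<open>x \<in> cells_interior\<close> by blast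
    have z: "indicator (interior L) x = (0::real)" if "L \<in> \<T> - {K}" for L
      using interiors_disjoint[of K L] interior_subset[of L] K that by (auto simp: indicator_def)
    have "(\<Sum>i\<in>\<T> \<times> ?A. a (fst i) (snd i) * (indicator (interior (fst i)) x * monomial (snd i) x))
        = (\<Sum>L\<in>\<T>. \<Sum>\<alpha>\<in>?A. a L \<alpha> * (indicator (interior L) x * monomial \<alpha> x))"
      by (simp add: sum.cartesian_product case_prod_beta)
    also have "\<dots> = (\<Sum>\<alpha>\<in>?A. a K \<alpha> * (indicator (interior K) x * monomial \<alpha> x))"
      using finite_cells K(1) z by (subst sum.remove[of _ K]) auto
    finally show ?thesis using a K by simp
  qed
  then show ?thesis by (intro exI[of _ "\<lambda>i. a (fst i) (snd i)"]) blast
qed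

text \<open>The Riesz representation applies because a function of \<open>Q0\<close> with zero norm vanishes on every open cell by continuity,
and then so does its gradient.\<close>

lemma nabla_w_property:
  assumes E: "E \<in> L2 \<Omega>"
  shows "nabla_w \<Omega> \<T> k E \<in> Q0 \<Omega> \<T> (k + 1) \<and> (\<forall>\<phi>\<in>Q0 \<Omega> \<T> (k + 1).
    (LINT x|\<mu>. nabla_w \<Omega> \<T> k E x * \<phi> x) = - (LINT x|\<mu>. E x \<bullet> grad \<phi> x))"
proof -
  let ?V = "Q0 \<Omega> \<T> (k + 1)"
  have Q: "f \<in> Q \<Omega> \<T> (k + 1)" if "f \<in> ?V" for f using that by (simp add: Q0_def)
  have L2: "f \<in> L2 \<Omega>" if "f \<in> ?V" for f using Q[OF that] by (simp add: Q_def H1_def)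
  have int: "integrable (\<mu>) (\<lambda>x. E x \<bullet> grad f x)" if "f \<in> ?V" for f
    by (rule L2_inner_integrable[OF E grad_L2[OF Q[OF that]]])
  have diff: "f differentiable (at x)" if f: "f \<in> ?V" and x: "x \<in> cells_interior" for f x
  proof -
    obtain K where K: "K \<in> \<T>" "x \<in> interior K" using x by blast
    obtain p where p: "p \<in> Pol (k + 1)" "\<forall>x\<in>interior K. f x = p x" using Q_piecewise[OF Q[OF f] K(1)] by blast
    obtain D where "(p has_derivative D) (at x)" using Pol_differentiable[OF p(1)] unfolding differentiable_def by blast
    then have "(f has_derivative D) (at x)"
      by (rule has_derivative_transform_within_open[OF _ open_interior K(2)]) (use p(2) in simp)
    then show ?thesis unfolding differentiable_def by blast
  qed
  have "\<exists>d\<in>?V. \<forall>f\<in>?V. (LINT x|\<mu>. d x * f x) = - (LINT x|\<mu>. E x \<bullet> grad f x)"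
  proof (rule Riesz_representation_spanned[OF _ zero_Q0 Q0_add_scaled _ _ _ AE_cells_interior Q0_spanned])
    show "finite (\<T> \<times> {\<alpha> :: 3 \<Rightarrow> nat. (\<Sum>i\<in>UNIV. \<alpha> i) \<le> k + 1})"
      using finite_cells finite_multi_indices by blast
    show "integrable (\<mu>) (\<lambda>x. f x * g x)" if "f \<in> ?V" "g \<in> ?V" for f g
      using L2_mult_integrable L2 that by blast
  next
    fix f g a assume f: "f \<in> ?V" and g: "g \<in> ?V"
    have "(LINT x|\<mu>. E x \<bullet> grad (\<lambda>x. f x + a * g x) x)
        = (LINT x|\<mu>. E x \<bullet> grad f x + a * (E x \<bullet> grad g x))"
    proof (rule integral_cong_AE)
      show "AE x in \<mu>. E x \<bullet> grad (\<lambda>x. f x + a * g x) x = E x \<bullet> grad f x + a * (E x \<bullet> grad g x)"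
        using AE_cells_interior
      proof eventually_elim
        case (elim x)
        have "grad (\<lambda>x. f x + a * g x) x = grad f x + a *\<^sub>R grad g x"
          using diff[OF f elim] diff[OF g elim]
          by (simp add: grad_def vec_eq_iff pd_add pd_cmult differentiable_mult)
        then show ?case by (simp add: inner_add_right)
      qed
    qed (use int f g Q0_add_scaled[OF f g] in auto)
    then show "- (LINT x|\<mu>. E x \<bullet> grad (\<lambda>x. f x + a * g x) x)
        = - (LINT x|\<mu>. E x \<bullet> grad f x) + a * - (LINT x|\<mu>. E x \<bullet> grad g x)"
      using int[OF f] int[OF g] by simp
  next
    fix f assume f: "f \<in> ?V" and z: "(LINT x|\<mu>. f x * f x) = 0"
    have "AE x in \<mu>. f x * f x = 0"
      using integral_nonneg_eq_0_iff_AE[OF L2_mult_integrable[OF L2[OF f] L2[OF f]]] z by simp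
    then have ae: "AE x in lebesgue. x \<in> \<Omega> \<longrightarrow> f x = 0" using domain_sets by (simp add: AE_restrict_space_iff)
    have grad0: "grad f x = 0" if x: "x \<in> cells_interior" for x
    proof -
      obtain K where K: "K \<in> \<T>" "x \<in> interior K" using x by blast
      obtain p where p: "p \<in> Pol (k + 1)" "\<forall>x\<in>interior K. f x = p x" using Q_piecewise[OF Q[OF f] K(1)] by blast
      have "AE y in lebesgue. y \<in> interior K \<longrightarrow> p y = 0"
        using ae p(2) cell_properties(4)[OF K(1)] by (auto elim!: eventually_mono)
      then have "f y = 0" if "y \<in> interior K" for y
        using continuous_AE_zero[OF open_interior Pol_continuous[OF p(1)] _ that] p(2) that by simp
      then have "grad f x = grad (\<lambda>_. 0) x"
        by (rule grad_transform[OF open_interior K(2)])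
      then show ?thesis by (simp add: grad_def vec_eq_iff)
    qed
    have "AE x in \<mu>. E x \<bullet> grad f x = 0"
      using AE_cells_interior by eventually_elim (simp only: grad0 inner_zero_right)
    then show "- (LINT x|\<mu>. E x \<bullet> grad f x) = 0"
      by (simp add: integral_eq_zero_AE)
  qed
  then have "\<exists>d. d \<in> ?V \<and> (\<forall>f\<in>?V. (LINT x|\<mu>. d x * f x) = - (LINT x|\<mu>. E x \<bullet> grad f x))"
    by blast
  from someI_ex[OF this] show ?thesis unfolding nabla_w_def .
qed

section \<open>Conservation over one Euler step\<close>

lemma integral_union_cells:
  fixes f :: sfield
  assumes "f \<in> L2 \<Omega>"
  shows "(LINT x|lebesgue_on (\<Union>\<T>). f x) = (LINT x|\<mu>. f x)"
proof -
  have U: "\<Union>\<T> \<in> sets lebesgue"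
    using finite_cells cell_properties(2) by (intro sets.finite_Union) (auto intro: fmeasurableD[OF lmeasurable_compact])
  have sub: "\<Omega> \<subseteq> \<Union>\<T>" unfolding domain by (rule interior_subset)
  have m: "(\<lambda>x. if x \<in> \<Omega> then f x else 0) \<in> borel_measurable lebesgue"
    using assms domain_sets by (intro borel_measurable_if_I) (auto simp: L2_def)
  have "AE x in lebesgue. x \<notin> \<Union>\<T> - cells_interior"
    using skeleton_negligible unfolding negligible_iff_null_sets by (rule AE_not_in)
  moreover have "cells_interior \<subseteq> \<Omega>" using cell_properties(4) by blast
  ultimately have ae: "AE x in lebesgue. (if x \<in> \<Omega> then f x else 0) = (if x \<in> \<Union>\<T> then f x else 0)"
    using sub by (auto elim!: eventually_mono)
  have "(LINT x|lebesgue_on (\<Union>\<T>). f x) = (LINT x|lebesgue. (if x \<in> \<Union>\<T> then f x else 0))"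
    by (rule Lebesgue_Measure.integral_restrict_UNIV[OF U, symmetric])
  also have "\<dots> = (LINT x|lebesgue. (if x \<in> \<Omega> then f x else 0))"
    by (rule integral_cong_AE[OF m borel_measurable_AE[OF m ae] ae, symmetric])
  also have "\<dots> = (LINT x|\<mu>. f x)"
    by (rule Lebesgue_Measure.integral_restrict_UNIV[OF domain_sets])
  finally show ?thesis .
qed

text \<open>What the conservation laws use of either scheme: the discrete Maxwell equations, and the continuity equation without
face terms and for continuous test functions, both driven by the same current \<open>\<rho> w\<close>. Only its being the same
matters, so the velocity \<open>w\<close> is quantified existentially.\<close>

definition conservative_step ::
  "nat \<Rightarrow> real \<Rightarrow> real \<Rightarrow> real \<Rightarrow> real \<Rightarrow> sfield \<Rightarrow> vfield \<Rightarrow> vfield \<Rightarrow> sfield \<Rightarrow> vfield \<Rightarrow> vfield \<Rightarrow> bool"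
  where "conservative_step k c m e dt \<rho> E B \<rho>' E' B' \<longleftrightarrow>
    (\<exists>w. maxwell_step \<Omega> \<T> k c m e dt \<rho> w E B E' B' \<and> (\<forall>\<phi>\<in>Q \<Omega> \<T> (k + 1).
      (LINT x|\<mu>. (\<rho>' x - \<rho> x) / dt * \<phi> x) = (LINT x|\<mu>. (\<rho> x *\<^sub>R w x) \<bullet> grad \<phi> x)))"

lemma mass_step:
  assumes dt: "dt > 0" and \<rho>: "\<rho> \<in> L2 \<Omega>" "\<rho>' \<in> L2 \<Omega>"
    and step: "conservative_step k c m e dt \<rho> E B \<rho>' E' B'"
  shows "(LINT x|\<mu>. \<rho>' x) = (LINT x|\<mu>. \<rho> x)"
proof -
  obtain w where cont: "\<And>\<phi>. \<phi> \<in> Q \<Omega> \<T> (k + 1) \<Longrightarrow> (LINT x|\<mu>. (\<rho>' x - \<rho> x) / dt * \<phi> x)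
      = (LINT x|\<mu>. (\<rho> x *\<^sub>R w x) \<bullet> grad \<phi> x)"
    using step unfolding conservative_step_def by blast
  have "grad (\<lambda>x. 1) x = 0" for x by (simp add: grad_def vec_eq_iff)
  then have "(LINT x|\<mu>. (\<rho>' x - \<rho> x) / dt) = 0"
    using cont[OF const_Q[of 1]] by simp
  then show ?thesis
    using dt L2_integrable[OF domain_lmeasurable] \<rho> by simp
qed

text \<open>Both sides are rewritten by the defining property of \<open>nabla_w\<close>. The change of the electric term is then given by
Ampere's law tested with \<open>\<nabla>\<phi>\<close>, that of the charge term by the continuity equation tested with \<open>\<phi>\<close>.\<close>

lemma gauss_step:
  assumes dt: "dt > 0"
    and E: "E \<in> Ned0 \<Omega> \<T> k" "E' \<in> Ned0 \<Omega> \<T> k" and \<rho>: "\<rho> \<in> L2 \<Omega>" "\<rho>' \<in> L2 \<Omega>"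
    and step: "conservative_step k c m e dt \<rho> E B \<rho>' E' B'"
    and \<phi>: "\<phi> \<in> Q0 \<Omega> \<T> (k + 1)"
  shows "(LINT x|\<mu>. (nabla_w \<Omega> \<T> k E' x - 4 * pi * e * (\<rho>' x / m)) * \<phi> x) =
    (LINT x|\<mu>. (nabla_w \<Omega> \<T> k E x - 4 * pi * e * (\<rho> x / m)) * \<phi> x)"
proof -
  obtain w where maxwell: "maxwell_step \<Omega> \<T> k c m e dt \<rho> w E B E' B'"
    and cont: "\<And>\<phi>. \<phi> \<in> Q \<Omega> \<T> (k + 1) \<Longrightarrow> (LINT x|\<mu>. (\<rho>' x - \<rho> x) / dt * \<phi> x)
      = (LINT x|\<mu>. (\<rho> x *\<^sub>R w x) \<bullet> grad \<phi> x)"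
    using step unfolding conservative_step_def by blast
  have \<phi>Q: "\<phi> \<in> Q \<Omega> \<T> (k + 1)" using \<phi> by (simp add: Q0_def)
  have \<phi>L2: "\<phi> \<in> L2 \<Omega>" using \<phi>Q by (simp add: Q_def H1_def)
  have EL2: "E \<in> L2 \<Omega>" "E' \<in> L2 \<Omega>" using E by (auto simp: Ned0_def Ned_def Hcurl_def)
  note gL2 = grad_L2[OF \<phi>Q]
  have residual: "(LINT x|\<mu>. (nabla_w \<Omega> \<T> k F x - 4 * pi * e * (\<sigma> x / m)) * \<phi> x)
      = - (LINT x|\<mu>. F x \<bullet> grad \<phi> x) - 4 * pi * e / m * (LINT x|\<mu>. \<sigma> x * \<phi> x)"
    if F: "F \<in> L2 \<Omega>" and \<sigma>: "\<sigma> \<in> L2 \<Omega>" for F \<sigma>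
  proof -
    note nw = nabla_w_property[OF F, of k]
    have "nabla_w \<Omega> \<T> k F \<in> L2 \<Omega>" using nw by (simp add: Q0_def Q_def H1_def)
    note int = L2_mult_integrable[OF this \<phi>L2] L2_mult_integrable[OF \<sigma> \<phi>L2]
    have "(LINT x|\<mu>. (nabla_w \<Omega> \<T> k F x - 4 * pi * e * (\<sigma> x / m)) * \<phi> x)
       = (LINT x|\<mu>. nabla_w \<Omega> \<T> k F x * \<phi> x - 4 * pi * e / m * (\<sigma> x * \<phi> x))"
      by (rule Bochner_Integration.integral_cong) (auto simp: algebra_simps)
    also have "\<dots> = (LINT x|\<mu>. nabla_w \<Omega> \<T> k F x * \<phi> x) - 4 * pi * e / m * (LINT x|\<mu>. \<sigma> x * \<phi> x)"
      by (subst Bochner_Integration.integral_diff) (use int in auto)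
    finally show ?thesis using nw \<phi> by simp
  qed
  have "(LINT x|\<mu>. B x \<bullet> weak_curl \<Omega> (grad \<phi>) x) = 0"
    by (rule integral_eq_zero_AE) (use grad_Hcurl(2)[OF \<phi>Q] in \<open>auto elim!: eventually_mono\<close>)
  then have "(LINT x|\<mu>. ((1/dt) *\<^sub>R (E' x - E x)) \<bullet> grad \<phi> x)
      = - (4 * pi * e / m) * (LINT x|\<mu>. (\<rho> x *\<^sub>R w x) \<bullet> grad \<phi> x)"
    using maxwell grad_Q0_Ned0[OF \<phi>] unfolding maxwell_step_def by simp
  also have "\<dots> = - (4 * pi * e / m) * (LINT x|\<mu>. (\<rho>' x - \<rho> x) / dt * \<phi> x)"
    by (simp only: cont[OF \<phi>Q])
  also have "(LINT x|\<mu>. (\<rho>' x - \<rho> x) / dt * \<phi> x)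
      = (1 / dt) * ((LINT x|\<mu>. \<rho>' x * \<phi> x) - (LINT x|\<mu>. \<rho> x * \<phi> x))"
    using L2_mult_integrable[OF \<rho>(1) \<phi>L2] L2_mult_integrable[OF \<rho>(2) \<phi>L2]
    by (simp add: left_diff_distrib diff_divide_distrib)
  finally have A: "(LINT x|\<mu>. ((1/dt) *\<^sub>R (E' x - E x)) \<bullet> grad \<phi> x)
      = (1 / dt) * (- (4 * pi * e / m) * ((LINT x|\<mu>. \<rho>' x * \<phi> x) - (LINT x|\<mu>. \<rho> x * \<phi> x)))"
    by simp
  have "(LINT x|\<mu>. ((1/dt) *\<^sub>R (E' x - E x)) \<bullet> grad \<phi> x)
      = (1 / dt) * ((LINT x|\<mu>. E' x \<bullet> grad \<phi> x) - (LINT x|\<mu>. E x \<bullet> grad \<phi> x))"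
    using L2_inner_integrable[OF EL2(1) gL2] L2_inner_integrable[OF EL2(2) gL2]
    by (simp add: inner_diff_left)
  then have "(1 / dt) * ((LINT x|\<mu>. E' x \<bullet> grad \<phi> x) - (LINT x|\<mu>. E x \<bullet> grad \<phi> x))
      = (1 / dt) * (- (4 * pi * e / m) * ((LINT x|\<mu>. \<rho>' x * \<phi> x) - (LINT x|\<mu>. \<rho> x * \<phi> x)))"
    using A by (simp only:)
  then have "(LINT x|\<mu>. E' x \<bullet> grad \<phi> x) - (LINT x|\<mu>. E x \<bullet> grad \<phi> x)
      = - (4 * pi * e / m) * ((LINT x|\<mu>. \<rho>' x * \<phi> x) - (LINT x|\<mu>. \<rho> x * \<phi> x))"
    using dt by (subst (asm) mult_left_cancel) simp_all
  then show ?thesis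
    unfolding residual[OF EL2(1) \<rho>(1)] residual[OF EL2(2) \<rho>(2)] by (simp add: algebra_simps)
qed

text \<open>Faraday's law tested with the residual \<open>r = B' - B + c dt curl E\<close> gives \<open>\<integral> r \<bullet> r = 0\<close>. Hence the weak
divergence of \<open>B\<close> is also one of \<open>B'\<close>, and weak divergences are unique up to null sets.\<close>

lemma div_step:
  assumes dt: "dt > 0"
    and E: "E \<in> Ned0 \<Omega> \<T> k" and B: "B \<in> RT0 \<Omega> \<T> k" "B' \<in> RT0 \<Omega> \<T> k"
    and step: "conservative_step k c m e dt \<rho> E B \<rho>' E' B'"
  shows "AE x in \<mu>. weak_div \<Omega> B' x = weak_div \<Omega> B x"
proof -
  obtain w where maxwell: "maxwell_step \<Omega> \<T> k c m e dt \<rho> w E B E' B'"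
    using step unfolding conservative_step_def by blast
  define r where "r x = (B' x + (-1) *\<^sub>R B x) + (c * dt) *\<^sub>R curl E x" for x
  note C = curl_Ned0_RT0[OF E]
  have r: "r \<in> RT0 \<Omega> \<T> k"
    unfolding r_def[abs_def] by (rule RT0_add_scaled[OF RT0_add_scaled[OF B(2,1)] C(1)])
  have L2: "f \<in> L2 \<Omega>" if "f \<in> RT0 \<Omega> \<T> k" for f
    using that by (simp add: RT0_def RT_def Hdiv_def)
  note int = L2_inner_integrable[OF L2[OF B(1)] L2[OF r]] L2_inner_integrable[OF L2[OF B(2)] L2[OF r]]
    L2_inner_integrable[OF L2[OF C(1)] L2[OF r]]
  have wL2: "weak_curl \<Omega> E \<in> L2 \<Omega>"
    using weak_curl_properties(1)[of E] E by (simp add: Ned0_def Ned_def)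
  have "(LINT x|\<mu>. ((1/dt) *\<^sub>R (B' x - B x)) \<bullet> r x) = - c * (LINT x|\<mu>. weak_curl \<Omega> E x \<bullet> r x)"
    using maxwell r unfolding maxwell_step_def by (simp add: inner_commute)
  also have "(LINT x|\<mu>. weak_curl \<Omega> E x \<bullet> r x) = (LINT x|\<mu>. curl E x \<bullet> r x)"
    by (rule integral_inner_cong_AE[OF wL2 L2[OF C(1)] L2[OF r] C(2)])
  finally have "(1 / dt) * ((LINT x|\<mu>. B' x \<bullet> r x) - (LINT x|\<mu>. B x \<bullet> r x))
      = - c * (LINT x|\<mu>. curl E x \<bullet> r x)"
    using int by (simp add: inner_diff_left)
  then have *: "(LINT x|\<mu>. B' x \<bullet> r x) - (LINT x|\<mu>. B x \<bullet> r x)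
      + c * dt * (LINT x|\<mu>. curl E x \<bullet> r x) = 0"
    using dt by (simp add: field_simps)
  have "(LINT x|\<mu>. r x \<bullet> r x)
      = (LINT x|\<mu>. B' x \<bullet> r x - B x \<bullet> r x + c * dt * (curl E x \<bullet> r x))"
  proof (rule Bochner_Integration.integral_cong[OF refl])
    fix x
    have "r x \<bullet> v = B' x \<bullet> v - B x \<bullet> v + c * dt * (curl E x \<bullet> v)" for v
      by (simp add: r_def inner_add_left inner_diff_left)
    then show "r x \<bullet> r x = B' x \<bullet> r x - B x \<bullet> r x + c * dt * (curl E x \<bullet> r x)" .
  qed
  also have "\<dots> = 0" using int * by simp
  finally have "AE x in \<mu>. r x \<bullet> r x = 0"
    using integral_nonneg_eq_0_iff_AE[OF L2_inner_integrable[OF L2[OF r] L2[OF r]]] by simp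
  then have r0: "AE x in \<mu>. r x = (\<lambda>_. 0) x" by simp
  have H: "B \<in> Hdiv \<Omega>" "B' \<in> Hdiv \<Omega>" using B by (simp_all add: RT0_def RT_def)
  note d = weak_div_properties[OF H(1)] weak_div_properties[OF H(2)]
  have "is_weak_div \<Omega> B' (weak_div \<Omega> B)"
    unfolding is_weak_div_def
  proof (intro allI impI)
    fix \<psi> assume \<psi>: "test_function \<Omega> \<psi>"
    note g = test_function_grad_L2[OF \<psi>]
    have "(LINT x|\<mu>. r x \<bullet> grad \<psi> x) = 0"
      using integral_inner_cong_AE[OF L2[OF r] L2_zero g r0] by simp
    moreover have "(LINT x|\<mu>. r x \<bullet> grad \<psi> x)
        = (LINT x|\<mu>. B' x \<bullet> grad \<psi> x) - (LINT x|\<mu>. B x \<bullet> grad \<psi> x)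
          + c * dt * (LINT x|\<mu>. curl E x \<bullet> grad \<psi> x)"
      using L2_inner_integrable[OF L2[OF B(1)] g] L2_inner_integrable[OF L2[OF B(2)] g]
        L2_inner_integrable[OF L2[OF C(1)] g] by (simp add: r_def inner_add_left inner_diff_left)
    moreover have "(LINT x|\<mu>. curl E x \<bullet> grad \<psi> x) = 0"
      using C(3)[unfolded is_weak_div_def, rule_format, OF \<psi>] by simp
    moreover have "(LINT x|\<mu>. B x \<bullet> grad \<psi> x) = - (LINT x|\<mu>. weak_div \<Omega> B x * \<psi> x)"
      using d(2)[unfolded is_weak_div_def, rule_format, OF \<psi>] .
    ultimately show "(LINT x|\<mu>. B' x \<bullet> grad \<psi> x) = - (LINT x|\<mu>. weak_div \<Omega> B x * \<psi> x)"
      by simp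
  qed
  then show ?thesis by (rule weak_div_unique[OF d(3,1,4)])
qed

lemma step_S0_conservative:
  "step_S0 \<Omega> \<T> k c m e dt \<rho> M E B \<rho>' M' E' B' \<Longrightarrow> conservative_step k c m e dt \<rho> E B \<rho>' E' B'"
  unfolding step_S0_def conservative_step_def Let_def by blast

text \<open>The face terms contain the jump of the test function as a factor, which is zero for a function of \<open>Q\<close>.\<close>

lemma step_F0_conservative:
  assumes "step_F0 \<Omega> \<T> k c m e dt \<rho> M E B \<rho>' M' E' B'"
  shows "conservative_step k c m e dt \<rho> E B \<rho>' E' B'"
proof -
  define w where "w = L2_projection \<Omega> (RT \<Omega> \<T> k) (w_expr c m \<rho> M)"
  have mx: "maxwell_step \<Omega> \<T> k c m e dt \<rho> w E B E' B'"
    using assms unfolding step_F0_def Let_def w_def by blast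
  have dg: "(LINT x|\<mu>. (\<rho>' x - \<rho> x) / dt * \<phi> x) =
      (LINT x|\<mu>. (\<rho> x *\<^sub>R w x) \<bullet> grad \<phi> x)
      - (\<Sum>F\<in>interior_faces \<T>. face_integral F
          (\<lambda>x. upwind \<T> M F (\<lambda>y. \<rho> y *\<^sub>R w y) x \<bullet> jump_s \<T> F \<phi> x))" if "\<phi> \<in> DG \<Omega> \<T> (k + 1)" for \<phi>
    using assms that unfolding step_F0_def Let_def w_def by blast
  have "(LINT x|\<mu>. (\<rho>' x - \<rho> x) / dt * \<phi> x) = (LINT x|\<mu>. (\<rho> x *\<^sub>R w x) \<bullet> grad \<phi> x)"
    if \<phi>: "\<phi> \<in> Q \<Omega> \<T> (k + 1)" for \<phi>
  proof -
    have "face_integral F (\<lambda>x. upwind \<T> M F (\<lambda>y. \<rho> y *\<^sub>R w y) x \<bullet> jump_s \<T> F \<phi> x) = 0"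
      if "F \<in> interior_faces \<T>" for F
      by (rule face_integral_zero) (simp add: jump_s_Q_zero[OF \<phi> that])
    then show ?thesis using dg[OF Q_DG[OF \<phi>]] by simp
  qed
  then show ?thesis unfolding conservative_step_def using mx by blast
qed

end

theorem proposition4p3:
  fixes \<Omega> :: "(real^3) set" and \<T> :: "(real^3) set set" and k :: nat
    and c m e dt :: real
    and \<rho> :: "nat \<Rightarrow> real^3 \<Rightarrow> real"
    and M E B :: "nat \<Rightarrow> real^3 \<Rightarrow> real^3"
  assumes "open \<Omega>" and "connected \<Omega>" and "bounded \<Omega>" and "\<Omega> \<noteq> {}"
    and "conforming_mesh \<Omega> \<T>"
    and "c > 0" and "m > 0" and "e \<noteq> 0" and "dt > 0"
    and "\<And>n. nowhere_zero \<T> (\<rho> n)"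
    and "euler_S0 \<Omega> \<T> k c m e dt \<rho> M E B \<or> euler_F0 \<Omega> \<T> k c m e dt \<rho> M E B"
  shows "(\<forall>n. (LINT x|lebesgue_on (\<Union>\<T>). \<rho> n x) = (LINT x|lebesgue_on (\<Union>\<T>). \<rho> 0 x)) \<and>
    (\<forall>\<phi>\<in>Q0 \<Omega> \<T> (k+1). \<forall>n.
      (LINT x|lebesgue_on \<Omega>. (nabla_w \<Omega> \<T> k (E n) x - 4 * pi * e * (\<rho> n x / m)) * \<phi> x) =
      (LINT x|lebesgue_on \<Omega>. (nabla_w \<Omega> \<T> k (E 0) x - 4 * pi * e * (\<rho> 0 x / m)) * \<phi> x)) \<and>
    (\<forall>n. AE x in lebesgue_on \<Omega>. weak_div \<Omega> (B n) x = weak_div \<Omega> (B 0) x)"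
proof -
  interpret mesh \<Omega> \<T> using assms(3,5) by unfold_locales
  have EB: "E n \<in> Ned0 \<Omega> \<T> k" "B n \<in> RT0 \<Omega> \<T> k" for n
    using assms(11) unfolding euler_S0_def euler_F0_def by blast+
  have "\<rho> n \<in> DG \<Omega> \<T> (k + 1)" for n
    using assms(11) Q_DG unfolding euler_S0_def euler_F0_def by blast
  then have \<rho>: "\<rho> n \<in> L2 \<Omega>" for n by (simp add: DG_def)
  have step: "conservative_step k c m e dt (\<rho> n) (E n) (B n) (\<rho> (Suc n)) (E (Suc n)) (B (Suc n))" for n
    using assms(11)
  proof
    assume "euler_S0 \<Omega> \<T> k c m e dt \<rho> M E B"
    then show ?thesis
      unfolding euler_S0_def using step_S0_conservative[of k c m e dt "\<rho> n" "M n"] by blast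
  next
    assume "euler_F0 \<Omega> \<T> k c m e dt \<rho> M E B"
    then show ?thesis
      unfolding euler_F0_def using step_F0_conservative[of k c m e dt "\<rho> n" "M n"] by blast
  qed
  have mass: "(LINT x|lebesgue_on \<Omega>. \<rho> n x) = (LINT x|lebesgue_on \<Omega>. \<rho> 0 x)" for n
  proof (induction n)
    case (Suc n)
    then show ?case using mass_step[OF assms(9) \<rho> \<rho> step] by simp
  qed simp
  have gauss: "(LINT x|lebesgue_on \<Omega>. (nabla_w \<Omega> \<T> k (E n) x - 4 * pi * e * (\<rho> n x / m)) * \<phi> x) =
      (LINT x|lebesgue_on \<Omega>. (nabla_w \<Omega> \<T> k (E 0) x - 4 * pi * e * (\<rho> 0 x / m)) * \<phi> x)"
    if \<phi>: "\<phi> \<in> Q0 \<Omega> \<T> (k + 1)" for \<phi> n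
  proof (induction n)
    case (Suc n)
    show ?case
      using gauss_step[OF assms(9) EB(1) EB(1) \<rho> \<rho> step \<phi>] Suc by simp
  qed simp
  have div: "AE x in lebesgue_on \<Omega>. weak_div \<Omega> (B n) x = weak_div \<Omega> (B 0) x" for n
  proof (induction n)
    case (Suc n)
    show ?case
      using div_step[OF assms(9) EB(1) EB(2) EB(2) step, of n] Suc by eventually_elim simp
  qed simp
  show ?thesis
    unfolding integral_union_cells[OF \<rho>] by (intro conjI allI ballI mass gauss div)
qed

end
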